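(* Let $s\in(0,1)$, let $\Omega\subset\mathbb{R}^n$ be a bounded smooth domain, and let $f\in C^1(\mathbb{R})$ be a strictly convex function with $f(0)=0$. Let $u\in H^s_\Omega$ be a nonnegative $L^1$-weak stable solution to $$(-\Delta)^su=f(u)\ \text{ in }\Omega,\qquad u=0\ \text{ in }\mathbb{R}^n\setminus\Omega.$$ Then $u\equiv0$ and $f'(0)\le\lambda_1$, where $\lambda_1>0$ is the first eigenvalue of $(-\Delta)^s$ in $\Omega$ with zero exterior Dirichlet condition.
   Context: Fractional Laplacian: $(-\Delta)^s w(x)=c_{n,s}\int_{\mathbb{R}^n}\frac{w(x)-w(y)}{|x-y|^{n+2s}}\,dy$ (principal value), with $c_{n,s}>0$ a normalizing constant. Put $d_\Omega=\mathrm{dist}(\cdot,\partial\Omega)$ and $\Omega^c=\mathbb{R}^n\setminus\Omega$. Energy space: $H^s_\Omega=\{w:\mathbb{R}^n\to\mathbb{R}: w\in L^2(\Omega),\ [w]_{H^s_\Omega}<+\infty\}$, where $[w]^2_{H^s_\Omega}=\frac{c_{n,s}}{2}\iint_{\mathbb{R}^{2n}\setminus(\Omega^c\times\Omega^c)}\frac{|w(x)-w(y)|^2}{|x-y|^{n+2s}}\,dx\,dy$; $H^s_{\Omega,0}=\{w\in H^s_\Omega: w=0\text{ a.e. in }\mathbb{R}^n\setminus\Omega\}$. The first eigenvalue is $\lambda_1=\min\{[w]^2_{H^s_\Omega}/\|w\|^2_{L^2(\Omega)}: w\in H^s_{\Omega,0}\setminus\{0\}\}$. $L^1$-weak solution: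 $u$ is an $L^1$-weak solution to $(-\Delta)^su=f(u)$ in $\Omega$, $u=0$ in $\mathbb{R}^n\setminus\Omega$, if $u\in L^1(\Omega)$, $f(u)\in L^1(\Omega,d_\Omega^s\,dx)$, $u=0$ in $\mathbb{R}^n\setminus\Omega$, and $\int_\Omega u(-\Delta)^s\varphi\,dx=\int_\Omega f(u)\varphi\,dx$ for every $\varphi$ such that $\varphi$ and $(-\Delta)^s\varphi$ are bounded in $\Omega$ and $\varphi\equiv0$ in $\mathbb{R}^n\setminus\Omega$. Stability: such a solution $u$ is stable in $\Omega$ if $f'(u)\in L^1_{\mathrm{loc}}(\Omega)$ and $\int_\Omega f'(u)\xi^2\,dx\le[\xi]^2_{H^s_\Omega}$ for every $\xi\in C^\infty_c(\Omega)$. *)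

theory Defs
  imports "HOL-Analysis.Analysis"
begin

section \<open>Smooth functions and smooth domains\<close>

text \<open>The regularity class C^k on an open set; class k + 1 means that the function is
  differentiable and all its directional derivatives are of class k.\<close>

primrec Ck_on :: "nat \<Rightarrow> ('a::euclidean_space \<Rightarrow> real) \<Rightarrow> 'a set \<Rightarrow> bool" where
  "Ck_on 0 f S \<longleftrightarrow> continuous_on S f"
| "Ck_on (Suc k) f S \<longleftrightarrow> (\<forall>x\<in>S. f differentiable (at x)) \<and>
     (\<forall>v. Ck_on k (\<lambda>x. frechet_derivative f (at x) v) S)"

definition smooth :: "('a::euclidean_space \<Rightarrow> real) \<Rightarrow> bool" where
  "smooth f \<longleftrightarrow> (\<forall>k. Ck_on k f UNIV)"

definition test_functions :: "'a::euclidean_space set \<Rightarrow> ('a \<Rightarrow> real) set" where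
  "test_functions \<Omega> =
     {\<xi>. smooth \<xi> \<and> compact (closure {x. \<xi> x \<noteq> 0}) \<and> closure {x. \<xi> x \<noteq> 0} \<subseteq> \<Omega>}"

text \<open>Near each boundary point the domain is, in suitable orthonormal coordinates with last axis
  \<open>e\<close>, the strict epigraph of a smooth function. The graph function \<open>\<gamma>\<close> is evaluated only on the
  hyperplane orthogonal to \<open>e\<close>; a smooth function on that hyperplane extends to the whole space
  by composition with the projection.\<close>

definition smooth_boundary :: "'a::euclidean_space set \<Rightarrow> bool" where
  "smooth_boundary \<Omega> \<longleftrightarrow>
     (\<forall>p\<in>frontier \<Omega>. \<exists>r>0. \<exists>e \<gamma>. norm e = 1 \<and> smooth \<gamma> \<and>
        \<Omega> \<inter> ball p r = {x \<in> ball p r. \<gamma> (x - (x \<bullet> e) *\<^sub>R e) < x \<bullet> e})"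

definition bounded_smooth_domain :: "'a::euclidean_space set \<Rightarrow> bool" where
  "bounded_smooth_domain \<Omega> \<longleftrightarrow>
     open \<Omega> \<and> connected \<Omega> \<and> \<Omega> \<noteq> {} \<and> bounded \<Omega> \<and> smooth_boundary \<Omega>"

definition strictly_convex :: "(real \<Rightarrow> real) \<Rightarrow> bool" where
  "strictly_convex f \<longleftrightarrow> (\<forall>x y t. x \<noteq> y \<longrightarrow> 0 < t \<longrightarrow> t < 1 \<longrightarrow>
     f ((1 - t) * x + t * y) < (1 - t) * f x + t * f y)"


section \<open>The fractional Laplacian\<close>

text \<open>Throughout, \<open>c\<close> stands for the normalizing constant and \<open>s\<close> for the order. The integral is a
  principal value, so the value at a point need not exist; \<open>frac_laplacian\<close> is meaningful
  only at points where \<open>has_frac_laplacian\<close> holds for some value.\<close>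

definition has_frac_laplacian ::
    "real \<Rightarrow> real \<Rightarrow> ('a::euclidean_space \<Rightarrow> real) \<Rightarrow> 'a \<Rightarrow> real \<Rightarrow> bool" where
  "has_frac_laplacian c s w x L \<longleftrightarrow>
     (\<forall>\<epsilon>>0. set_integrable lebesgue {y. \<epsilon> < norm (x - y)}
        (\<lambda>y. (w x - w y) / norm (x - y) powr (real DIM('a) + 2 * s))) \<and>
     ((\<lambda>\<epsilon>. c * (LINT y:{y. \<epsilon> < norm (x - y)}|lebesgue.
        (w x - w y) / norm (x - y) powr (real DIM('a) + 2 * s))) \<longlongrightarrow> L) (at_right 0)"

definition frac_laplacian :: "real \<Rightarrow> real \<Rightarrow> ('a::euclidean_space \<Rightarrow> real) \<Rightarrow> 'a \<Rightarrow> real" where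
  "frac_laplacian c s w x = (THE L. has_frac_laplacian c s w x L)"


section \<open>Energy space and first eigenvalue\<close>

text \<open>The squared seminorm, with values in \<open>[0, \<infinity>]\<close>. On the (null) diagonal the quotient is
  \<open>0 / 0 = 0\<close>.\<close>

definition energy :: "real \<Rightarrow> real \<Rightarrow> 'a::euclidean_space set \<Rightarrow> ('a \<Rightarrow> real) \<Rightarrow> ennreal" where
  "energy c s \<Omega> w = ennreal (c / 2) *
     (\<integral>\<^sup>+ z \<in> UNIV - (- \<Omega>) \<times> (- \<Omega>). (case z of (x, y) \<Rightarrow>
        ennreal (\<bar>w x - w y\<bar>\<^sup>2 / norm (x - y) powr (real DIM('a) + 2 * s)))
      \<partial>(lebesgue :: ('a \<times> 'a) measure))"

definition energy_space :: "real \<Rightarrow> real \<Rightarrow> 'a::euclidean_space set \<Rightarrow> ('a \<Rightarrow> real) set" where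
  "energy_space c s \<Omega> = {w. w \<in> borel_measurable lebesgue \<and>
     set_integrable lebesgue \<Omega> (\<lambda>x. (w x)\<^sup>2) \<and> energy c s \<Omega> w < \<infinity>}"

definition energy_space0 :: "real \<Rightarrow> real \<Rightarrow> 'a::euclidean_space set \<Rightarrow> ('a \<Rightarrow> real) set" where
  "energy_space0 c s \<Omega> = {w \<in> energy_space c s \<Omega>. AE x in lebesgue. x \<notin> \<Omega> \<longrightarrow> w x = 0}"

text \<open>The minimum of the Rayleigh quotient. Nonzero elements of the energy space are
  the functions that do not vanish almost everywhere.\<close>

definition first_eigenvalue :: "real \<Rightarrow> real \<Rightarrow> 'a::euclidean_space set \<Rightarrow> real" where
  "first_eigenvalue c s \<Omega> = (LEAST r. \<exists>w \<in> energy_space0 c s \<Omega>.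
     \<not> (AE x in lebesgue. w x = 0) \<and>
     r = enn2real (energy c s \<Omega> w) / (LINT x:\<Omega>|lebesgue. (w x)\<^sup>2))"


section \<open>Weak solutions and stability\<close>

text \<open>In the test class, the principal value defining the fractional Laplacian of \<open>\<phi>\<close> is
  required to exist at every point of \<open>\<Omega>\<close>.\<close>

definition L1_weak_solution ::
    "real \<Rightarrow> real \<Rightarrow> 'a::euclidean_space set \<Rightarrow> (real \<Rightarrow> real) \<Rightarrow> ('a \<Rightarrow> real) \<Rightarrow> bool" where
  "L1_weak_solution c s \<Omega> f u \<longleftrightarrow>
     set_integrable lebesgue \<Omega> u \<and>
     set_integrable lebesgue \<Omega> (\<lambda>x. f (u x) * infdist x (frontier \<Omega>) powr s) \<and>
     (AE x in lebesgue. x \<notin> \<Omega> \<longrightarrow> u x = 0) \<and>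
     (\<forall>\<phi>. \<phi> \<in> borel_measurable lebesgue \<and> bounded (\<phi> ` \<Omega>) \<and> (\<forall>x. x \<notin> \<Omega> \<longrightarrow> \<phi> x = 0) \<and>
        (\<forall>x\<in>\<Omega>. \<exists>L. has_frac_laplacian c s \<phi> x L) \<and> bounded (frac_laplacian c s \<phi> ` \<Omega>) \<longrightarrow>
        (LINT x:\<Omega>|lebesgue. u x * frac_laplacian c s \<phi> x) =
        (LINT x:\<Omega>|lebesgue. f (u x) * \<phi> x))"

definition stable ::
    "real \<Rightarrow> real \<Rightarrow> 'a::euclidean_space set \<Rightarrow> (real \<Rightarrow> real) \<Rightarrow> ('a \<Rightarrow> real) \<Rightarrow> bool" where
  "stable c s \<Omega> f u \<longleftrightarrow>
     (\<forall>K. compact K \<and> K \<subseteq> \<Omega> \<longrightarrow> set_integrable lebesgue K (\<lambda>x. deriv f (u x))) \<and>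
     (\<forall>\<xi>\<in>test_functions \<Omega>.
        (LINT x:\<Omega>|lebesgue. deriv f (u x) * (\<xi> x)\<^sup>2) \<le> enn2real (energy c s \<Omega> \<xi>))"

end

theory Submission
  imports Defs "HOL-Library.Diagonal_Subsequence"
begin

text \<open>Test both the equation and the stability inequality with \<open>u\<close> itself: the first gives
  \<open>[u]\<^sup>2 = \<integral> f(u) u\<close>, the second \<open>\<integral> f'(u) u\<^sup>2 \<le> [u]\<^sup>2\<close>, and strict convexity with \<open>f 0 = 0\<close> gives
  \<open>f'(t) t > f(t)\<close> for \<open>t > 0\<close>, so \<open>u = 0\<close>; stability of \<open>0\<close> is then the bound on \<open>f' 0\<close>.

  Admissibility of \<open>u\<close> rests on the density of test functions in the energy space with zero exterior
  data: cut off by Lipschitz tents, push each boundary piece into the domain by a translation, and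
  mollify. Both operations average translates \<open>(x, y) \<mapsto> (x - h, y - h)\<close> of the difference quotient,
  so convergence is continuity of translations in \<open>L\<^sup>2\<close> of the product space. Since \<open>f(u)\<close> and
  \<open>f'(u)\<close> are only locally integrable, the linear part at \<open>0\<close> is split off: with
  \<open>h = f'(u) - f' 0 \<ge> 0\<close> Fatou's lemma passes to the limit in the stability inequality, and with
  \<open>g = f(u) - f' 0 u \<ge> 0\<close> the equation is tested with \<open>min u \<xi>\<close> for test functions \<open>\<xi> \<rightarrow> u\<close>, where
  \<open>g min u \<xi> \<le> g u \<le> h u\<^sup>2\<close>.

  The minimum defining the first eigenvalue is attained by a Rellich argument: on a cube of side
  \<open>\<delta>\<close> the variance of a function is controlled by \<open>\<delta>\<close> to the power \<open>2 s\<close> times its seminorm, so it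
  suffices that the averages over the cubes converge.\<close>

subsection \<open>Lebesgue measure\<close>

text \<open>\<open>f(u)\<close> is integrable only against a power of the distance to the boundary
  and \<open>f'(u)\<close> only on compact sets, so \<open>u\<close> is not directly admissible in
  either relation, and neither integrand has a known sign. Subtracting the linear part at 0 supplies
  the sign, because \<open>u\<close> is nonnegative and \<open>f\<close> convex; the price is a
  multiple of \<open>u\<^sup>2\<close>, harmless since \<open>u\<close> is square integrable. The
  two limits then need different approximations. In the stability inequality, Fatou asks only for
  nonnegativity and a.e. convergence. In the equation, the limit needs domination, which
  \<open>\<xi>\<close> alone does not give. \<open>min u \<xi>\<close> gives it but is not smooth,
  so the equation is first extended from test functions to bounded functions of finite seminorm with
  compact support in the domain.

  The analysis is carried out for Borel functions that vanish everywhere off the domain, where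
  Fubini and translations of the product space are available. The Lebesgue measurable data are
  converted only at the end.\<close>

lemma lborel_distr_diff_left: "distr lborel borel (\<lambda>x. t - x) = (lborel :: 'a::euclidean_space measure)"
  by (subst (2) lborel_affine[of "-1" t], auto simp: density_1)

lemma lborel_distr_diff_right: "distr lborel borel (\<lambda>x. x - t) = (lborel :: 'a::euclidean_space measure)"
proof -
  have "(+) (- t) = (\<lambda>x. x - t)" by auto
  then show ?thesis using lborel_distr_plus[of "-t"] by simp
qed

lemma nn_integral_lborel_diff_right:
  fixes t :: "'a::euclidean_space"
  assumes [measurable]: "f \<in> borel_measurable borel"
  shows "(\<integral>\<^sup>+x. f (x - t) \<partial>lborel) = (\<integral>\<^sup>+x. f x \<partial>lborel)"
proof -
  have "(\<integral>\<^sup>+x. f x \<partial>lborel) = (\<integral>\<^sup>+x. f x \<partial>distr lborel borel (\<lambda>x. x - t))"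
    by (simp add: lborel_distr_diff_right)
  then show ?thesis by (subst (asm) nn_integral_distr) auto
qed

lemma nn_integral_lborel_diff_left:
  fixes t :: "'a::euclidean_space"
  assumes [measurable]: "f \<in> borel_measurable borel"
  shows "(\<integral>\<^sup>+x. f (t - x) \<partial>lborel) = (\<integral>\<^sup>+x. f x \<partial>lborel)"
proof -
  have "(\<integral>\<^sup>+x. f x \<partial>lborel) = (\<integral>\<^sup>+x. f x \<partial>distr lborel borel (\<lambda>x. t - x))"
    by (simp add: lborel_distr_diff_left)
  then show ?thesis by (subst (asm) nn_integral_distr) auto
qed

lemma integral_lborel_diff_left:
  fixes t :: "'a::euclidean_space" and f :: "'a \<Rightarrow> real"
  assumes [measurable]: "f \<in> borel_measurable borel"
  shows "(LINT x|lborel. f (t - x)) = (LINT x|lborel. f x)"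
proof -
  have "(LINT x|lborel. f x) = (LINT x|distr lborel borel (\<lambda>x. t - x). f x)"
    by (simp add: lborel_distr_diff_left)
  then show ?thesis by (subst (asm) integral_distr) auto
qed

text \<open>The bad pairs lie in \<open>N \<times> UNIV \<union> UNIV \<times> N\<close>, a union of
  two null rectangles. This carries changes on null sets and a.e. limits over to integrals over
  pairs.\<close>

lemma AE_lborel_pair:
  assumes "AE x in (lborel::'a::euclidean_space measure). P x"
  shows "AE z in (lborel::('a \<times> 'a) measure). P (fst z) \<and> P (snd z)"
proof -
  obtain N where N: "N \<in> null_sets (lborel::'a measure)" "{x. \<not> P x} \<subseteq> N"
    using assms unfolding eventually_ae_filter by auto
  have NN[measurable]: "N \<in> sets borel" and N0: "emeasure lborel N = 0" using N(1) by auto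
  have m: "N \<times> UNIV \<in> sets (borel::('a\<times>'a) measure)" "UNIV \<times> N \<in> sets (borel::('a\<times>'a) measure)"
    by (auto intro!: borel_Times)
  have "emeasure (lborel \<Otimes>\<^sub>M (lborel::'a measure)) (N \<times> UNIV) = 0"
    "emeasure (lborel \<Otimes>\<^sub>M (lborel::'a measure)) (UNIV \<times> N) = 0"
    using N0 by (subst lborel.emeasure_pair_measure_Times; simp)+
  then have "N \<times> UNIV \<in> null_sets (lborel::('a\<times>'a) measure)" "UNIV \<times> N \<in> null_sets (lborel::('a\<times>'a) measure)"
    using m by (auto simp: lborel_prod null_sets_def)
  then have "N \<times> UNIV \<union> UNIV \<times> N \<in> null_sets (lborel::('a\<times>'a) measure)" by auto
  then show ?thesis by (rule AE_I') (use N(2) in auto)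
qed

lemma borel_representative:
  fixes w :: "'a::euclidean_space \<Rightarrow> real"
  assumes "w \<in> borel_measurable lebesgue"
  obtains v where "v \<in> borel_measurable borel" "AE x in lborel. w x = v x"
  using completion_ex_borel_measurable_real[OF assms] by auto

subsection \<open>The square integral and its continuity under translations\<close>

text \<open>Extended-valued, so that inequalities need no integrability; the type is left general
  because it is used both on the space and, for difference quotients, on pairs.\<close>

definition l2 :: "('a::euclidean_space \<Rightarrow> real) \<Rightarrow> ennreal" where
  "l2 f = (\<integral>\<^sup>+x. ennreal ((f x)\<^sup>2) \<partial>lborel)"

lemma l2_mono: "(\<And>x. \<bar>f x\<bar> \<le> \<bar>g x\<bar>) \<Longrightarrow> l2 f \<le> l2 g"
  unfolding l2_def by (intro nn_integral_mono ennreal_leI) (metis power2_abs power_mono abs_ge_zero)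

lemma l2_cmult: "f \<in> borel_measurable borel \<Longrightarrow> l2 (\<lambda>x. a * f x) = ennreal (a\<^sup>2) * l2 f"
  unfolding l2_def by (subst nn_integral_cmult[symmetric]) (auto simp: power_mult_distrib ennreal_mult)

lemma l2_uminus: "l2 (\<lambda>x. - f x) = l2 f"
  unfolding l2_def by simp

lemma l2_diff_right: "f \<in> borel_measurable borel \<Longrightarrow> l2 (\<lambda>x. f (x - h)) = l2 f"
  unfolding l2_def by (rule nn_integral_lborel_diff_right) auto

text \<open>Young's inequality \<open>2 a b \<le> \<delta> a\<^sup>2 + b\<^sup>2 / \<delta>\<close>,
  integrated. With \<open>\<delta> = 1\<close> it is the triangle inequality with factor 2 used
  below, free of square roots.\<close>

lemma l2_add_weighted:
  assumes [measurable]: "f \<in> borel_measurable borel" "g \<in> borel_measurable borel" and "0 < \<delta>"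
  shows "l2 (\<lambda>x. f x + g x) \<le> ennreal (1 + \<delta>) * l2 f + ennreal (1 + 1 / \<delta>) * l2 g"
proof -
  have *: "(a + b)\<^sup>2 \<le> (1 + \<delta>) * a\<^sup>2 + (1 + 1 / \<delta>) * b\<^sup>2" for a b :: real
  proof -
    have "0 \<le> (\<delta> * a - b)\<^sup>2 / \<delta>" using \<open>0 < \<delta>\<close> by simp
    then show ?thesis using \<open>0 < \<delta>\<close> by (simp add: field_simps power2_eq_square)
  qed
  have "l2 (\<lambda>x. f x + g x) \<le> (\<integral>\<^sup>+x. ennreal (1 + \<delta>) * ennreal ((f x)\<^sup>2) + ennreal (1 + 1 / \<delta>) * ennreal ((g x)\<^sup>2) \<partial>lborel)"
    unfolding l2_def
    using * \<open>0 < \<delta>\<close> by (intro nn_integral_mono) (simp flip: ennreal_mult ennreal_plus)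
  also have "\<dots> = ennreal (1 + \<delta>) * l2 f + ennreal (1 + 1 / \<delta>) * l2 g"
    unfolding l2_def by (subst nn_integral_add) (auto simp: nn_integral_cmult)
  finally show ?thesis .
qed

lemma l2_add_le:
  assumes [measurable]: "f \<in> borel_measurable borel" "g \<in> borel_measurable borel"
  shows "l2 (\<lambda>x. f x + g x) \<le> 2 * l2 f + 2 * l2 g"
  using l2_add_weighted[OF assms, of 1] by simp

lemma l2_diff_le:
  assumes [measurable]: "f \<in> borel_measurable borel" "g \<in> borel_measurable borel"
  shows "l2 (\<lambda>x. f x - g x) \<le> 2 * l2 f + 2 * l2 g"
  using l2_add_le[of f "\<lambda>x. - g x"] by (simp add: l2_uminus)

lemma l2_finite_integrable:
  assumes "f \<in> borel_measurable borel" "l2 f < \<infinity>"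
  shows "integrable lborel (\<lambda>x. (f x)\<^sup>2)" "(LINT x|lborel. (f x)\<^sup>2) = enn2real (l2 f)"
  using assms unfolding l2_def by (auto intro!: integrableI_bounded simp: integral_eq_nn_integral)

lemma integrable_l2: 
  assumes "integrable lborel (\<lambda>x. (f x)\<^sup>2)" shows "l2 f = ennreal (LINT x|lborel. (f x)\<^sup>2)"
  using assms unfolding l2_def by (intro nn_integral_eq_integral) auto

lemma l2_product_integrable:
  assumes [measurable]: "f \<in> borel_measurable borel" "g \<in> borel_measurable borel"
    and "l2 f < \<infinity>" "l2 g < \<infinity>"
  shows "integrable lborel (\<lambda>x. f x * g x)"
proof (rule Bochner_Integration.integrable_bound)
  show "integrable lborel (\<lambda>x. (f x)\<^sup>2 + (g x)\<^sup>2)"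
    using l2_finite_integrable(1)[OF assms(1,3)] l2_finite_integrable(1)[OF assms(2,4)] by auto
  have "\<bar>a * b\<bar> \<le> a\<^sup>2 + b\<^sup>2" for a b :: real
  proof -
    have "2 * (\<bar>a\<bar> * \<bar>b\<bar>) \<le> a\<^sup>2 + b\<^sup>2" using sum_squares_bound[of "\<bar>a\<bar>" "\<bar>b\<bar>"] by simp
    moreover have "0 \<le> \<bar>a\<bar> * \<bar>b\<bar>" by simp
    ultimately show ?thesis unfolding abs_mult by linarith
  qed
  then show "AE x in lborel. norm (f x * g x) \<le> norm ((f x)\<^sup>2 + (g x)\<^sup>2)" by auto
qed simp

lemma tendsto_0_ennreal_le:
  fixes f g :: "'a \<Rightarrow> ennreal"
  assumes "\<And>x. f x \<le> g x" "(g \<longlongrightarrow> 0) F"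
  shows "(f \<longlongrightarrow> 0) F"
  by (rule tendsto_sandwich[OF _ _ tendsto_const assms(2)]) (use assms(1) in auto)

section \<open>Continuity of translations in the mean and in square mean\<close>

definition L1_shift_continuous :: "('a::euclidean_space \<Rightarrow> real) \<Rightarrow> bool" where
  "L1_shift_continuous f \<longleftrightarrow>
     (\<forall>h. h \<longlonglongrightarrow> 0 \<longrightarrow> (\<lambda>k. \<integral>\<^sup>+x. ennreal \<bar>f (x - h k) - f x\<bar> \<partial>lborel) \<longlonglongrightarrow> 0)"

text \<open>The usual splitting into three errors; two of them coincide, because translation does
  not change the distance from \<open>f\<close> to \<open>g\<close>.\<close>

lemma L1_shift_continuous_approx:
  fixes f :: "'a::euclidean_space \<Rightarrow> real"
  assumes [measurable]: "f \<in> borel_measurable borel"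
    and approx: "\<And>e. 0 < e \<Longrightarrow> \<exists>g. g \<in> borel_measurable borel \<and> L1_shift_continuous g \<and>
                   (\<integral>\<^sup>+x. ennreal \<bar>f x - g x\<bar> \<partial>lborel) \<le> ennreal e"
  shows "L1_shift_continuous f"
  unfolding L1_shift_continuous_def
proof (intro allI impI)
  fix h :: "nat \<Rightarrow> 'a" assume h: "h \<longlonglongrightarrow> 0"
  let ?I = "\<lambda>f k. \<integral>\<^sup>+x. ennreal \<bar>f (x - h k) - f x\<bar> \<partial>lborel"
  show "?I f \<longlonglongrightarrow> 0"
    unfolding order_tendsto_iff
  proof safe
    fix E :: ennreal assume "0 < E"
    then obtain y where y: "0 < y" "y < E" using dense by blast
    define e where "e = enn2real y"
    have ye: "y = ennreal e" using y unfolding e_def by (metis ennreal_enn2real order_less_le_trans top_greatest)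
    have e: "0 < e" "ennreal e < E" using y by (auto simp: ye)
    have e3: "0 < e / 3" using e by simp
    obtain g where g[measurable]: "g \<in> borel_measurable borel" and gc: "L1_shift_continuous g"
      and ge: "(\<integral>\<^sup>+x. ennreal \<bar>f x - g x\<bar> \<partial>lborel) \<le> ennreal (e / 3)"
      using approx[OF e3] by auto
    have "\<forall>\<^sub>F k in sequentially. ?I g k < ennreal (e / 3)"
      using gc h e3 unfolding L1_shift_continuous_def by (intro order_tendstoD(2)[of _ 0]) auto
    then show "\<forall>\<^sub>F k in sequentially. ?I f k < E"
    proof eventually_elim
      case (elim k)
      have "?I f k \<le> (\<integral>\<^sup>+x. ennreal \<bar>f (x - h k) - g (x - h k)\<bar> + (ennreal \<bar>g (x - h k) - g x\<bar> + ennreal \<bar>f x - g x\<bar>) \<partial>lborel)"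
        by (intro nn_integral_mono) (simp flip: ennreal_plus)
      also have "\<dots> = (\<integral>\<^sup>+x. ennreal \<bar>f (x - h k) - g (x - h k)\<bar> \<partial>lborel) + (?I g k + (\<integral>\<^sup>+x. ennreal \<bar>f x - g x\<bar> \<partial>lborel))"
        by (simp add: nn_integral_add)
      also have "(\<integral>\<^sup>+x. ennreal \<bar>f (x - h k) - g (x - h k)\<bar> \<partial>lborel) = (\<integral>\<^sup>+x. ennreal \<bar>f x - g x\<bar> \<partial>lborel)"
        by (rule nn_integral_lborel_diff_right[of "\<lambda>x. ennreal \<bar>f x - g x\<bar>"]) simp
      also have "\<dots> + (?I g k + (\<integral>\<^sup>+x. ennreal \<bar>f x - g x\<bar> \<partial>lborel)) \<le> ennreal (e/3) + (ennreal (e/3) + ennreal (e/3))"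
        using ge elim by (intro add_mono) auto
      also have "\<dots> = ennreal e" using e by (simp flip: ennreal_plus)
      finally show ?case using e by order
    qed
  qed simp
qed

text \<open>Openness keeps each point of \<open>U\<close> inside after small shifts, so the part of
  \<open>U\<close> that is lost vanishes by dominated convergence. The part gained lies outside
  \<open>U\<close>, where boundary points defeat this argument; but a shift preserves the finite
  measure of \<open>U\<close>, so loss and gain are equal.\<close>

lemma L1_shift_continuous_open:
  fixes U :: "'a::euclidean_space set"
  assumes U: "open U" "emeasure lborel U < \<infinity>"
  shows "L1_shift_continuous (indicator U)"
  unfolding L1_shift_continuous_def
proof (intro allI impI)
  fix h :: "nat \<Rightarrow> 'a" assume h: "h \<longlonglongrightarrow> 0"
  have [measurable]: "U \<in> sets borel" using U by simp
  define a where "a k = (\<integral>\<^sup>+x. indicator (U \<inter> {x. x - h k \<notin> U}) x \<partial>lborel)" for k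
  define b where "b k = (\<integral>\<^sup>+x. indicator {x. x \<notin> U \<and> x - h k \<in> U} x \<partial>lborel)" for k
  define m where "m k = (\<integral>\<^sup>+x. indicator {x. x \<in> U \<and> x - h k \<in> U} x \<partial>lborel)" for k
  have am: "a k + m k = emeasure lborel U" for k
    unfolding a_def m_def by (subst nn_integral_add[symmetric]) (auto simp flip: nn_integral_indicator intro!: nn_integral_cong split: split_indicator)
  have "b k + m k = (\<integral>\<^sup>+x. indicator U (x - h k) \<partial>lborel)" for k
    unfolding b_def m_def by (subst nn_integral_add[symmetric]) (auto simp flip: nn_integral_indicator intro!: nn_integral_cong split: split_indicator)
  then have bm: "b k + m k = emeasure lborel U" for k
    by (simp add: nn_integral_lborel_diff_right)
  have ab: "a k = b k" for k
  proof -
    have "m k \<noteq> top" using am[of k] U(2) by auto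
    moreover have "m k + a k = m k + b k" using am[of k] bm[of k] by (simp add: add.commute)
    ultimately show ?thesis by (simp add: ennreal_add_left_cancel)
  qed
  have "(\<lambda>k. a k) \<longlonglongrightarrow> (\<integral>\<^sup>+x. 0 \<partial>(lborel::'a measure))"
    unfolding a_def
  proof (rule nn_integral_dominated_convergence[where w="indicator U"])
    show "(\<integral>\<^sup>+x. indicator U x \<partial>lborel) < \<infinity>" using U by simp
    show "AE x in lborel. (\<lambda>k. indicator (U \<inter> {x. x - h k \<notin> U}) x :: ennreal) \<longlonglongrightarrow> 0"
    proof (rule AE_I2, cases)
      fix x assume "x \<in> U"
      have "(\<lambda>k. x - h k) \<longlonglongrightarrow> x - 0" by (intro tendsto_intros h)
      then have "\<forall>\<^sub>F k in sequentially. x - h k \<in> U" using U(1) \<open>x \<in> U\<close> by (auto simp: topological_tendstoD)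
      then have "\<forall>\<^sub>F k in sequentially. (indicator (U \<inter> {x. x - h k \<notin> U}) x :: ennreal) = 0"
        by eventually_elim auto
      then show "(\<lambda>k. indicator (U \<inter> {x. x - h k \<notin> U}) x :: ennreal) \<longlonglongrightarrow> 0"
        by (rule tendsto_eventually)
    qed auto
  qed (auto split: split_indicator)
  then have a0: "a \<longlonglongrightarrow> 0" by simp
  have "(\<integral>\<^sup>+x. ennreal \<bar>indicator U (x - h k) - indicator U x\<bar> \<partial>lborel) = a k + b k" for k
    unfolding a_def b_def by (subst nn_integral_add[symmetric]) (auto intro!: nn_integral_cong split: split_indicator)
  then show "(\<lambda>k. \<integral>\<^sup>+x. ennreal \<bar>indicator U (x - h k) - indicator U x\<bar> \<partial>lborel) \<longlonglongrightarrow> 0"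
    using tendsto_add[OF a0 a0] by (simp add: ab)
qed

lemma L1_shift_continuous_add:
  fixes f g :: "'a::euclidean_space \<Rightarrow> real"
  assumes [measurable]: "f \<in> borel_measurable borel" "g \<in> borel_measurable borel"
    and f: "L1_shift_continuous f" and g: "L1_shift_continuous g"
  shows "L1_shift_continuous (\<lambda>x. f x + g x)"
  unfolding L1_shift_continuous_def
proof (intro allI impI)
  fix h :: "nat \<Rightarrow> 'a" assume h: "h \<longlonglongrightarrow> 0"
  let ?I = "\<lambda>f k. \<integral>\<^sup>+x. ennreal \<bar>f (x - h k) - f x\<bar> \<partial>lborel"
  have le: "?I (\<lambda>x. f x + g x) k \<le> ?I f k + ?I g k" for k
    by (subst nn_integral_add[symmetric]) (auto intro!: nn_integral_mono simp flip: ennreal_plus)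
  have "(\<lambda>k. ?I f k + ?I g k) \<longlonglongrightarrow> 0 + 0"
    using f g h unfolding L1_shift_continuous_def by (intro tendsto_add) auto
  then show "?I (\<lambda>x. f x + g x) \<longlonglongrightarrow> 0"
    by (intro tendsto_0_ennreal_le[OF le]) simp
qed

text \<open>Outer regularity reduces Borel sets of finite measure to open sets; sums and dominated
  limits then give all integrable functions.\<close>

lemma L1_shift_continuous_integrable:
  fixes f :: "'a::euclidean_space \<Rightarrow> real"
  assumes "integrable lborel f"
  shows "L1_shift_continuous f"
  using assms
proof (induction rule: integrable_induct)
  case (base A c)
  then have Am[measurable]: "A \<in> sets borel" and Af: "emeasure lborel A < \<infinity>" by auto
  have A: "L1_shift_continuous (indicator A :: 'a \<Rightarrow> real)"
  proof (rule L1_shift_continuous_approx)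
    fix e :: real assume "0 < e"
    obtain U where U: "open U" "A \<subseteq> U" "U - A \<in> lmeasurable" "emeasure lebesgue (U - A) < ennreal e"
      using sets_lebesgue_outer_open[of A, OF _ \<open>0 < e\<close>] Am by auto
    have [measurable]: "U \<in> sets borel" using U by simp
    have "emeasure lborel U \<le> emeasure lborel A + emeasure lborel (U - A)"
      using U(2) by (subst plus_emeasure) (auto intro!: emeasure_mono)
    also have "\<dots> < \<infinity>" using Af order_less_trans[OF U(4) ennreal_less_top] U(1)
      by (simp add: ennreal_add_eq_top less_top)
    finally have "L1_shift_continuous (indicator U :: 'a \<Rightarrow> real)" by (rule L1_shift_continuous_open[OF U(1)])
    moreover have "(\<integral>\<^sup>+x. ennreal \<bar>indicator A x - indicator U x\<bar> \<partial>lborel) = (\<integral>\<^sup>+x. indicator (U - A) x \<partial>lborel)"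
      using U(2) by (intro nn_integral_cong) (auto split: split_indicator)
    ultimately show "\<exists>g. g \<in> borel_measurable borel \<and> L1_shift_continuous g \<and>
                   (\<integral>\<^sup>+x. ennreal \<bar>indicator A x - g x\<bar> \<partial>lborel) \<le> ennreal e"
      using U(4) by (intro exI[of _ "indicator U"]) auto
  qed simp
  show ?case
    unfolding L1_shift_continuous_def
  proof (intro allI impI)
    fix h :: "nat \<Rightarrow> 'a" assume h: "h \<longlonglongrightarrow> 0"
    let ?I = "\<lambda>k. \<integral>\<^sup>+x. ennreal \<bar>indicator A (x - h k) - indicator A x\<bar> \<partial>lborel"
    have "ennreal \<bar>indicator A (x - h k) *\<^sub>R c - indicator A x *\<^sub>R c\<bar> = ennreal \<bar>c\<bar> * ennreal \<bar>indicator A (x - h k) - indicator A x\<bar>" for x k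
      by (simp flip: ennreal_mult abs_mult add: algebra_simps)
    then have "(\<integral>\<^sup>+x. ennreal \<bar>indicator A (x - h k) *\<^sub>R c - indicator A x *\<^sub>R c\<bar> \<partial>lborel) = ennreal \<bar>c\<bar> * ?I k" for k
      by (simp add: nn_integral_cmult)
    moreover have "(\<lambda>k. ennreal \<bar>c\<bar> * ?I k) \<longlonglongrightarrow> ennreal \<bar>c\<bar> * 0"
      using A h unfolding L1_shift_continuous_def by (intro ennreal_tendsto_cmult) auto
    ultimately show "(\<lambda>k. \<integral>\<^sup>+x. ennreal \<bar>indicator A (x - h k) *\<^sub>R c - indicator A x *\<^sub>R c\<bar> \<partial>lborel) \<longlonglongrightarrow> 0"
      by simp
  qed
next
  case (add f g)
  then show ?case by (intro L1_shift_continuous_add) auto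
next
  case (lim f s)
  have [measurable]: "f \<in> borel_measurable borel" "\<And>i. s i \<in> borel_measurable borel" using lim by (auto dest: borel_measurable_integrable)
  have "(\<lambda>i. \<integral>\<^sup>+x. ennreal \<bar>f x - s i x\<bar> \<partial>lborel) \<longlonglongrightarrow> (\<integral>\<^sup>+x. 0 \<partial>(lborel::'a measure))"
  \<comment> \<open>The induction principle supplies
    \<open>\<bar>s j x\<bar> \<le> 2 * \<bar>f x\<bar>\<close>, hence the factor 3 for the
    difference.\<close>
  proof (rule nn_integral_dominated_convergence[where w="\<lambda>x. ennreal (3 * \<bar>f x\<bar>)"])
    show "AE x in lborel. ennreal \<bar>f x - s j x\<bar> \<le> ennreal (3 * \<bar>f x\<bar>)" for j
    proof (rule AE_I2)
      fix x show "ennreal \<bar>f x - s j x\<bar> \<le> ennreal (3 * \<bar>f x\<bar>)"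
        using lim(3)[of x j] by (intro ennreal_leI) auto
    qed
    have "integrable lborel (\<lambda>x. 3 * \<bar>f x\<bar>)" using lim by auto
    then show "(\<integral>\<^sup>+ x. ennreal (3 * \<bar>f x\<bar>) \<partial>lborel) < \<infinity>" 
      by (simp add: nn_integral_eq_integral)
    show "AE x in lborel. (\<lambda>i. ennreal \<bar>f x - s i x\<bar>) \<longlonglongrightarrow> 0"
    proof (rule AE_I2)
      fix x
      have "(\<lambda>i. \<bar>f x - s i x\<bar>) \<longlonglongrightarrow> \<bar>f x - f x\<bar>"
        using lim(2)[of x] by (intro tendsto_intros) auto
      then have "(\<lambda>i. ennreal \<bar>f x - s i x\<bar>) \<longlonglongrightarrow> ennreal \<bar>f x - f x\<bar>" by (rule tendsto_ennrealI)
      then show "(\<lambda>i. ennreal \<bar>f x - s i x\<bar>) \<longlonglongrightarrow> 0" by simp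
    qed
  qed auto
  then have l: "(\<lambda>i. \<integral>\<^sup>+x. ennreal \<bar>f x - s i x\<bar> \<partial>lborel) \<longlonglongrightarrow> 0" by simp
  show ?case
  proof (rule L1_shift_continuous_approx)
    fix e :: real assume "0 < e"
    then have "\<forall>\<^sub>F i in sequentially. (\<integral>\<^sup>+x. ennreal \<bar>f x - s i x\<bar> \<partial>lborel) < ennreal e"
      using l by (auto simp: order_tendsto_iff)
    then obtain i where "(\<integral>\<^sup>+x. ennreal \<bar>f x - s i x\<bar> \<partial>lborel) < ennreal e"
      using eventually_happens'[OF sequentially_bot] by blast
    then show "\<exists>g. g \<in> borel_measurable borel \<and> L1_shift_continuous g \<and>
                   (\<integral>\<^sup>+x. ennreal \<bar>f x - g x\<bar> \<partial>lborel) \<le> ennreal e"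
      using lim(5)[of i] by (intro exI[of _ "s i"]) auto
  qed simp
qed

text \<open>Continuity in \<open>L\<^sup>2\<close> is reduced to \<open>L\<^sup>1\<close> through
  \<open>(a - b)\<^sup>2 \<le> 2 \<bar>a \<bar>a\<bar> - b \<bar>b\<bar>\<bar>\<close>.\<close>

lemma l2_shift_continuous:
  fixes f :: "'a::euclidean_space \<Rightarrow> real"
  assumes [measurable]: "f \<in> borel_measurable borel" and fin: "l2 f < \<infinity>" and "0 < e"
  shows "\<exists>d>0. \<forall>h. norm h < d \<longrightarrow> l2 (\<lambda>x. f (x - h) - f x) < e"
proof -
  define F where "F x = f x * \<bar>f x\<bar>" for x
  have [measurable]: "F \<in> borel_measurable borel" unfolding F_def by simp
  have "integrable lborel F" unfolding F_def
    by (rule l2_product_integrable) (use fin in \<open>simp_all add: l2_def\<close>)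
  then have F: "L1_shift_continuous F" by (rule L1_shift_continuous_integrable)
  \<comment> \<open>For equal signs the right side factors as
    \<open>\<bar>a - b\<bar> * (\<bar>a\<bar> + \<bar>b\<bar>)\<close>; for opposite signs the
    modulus is \<open>a\<^sup>2 + b\<^sup>2\<close>, at least half of
    \<open>(a - b)\<^sup>2\<close>.\<close>
  have key: "(a - b)\<^sup>2 \<le> 2 * \<bar>a * \<bar>a\<bar> - b * \<bar>b\<bar>\<bar>" for a b :: real
  proof (cases "0 \<le> a * b")
    case True
    then have "(0 \<le> a \<and> 0 \<le> b) \<or> (a \<le> 0 \<and> b \<le> 0)" by (simp add: zero_le_mult_iff)
    then have eq: "\<bar>a * \<bar>a\<bar> - b * \<bar>b\<bar>\<bar> = \<bar>a - b\<bar> * (\<bar>a\<bar> + \<bar>b\<bar>)"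
    proof
      assume "0 \<le> a \<and> 0 \<le> b"
      then have "a * \<bar>a\<bar> - b * \<bar>b\<bar> = (a - b) * (\<bar>a\<bar> + \<bar>b\<bar>)" by (simp add: algebra_simps)
      then show ?thesis by (simp add: abs_mult)
    next
      assume "a \<le> 0 \<and> b \<le> 0"
      then have "a * \<bar>a\<bar> - b * \<bar>b\<bar> = (a - b) * (\<bar>a\<bar> + \<bar>b\<bar>)" by (simp add: algebra_simps)
      then show ?thesis by (simp add: abs_mult)
    qed
    have "(a - b)\<^sup>2 = \<bar>a - b\<bar> * \<bar>a - b\<bar>" by (simp add: power2_eq_square)
    also have "\<dots> \<le> \<bar>a - b\<bar> * (\<bar>a\<bar> + \<bar>b\<bar>)" by (intro mult_left_mono) auto
    also have "\<dots> \<le> 2 * (\<bar>a - b\<bar> * (\<bar>a\<bar> + \<bar>b\<bar>))" by simp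
    finally show ?thesis unfolding eq .
  next
    case False
    then have "(0 < a \<and> b < 0) \<or> (a < 0 \<and> 0 < b)" by (simp add: not_le mult_less_0_iff)
    then have "\<bar>a * \<bar>a\<bar> - b * \<bar>b\<bar>\<bar> = a\<^sup>2 + b\<^sup>2"
      by (auto simp: power2_eq_square)
    moreover have "0 \<le> (a + b)\<^sup>2" by simp
    ultimately show ?thesis by (simp add: power2_eq_square algebra_simps)
  qed
  have le: "l2 (\<lambda>x. f (x - h) - f x) \<le> 2 * (\<integral>\<^sup>+x. ennreal \<bar>F (x - h) - F x\<bar> \<partial>lborel)" for h
  proof -
    have "ennreal ((f (x - h) - f x)\<^sup>2) \<le> 2 * ennreal \<bar>F (x - h) - F x\<bar>" for x
    proof -
      have "ennreal ((f (x - h) - f x)\<^sup>2) \<le> ennreal (2 * \<bar>F (x - h) - F x\<bar>)"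
        using key[of "f (x - h)" "f x"] by (auto intro: ennreal_leI simp: F_def)
      then show ?thesis by (simp add: ennreal_mult)
    qed
    then show ?thesis unfolding l2_def
      by (subst nn_integral_cmult[symmetric]) (auto intro!: nn_integral_mono)
  qed
  have "((\<lambda>h. l2 (\<lambda>x. f (x - h) - f x)) \<longlongrightarrow> 0) (at 0)"
    unfolding tendsto_at_iff_sequentially comp_def
  proof (intro allI impI)
    fix h :: "nat \<Rightarrow> 'a" assume h: "h \<longlonglongrightarrow> 0"
    have "(\<lambda>k. 2 * (\<integral>\<^sup>+x. ennreal \<bar>F (x - h k) - F x\<bar> \<partial>lborel)) \<longlonglongrightarrow> 2 * 0"
      using F h unfolding L1_shift_continuous_def by (intro ennreal_tendsto_cmult) auto
    then show "(\<lambda>k. l2 (\<lambda>x. f (x - h k) - f x)) \<longlonglongrightarrow> 0"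
      using tendsto_0_ennreal_le[OF le, of h sequentially] by simp
  qed
  then have "\<forall>\<^sub>F h in at 0. l2 (\<lambda>x. f (x - h) - f x) < e"
    using \<open>0 < e\<close> by (rule order_tendstoD(2))
  then obtain d where d: "0 < d" "\<And>h. h \<noteq> 0 \<Longrightarrow> dist h 0 < d \<Longrightarrow> l2 (\<lambda>x. f (x - h) - f x) < e"
    unfolding eventually_at by auto
  \<comment> \<open>The punctured filter \<open>at 0\<close> says nothing about the zero shift,
    which is added by hand.\<close>
  have "l2 (\<lambda>x. f (x - 0) - f x) < e" using \<open>0 < e\<close> by (simp add: l2_def)
  with d show ?thesis by (metis dist_0_norm dist_commute)
qed

subsection \<open>The kernel\<close>

text \<open>At the origin \<open>0 powr a = 0\<close> and \<open>1 / 0 = 0\<close> give the value 0,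
  in agreement with the convention on the diagonal in \<open>energy\<close>.\<close>

definition kern :: "real \<Rightarrow> 'a::euclidean_space \<Rightarrow> real" where
  "kern s z = 1 / norm z powr (real DIM('a) + 2 * s)"

lemma kern_nonneg [simp]: "0 \<le> kern s z"
  by (simp add: kern_def)

lemma kern_minus [simp]: "kern s (- z) = kern s z"
  by (simp add: kern_def)

lemma kern_diff_commute: "kern s (x - y) = kern s (y - x)"
  by (simp add: kern_def norm_minus_commute)

lemma kern_measurable [measurable]: "kern s \<in> borel_measurable borel"
  unfolding kern_def by measurable

text \<open>Dyadic shells: for \<open>2 ^ m \<le> norm z < 2 ^ (m + 1)\<close> the kernel is at most
  \<open>2 powr (- m (n + 2 s))\<close>, while the enclosing ball has volume of order
  \<open>2 powr (m n)\<close>. The outer shells sum geometrically with ratio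
  \<open>2 powr (- 2 s)\<close>, which needs \<open>0 < s\<close>. On the inner ones the factor
  \<open>(norm z)\<^sup>2\<close> produces the ratio \<open>2 powr (2 s - 2)\<close>, which needs
  \<open>s < 1\<close>.\<close>

lemma kern_integrable_min:
  assumes "0 < s" "s < 1"
  shows "integrable lborel (\<lambda>z::'a::euclidean_space. min 1 ((norm z)\<^sup>2) * kern s z)"
proof -
  define n where "n = real DIM('a)"
  define \<omega> where "\<omega> = unit_ball_vol n"
  have \<omega>: "0 \<le> \<omega>" by (simp add: \<omega>_def n_def)
  \<comment> \<open>\<open>A k\<close> dominates on the shell \<open>m = k\<close>,
    \<open>B k\<close> on the shell \<open>m = - k - 1\<close>. Both live on full balls instead of
    shells, so only the volume of a ball has to be known.\<close>
  define A where "A k z = ennreal (2 powr (- real k * (n + 2 * s))) * (indicator (ball 0 (2 powr (real k + 1))) z :: ennreal)"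
    for k :: nat and z :: 'a
  define B where "B k z = ennreal (2 powr (- 2 * real k + (real k + 1) * (n + 2 * s))) * (indicator (ball 0 (2 powr (- real k))) z :: ennreal)"
    for k :: nat and z :: 'a
  have [measurable]: "A k \<in> borel_measurable lborel" for k
    unfolding A_def by (intro borel_measurable_times_ennreal borel_measurable_const borel_measurable_indicator) simp
  have [measurable]: "B k \<in> borel_measurable lborel" for k
    unfolding B_def by (intro borel_measurable_times_ennreal borel_measurable_const borel_measurable_indicator) simp
  have vol: "emeasure lborel (ball (0::'a) (2 powr t)) = ennreal (\<omega> * 2 powr (t * n))" for t
    by (subst emeasure_ball) (simp_all add: \<omega>_def n_def powr_realpow[symmetric] powr_powr)
  have iA: "(\<integral>\<^sup>+z. A k z \<partial>lborel) = ennreal (\<omega> * 2 powr n * (2 powr (- 2 * s)) ^ k)" for k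
  proof -
    have "(\<integral>\<^sup>+z. A k z \<partial>lborel) = ennreal (2 powr (- real k * (n + 2 * s))) * ennreal (\<omega> * 2 powr ((real k + 1) * n))"
      unfolding A_def by (subst nn_integral_cmult_indicator) (simp_all add: vol)
    also have "\<dots> = ennreal (\<omega> * (2 powr (- real k * (n + 2 * s)) * 2 powr ((real k + 1) * n)))"
      using \<omega> by (simp flip: ennreal_mult add: ac_simps)
    also have "2 powr (- real k * (n + 2 * s)) * 2 powr ((real k + 1) * n) = 2 powr n * 2 powr (- 2 * s * real k)"
      by (simp flip: powr_add add: algebra_simps)
    also have "2 powr (- 2 * s * real k) = (2 powr (- 2 * s)) ^ k"
      by (simp add: powr_realpow[symmetric] powr_powr)
    finally show ?thesis by (simp add: mult.assoc)
  qed
  have iB: "(\<integral>\<^sup>+z. B k z \<partial>lborel) = ennreal (\<omega> * 2 powr (n + 2 * s) * (2 powr (2 * s - 2)) ^ k)" for k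
  proof -
    have "(\<integral>\<^sup>+z. B k z \<partial>lborel) = ennreal (2 powr (- 2 * real k + (real k + 1) * (n + 2 * s))) * ennreal (\<omega> * 2 powr (- real k * n))"
      unfolding B_def by (subst nn_integral_cmult_indicator) (simp_all add: vol)
    also have "\<dots> = ennreal (\<omega> * (2 powr (- 2 * real k + (real k + 1) * (n + 2 * s)) * 2 powr (- real k * n)))"
      using \<omega> by (simp flip: ennreal_mult add: ac_simps)
    also have "2 powr (- 2 * real k + (real k + 1) * (n + 2 * s)) * 2 powr (- real k * n) = 2 powr (n + 2 * s) * 2 powr ((2 * s - 2) * real k)"
      by (simp flip: powr_add add: algebra_simps)
    also have "2 powr ((2 * s - 2) * real k) = (2 powr (2 * s - 2)) ^ k"
      by (simp add: powr_realpow[symmetric] powr_powr)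
    finally show ?thesis by (simp add: mult.assoc)
  qed
  have "2 powr (- 2 * s) < (1::real)" "2 powr (2 * s - 2) < (1::real)"
    using assms by (simp_all add: powr_less_one)
  then have sA: "(\<Sum>k. ennreal (\<omega> * 2 powr n * (2 powr (- 2 * s)) ^ k)) \<noteq> top"
    and sB: "(\<Sum>k. ennreal (\<omega> * 2 powr (n + 2 * s) * (2 powr (2 * s - 2)) ^ k)) \<noteq> top"
    using \<omega> by (intro ennreal_suminf_neq_top summable_mult summable_geometric; simp)+
  have pt: "ennreal (min 1 ((norm z)\<^sup>2) * kern s z) \<le> (\<Sum>k. A k z) + (\<Sum>k. B k z)" for z :: 'a
  proof (cases "z = 0")
    case False
    define m where "m = \<lfloor>log 2 (norm z)\<rfloor>"
    have m1: "2 powr (of_int m) \<le> norm z" 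
      using False by (simp add: m_def powr_le_iff le_log_iff)
    have m2: "norm z < 2 powr (of_int m + 1)" 
      using False by (simp add: m_def flip: log_less_iff)
    have npos: "0 < n + 2 * s" using assms by (simp add: n_def add_nonneg_pos)
    have k1: "kern s z \<le> 2 powr (- of_int m * (n + 2 * s))"
    proof -
      have "(2 powr of_int m) powr (n + 2 * s) \<le> norm z powr (n + 2 * s)"
        using m1 npos by (intro powr_mono2) auto
      then have "kern s z \<le> 1 / (2 powr of_int m) powr (n + 2 * s)"
        unfolding kern_def n_def[symmetric] by (intro divide_left_mono) (use False in auto)
      also have "\<dots> = 2 powr (- of_int m * (n + 2 * s))"
        by (simp add: powr_powr powr_minus_divide)
      finally show ?thesis .
    qed
    show ?thesis
    proof (cases "0 \<le> m")
      case True
      define k where "k = nat m"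
      have mk: "of_int m = real k" using True by (simp add: k_def)
      have "min 1 ((norm z)\<^sup>2) * kern s z \<le> 1 * kern s z" by (intro mult_right_mono) auto
      then have "ennreal (min 1 ((norm z)\<^sup>2) * kern s z) \<le> A k z"
        using k1 m2 by (simp add: A_def mk)
      also have "\<dots> \<le> (\<Sum>k. A k z)" using sum_le_suminf[OF summableI, of "{k}" "\<lambda>k. A k z"] by simp
      finally show ?thesis by (simp add: add_increasing2)
    next
      case F: False
      \<comment> \<open>Shifted by one so that the shell just inside the unit ball,
        \<open>m = - 1\<close>, receives the index 0.\<close>
      define k where "k = nat (- m - 1)"
      have mk: "of_int m = - real k - 1" using F by (simp add: k_def)
      have "min 1 ((norm z)\<^sup>2) * kern s z \<le> (2 powr (- real k))\<^sup>2 * 2 powr ((real k + 1) * (n + 2 * s))"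
      proof (intro mult_mono)
        show "min 1 ((norm z)\<^sup>2) \<le> (2 powr (- real k))\<^sup>2"
          using m2 by (intro min.coboundedI2 power_mono) (auto simp: mk)
        show "kern s z \<le> 2 powr ((real k + 1) * (n + 2 * s))"
          using k1 by (simp add: mk algebra_simps)
      qed auto
      also have "(2 powr (- real k))\<^sup>2 * 2 powr ((real k + 1) * (n + 2 * s)) = 2 powr (- 2 * real k + (real k + 1) * (n + 2 * s))"
        by (simp add: power2_eq_square flip: powr_add)
      finally have "ennreal (min 1 ((norm z)\<^sup>2) * kern s z) \<le> B k z"
        using m2 by (simp add: B_def mk ennreal_leI)
      also have "\<dots> \<le> (\<Sum>k. B k z)" using sum_le_suminf[OF summableI, of "{k}" "\<lambda>k. B k z"] by simp
      finally show ?thesis by (simp add: add_increasing)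
    qed
  qed simp
  have "(\<integral>\<^sup>+z. ennreal (min 1 ((norm z)\<^sup>2) * kern s z) \<partial>(lborel::'a measure)) \<le> (\<integral>\<^sup>+z. (\<Sum>k. A k z) + (\<Sum>k. B k z) \<partial>lborel)"
    by (intro nn_integral_mono pt)
  also have "\<dots> = (\<Sum>k. ennreal (\<omega> * 2 powr n * (2 powr (- 2 * s)) ^ k)) + (\<Sum>k. ennreal (\<omega> * 2 powr (n + 2 * s) * (2 powr (2 * s - 2)) ^ k))"
    by (subst nn_integral_add) (auto simp: nn_integral_suminf iA iB)
  also have "\<dots> < \<infinity>" using sA sB by (simp add: less_top)
  finally show ?thesis by (intro integrableI_bounded) auto
qed

text \<open>The dummy type argument records the space, and with it the dimension, which otherwise
  occurs only in the type of the bound variable.\<close>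

definition kern_mass :: "'a::euclidean_space itself \<Rightarrow> real \<Rightarrow> real" where
  "kern_mass _ s = (LINT z|lborel. min 1 ((norm (z::'a))\<^sup>2) * kern s z)"

lemma kern_mass_nonneg: "0 \<le> kern_mass TYPE('a::euclidean_space) s"
  unfolding kern_mass_def by (intro integral_nonneg_AE) auto

lemma nn_integral_kern_min:
  assumes "0 < s" "s < 1"
  shows "(\<integral>\<^sup>+z. ennreal (min 1 ((norm (z::'a::euclidean_space))\<^sup>2) * kern s z) \<partial>lborel) = ennreal (kern_mass TYPE('a) s)"
  unfolding kern_mass_def by (intro nn_integral_eq_integral kern_integrable_min assms) auto

lemma kern_integrable_tail:
  assumes "0 < s" "s < 1" "0 < \<epsilon>"
  shows "integrable lborel (\<lambda>z::'a::euclidean_space. indicator {z. \<epsilon> < norm z} z * kern s z)"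
proof (rule Bochner_Integration.integrable_bound)
  show "integrable lborel (\<lambda>z::'a. (1 / min 1 (\<epsilon>\<^sup>2)) * (min 1 ((norm z)\<^sup>2) * kern s z))"
    by (intro integrable_mult_right kern_integrable_min assms)
  show "AE z::'a in lborel. norm (indicator {z. \<epsilon> < norm z} z * kern s z) \<le> norm ((1 / min 1 (\<epsilon>\<^sup>2)) * (min 1 ((norm z)\<^sup>2) * kern s z))"
  proof (rule AE_I2)
    fix z :: 'a
    show "norm (indicator {z. \<epsilon> < norm z} z * kern s z) \<le> norm ((1 / min 1 (\<epsilon>\<^sup>2)) * (min 1 ((norm z)\<^sup>2) * kern s z))"
    proof (cases "\<epsilon> < norm z")
      case True
      have "\<epsilon>\<^sup>2 \<le> (norm z)\<^sup>2" using True assms by (intro power_mono) auto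
      then have "min 1 (\<epsilon>\<^sup>2) \<le> min 1 ((norm z)\<^sup>2)" by auto
      then have "1 \<le> min 1 ((norm z)\<^sup>2) / min 1 (\<epsilon>\<^sup>2)" using assms by (simp add: le_divide_eq)
      then have "1 * kern s z \<le> min 1 ((norm z)\<^sup>2) / min 1 (\<epsilon>\<^sup>2) * kern s z" by (intro mult_right_mono) auto
      then show ?thesis using True assms by (simp add: abs_mult)
    qed simp
  qed
qed measurable

subsection \<open>The Gagliardo seminorm\<close>

text \<open>Attaching the root of the kernel to the difference makes the seminorm an
  \<open>l2\<close> norm on pairs. Since the kernel depends on \<open>x - y\<close> only,
  translating \<open>w\<close> translates \<open>quot s w\<close> along the diagonal, and every fact
  about \<open>l2\<close> transfers.\<close>

definition quot :: "real \<Rightarrow> ('a::euclidean_space \<Rightarrow> real) \<Rightarrow> 'a \<times> 'a \<Rightarrow> real" where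
  "quot s w z = (w (fst z) - w (snd z)) * sqrt (kern s (fst z - snd z))"

text \<open>Taken over all pairs and without the factor \<open>c / 2\<close>: for a function
  vanishing off \<Omega>, pairs with both points outside contribute nothing.\<close>

definition gagliardo :: "real \<Rightarrow> ('a::euclidean_space \<Rightarrow> real) \<Rightarrow> ennreal" where
  "gagliardo s w = l2 (quot s w)"

lemma quot_measurable [measurable]:
  assumes [measurable]: "w \<in> borel_measurable borel"
  shows "quot s w \<in> borel_measurable borel"
  unfolding quot_def borel_prod[symmetric] by measurable

lemma quot_square: "(quot s w z)\<^sup>2 = (w (fst z) - w (snd z))\<^sup>2 * kern s (fst z - snd z)"
  by (simp add: quot_def power_mult_distrib)

lemma quot_add: "quot s (\<lambda>x. v x + w x) = (\<lambda>z. quot s v z + quot s w z)"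
  and quot_diff: "quot s (\<lambda>x. v x - w x) = (\<lambda>z. quot s v z - quot s w z)"
  and quot_cmult: "quot s (\<lambda>x. a * w x) = (\<lambda>z. a * quot s w z)"
  and quot_shift: "quot s (\<lambda>x. w (x - h)) = (\<lambda>z. quot s w (z - (h, h)))"
  by (auto simp: quot_def fun_eq_iff algebra_simps)

lemma nn_integral_lborel_pair:
  assumes [measurable]: "f \<in> borel_measurable (borel :: ('a::euclidean_space \<times> 'a) measure)"
  shows "(\<integral>\<^sup>+z. f z \<partial>lborel) = (\<integral>\<^sup>+x. \<integral>\<^sup>+y. f (x, y) \<partial>lborel \<partial>lborel)"
proof -
  have "f \<in> borel_measurable (lborel \<Otimes>\<^sub>M lborel)" by (simp add: lborel_prod)
  from lborel.nn_integral_fst[OF this] show ?thesis by (simp add: lborel_prod)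
qed

lemma gagliardo_eq:
  assumes [measurable]: "w \<in> borel_measurable borel"
  shows "gagliardo s w = (\<integral>\<^sup>+x. \<integral>\<^sup>+y. ennreal ((w x - w y)\<^sup>2 * kern s (x - y)) \<partial>lborel \<partial>lborel)"
proof -
  have "(\<lambda>z. ennreal ((quot s w z)\<^sup>2)) \<in> borel_measurable borel" by measurable
  from nn_integral_lborel_pair[OF this] show ?thesis
    unfolding gagliardo_def l2_def by (simp add: quot_square)
qed

lemma gagliardo_add_le:
  assumes [measurable]: "v \<in> borel_measurable borel" "w \<in> borel_measurable borel"
  shows "gagliardo s (\<lambda>x. v x + w x) \<le> 2 * gagliardo s v + 2 * gagliardo s w"
  unfolding gagliardo_def quot_add by (rule l2_add_le) auto

lemma gagliardo_cmult:
  assumes [measurable]: "w \<in> borel_measurable borel"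
  shows "gagliardo s (\<lambda>x. a * w x) = ennreal (a\<^sup>2) * gagliardo s w"
  unfolding gagliardo_def quot_cmult by (rule l2_cmult) auto

lemma gagliardo_uminus: "gagliardo s (\<lambda>x. - w x) = gagliardo s w"
  unfolding gagliardo_def l2_def quot_square by (simp add: power2_commute)

text \<open>Meant for \<open>v\<close> obtained from \<open>w\<close> by a map with Lipschitz
  constant 1, such as the modulus or the positive part.\<close>

lemma gagliardo_lipschitz:
  assumes "\<And>x y. \<bar>v x - v y\<bar> \<le> \<bar>w x - w y\<bar>"
  shows "gagliardo s v \<le> gagliardo s w"
  unfolding gagliardo_def by (rule l2_mono) (simp add: quot_def abs_mult mult_right_mono assms)

lemma energy_eq_gagliardo:
  fixes w :: "'a::euclidean_space \<Rightarrow> real"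
  assumes "AE x in lborel. w x = v x" "\<And>x. x \<notin> \<Omega> \<Longrightarrow> v x = 0"
  shows "energy c s \<Omega> w = ennreal (c / 2) * gagliardo s v"
proof -
  have "(\<integral>\<^sup>+ z \<in> UNIV - (- \<Omega>) \<times> (- \<Omega>). (case z of (x, y) \<Rightarrow>
        ennreal (\<bar>w x - w y\<bar>\<^sup>2 / norm (x - y) powr (real DIM('a) + 2 * s)))
      \<partial>(lebesgue :: ('a \<times> 'a) measure)) = gagliardo s v"
    unfolding nn_integral_completion gagliardo_def l2_def
    using AE_lborel_pair[OF assms(1)]
    by (intro nn_integral_cong_AE, eventually_elim)
       (auto simp: quot_square kern_def assms(2) split: split_indicator prod.splits)
  then show ?thesis unfolding energy_def by simp
qed

text \<open>Second order near \<open>x\<close> tames the singularity and boundedness handles the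
  rest; by translation invariance the bound does not depend on \<open>x\<close>.\<close>

lemma nn_integral_kern_lipschitz:
  fixes \<eta> :: "'a::euclidean_space \<Rightarrow> real"
  assumes "0 < s" "s < 1" "0 \<le> M" and [measurable]: "\<eta> \<in> borel_measurable borel"
    and "\<And>y. (\<eta> x - \<eta> y)\<^sup>2 \<le> M * min 1 ((norm (x - y))\<^sup>2)"
  shows "(\<integral>\<^sup>+y. ennreal ((\<eta> x - \<eta> y)\<^sup>2 * kern s (x - y)) \<partial>lborel) \<le> ennreal (M * kern_mass TYPE('a) s)"
proof -
  have "(\<integral>\<^sup>+y. ennreal ((\<eta> x - \<eta> y)\<^sup>2 * kern s (x - y)) \<partial>lborel)
      \<le> (\<integral>\<^sup>+y. ennreal M * ennreal (min 1 ((norm (x - y))\<^sup>2) * kern s (x - y)) \<partial>lborel)"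
    using assms by (intro nn_integral_mono) (simp flip: ennreal_mult mult.assoc add: mult_right_mono ennreal_leI)
  also have "\<dots> = ennreal M * (\<integral>\<^sup>+y. ennreal (min 1 ((norm (x - y))\<^sup>2) * kern s (x - y)) \<partial>lborel)"
    by (subst nn_integral_cmult) auto
  also have "(\<integral>\<^sup>+y. ennreal (min 1 ((norm (x - y))\<^sup>2) * kern s (x - y)) \<partial>lborel) = ennreal (kern_mass TYPE('a) s)"
    using nn_integral_lborel_diff_left[of "\<lambda>z. ennreal (min 1 ((norm z)\<^sup>2) * kern s z)" x]
    by (simp add: nn_integral_kern_min assms)
  finally show ?thesis using assms kern_mass_nonneg[where 'a='a, of s] by (simp flip: ennreal_mult)
qed

text \<open>Product rule \<open>\<eta> y (w x - w y) + w x (\<eta> x - \<eta> y)\<close>. In the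
  second term the integral over \<open>y\<close> comes first and is bounded uniformly in
  \<open>x\<close>, so only the square integral of \<open>w\<close> remains.\<close>

lemma gagliardo_mult_le:
  fixes w \<eta> :: "'a::euclidean_space \<Rightarrow> real"
  assumes s: "0 < s" "s < 1" and M: "0 \<le> M"
    and [measurable]: "w \<in> borel_measurable borel" "\<eta> \<in> borel_measurable borel"
    and \<eta>: "\<And>x. \<bar>\<eta> x\<bar> \<le> 1" "\<And>x y. (\<eta> x - \<eta> y)\<^sup>2 \<le> M * min 1 ((norm (x - y))\<^sup>2)"
  shows "gagliardo s (\<lambda>x. \<eta> x * w x) \<le> 2 * gagliardo s w + ennreal (2 * M * kern_mass TYPE('a) s) * l2 w"
proof -
  have ineq: "(\<eta> x * w x - \<eta> y * w y)\<^sup>2 \<le> 2 * (w x - w y)\<^sup>2 + 2 * ((w x)\<^sup>2 * (\<eta> x - \<eta> y)\<^sup>2)" for x y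
  proof -
    have "(\<eta> x * w x - \<eta> y * w y)\<^sup>2 = (\<eta> y * (w x - w y) + w x * (\<eta> x - \<eta> y))\<^sup>2" by (simp add: algebra_simps)
    also have "\<dots> \<le> 2 * (\<eta> y * (w x - w y))\<^sup>2 + 2 * (w x * (\<eta> x - \<eta> y))\<^sup>2"
      using sum_squares_ge_zero[of "\<eta> y * (w x - w y) - w x * (\<eta> x - \<eta> y)" 0] by (simp add: power2_eq_square algebra_simps)
    also have "(\<eta> y * (w x - w y))\<^sup>2 \<le> 1 * (w x - w y)\<^sup>2"
      unfolding power_mult_distrib using \<eta>(1)[of y] by (intro mult_right_mono) (auto simp: abs_square_le_1)
    finally show ?thesis by (simp add: power_mult_distrib)
  qed
  have "gagliardo s (\<lambda>x. \<eta> x * w x) \<le> (\<integral>\<^sup>+x. \<integral>\<^sup>+y. 2 * ennreal ((w x - w y)\<^sup>2 * kern s (x - y))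
      + ennreal (2 * (w x)\<^sup>2) * ennreal ((\<eta> x - \<eta> y)\<^sup>2 * kern s (x - y)) \<partial>lborel \<partial>lborel)"
    unfolding gagliardo_eq[OF borel_measurable_times[OF assms(5,4)]]
  proof (intro nn_integral_mono)
    fix x y
    have "(\<eta> x * w x - \<eta> y * w y)\<^sup>2 * kern s (x - y) \<le> (2 * (w x - w y)\<^sup>2 + 2 * ((w x)\<^sup>2 * (\<eta> x - \<eta> y)\<^sup>2)) * kern s (x - y)"
      by (intro mult_right_mono ineq) auto
    then have "ennreal ((\<eta> x * w x - \<eta> y * w y)\<^sup>2 * kern s (x - y)) \<le> ennreal (2 * ((w x - w y)\<^sup>2 * kern s (x - y)) + 2 * (w x)\<^sup>2 * ((\<eta> x - \<eta> y)\<^sup>2 * kern s (x - y)))"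
      by (intro ennreal_leI) (simp add: algebra_simps)
    then show "ennreal ((\<eta> x * w x - \<eta> y * w y)\<^sup>2 * kern s (x - y)) \<le> 2 * ennreal ((w x - w y)\<^sup>2 * kern s (x - y))
      + ennreal (2 * (w x)\<^sup>2) * ennreal ((\<eta> x - \<eta> y)\<^sup>2 * kern s (x - y))"
      by (simp add: ennreal_plus ennreal_mult)
  qed
  also have "\<dots> = 2 * gagliardo s w + (\<integral>\<^sup>+x. ennreal (2 * (w x)\<^sup>2) * (\<integral>\<^sup>+y. ennreal ((\<eta> x - \<eta> y)\<^sup>2 * kern s (x - y)) \<partial>lborel) \<partial>lborel)"
    by (simp add: nn_integral_add nn_integral_cmult gagliardo_eq)
  also have "(\<integral>\<^sup>+x. ennreal (2 * (w x)\<^sup>2) * (\<integral>\<^sup>+y. ennreal ((\<eta> x - \<eta> y)\<^sup>2 * kern s (x - y)) \<partial>lborel) \<partial>lborel)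
      \<le> (\<integral>\<^sup>+x. ennreal (2 * (w x)\<^sup>2) * ennreal (M * kern_mass TYPE('a) s) \<partial>lborel)"
    by (intro nn_integral_mono mult_left_mono nn_integral_kern_lipschitz s M \<eta>(2)) auto
  also have "\<dots> = (\<integral>\<^sup>+x. ennreal (2 * M * kern_mass TYPE('a) s) * ennreal ((w x)\<^sup>2) \<partial>lborel)"
    using M kern_mass_nonneg[where 'a='a, of s] by (intro nn_integral_cong) (simp flip: ennreal_mult add: ac_simps)
  also have "\<dots> = ennreal (2 * M * kern_mass TYPE('a) s) * l2 w"
    unfolding l2_def by (rule nn_integral_cmult) auto
  finally show ?thesis by (simp add: add_left_mono)
qed

text \<open>The integrand vanishes unless one of the points lies in \<open>S\<close>. By symmetry it
  suffices to double the contribution of \<open>x \<in> S\<close>, where the inner integral is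
  uniformly bounded and \<open>S\<close> has finite measure.\<close>

lemma gagliardo_finite_of_lipschitz:
  fixes w :: "'a::euclidean_space \<Rightarrow> real"
  assumes s: "0 < s" "s < 1" and M: "0 \<le> M" and [measurable]: "w \<in> borel_measurable borel"
    and w: "\<And>x y. (w x - w y)\<^sup>2 \<le> M * min 1 ((norm (x - y))\<^sup>2)"
    and S[measurable]: "S \<in> sets borel" "emeasure lborel S < \<infinity>" and wS: "\<And>x. x \<notin> S \<Longrightarrow> w x = 0"
  shows "gagliardo s w < \<infinity>"
proof -
  let ?F = "\<lambda>x y. ennreal ((w x - w y)\<^sup>2 * kern s (x - y))"
  have sym: "?F x y = ?F y x" for x y by (simp add: power2_commute kern_diff_commute)
  have I: "(\<integral>\<^sup>+y. ?F x y \<partial>lborel) \<le> ennreal (M * kern_mass TYPE('a) s)" for x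
    by (intro nn_integral_kern_lipschitz s M w) auto
  have "gagliardo s w \<le> (\<integral>\<^sup>+x. \<integral>\<^sup>+y. indicator S x * ?F x y + indicator S y * ?F x y \<partial>lborel \<partial>lborel)"
    unfolding gagliardo_eq[OF assms(4)] by (intro nn_integral_mono) (auto simp: wS split: split_indicator)
  also have "\<dots> = (\<integral>\<^sup>+x. \<integral>\<^sup>+y. indicator S x * ?F x y \<partial>lborel \<partial>lborel) + (\<integral>\<^sup>+x. \<integral>\<^sup>+y. indicator S y * ?F x y \<partial>lborel \<partial>lborel)"
    by (simp add: nn_integral_add)
  also have "(\<integral>\<^sup>+x. \<integral>\<^sup>+y. indicator S y * ?F x y \<partial>lborel \<partial>lborel) = (\<integral>\<^sup>+y. \<integral>\<^sup>+x. indicator S y * ?F x y \<partial>lborel \<partial>lborel)"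
    by (rule lborel_pair.Fubini') measurable
  also have "\<dots> = (\<integral>\<^sup>+y. \<integral>\<^sup>+x. indicator S y * ?F y x \<partial>lborel \<partial>lborel)"
    using sym by simp
  also have "(\<integral>\<^sup>+x. \<integral>\<^sup>+y. indicator S x * ?F x y \<partial>lborel \<partial>lborel) + \<dots> = 2 * (\<integral>\<^sup>+x. \<integral>\<^sup>+y. indicator S x * ?F x y \<partial>lborel \<partial>lborel)"
    by (simp add: mult_2)
  also have "(\<integral>\<^sup>+x. \<integral>\<^sup>+y. indicator S x * ?F x y \<partial>lborel \<partial>lborel) \<le> (\<integral>\<^sup>+x. indicator S x * ennreal (M * kern_mass TYPE('a) s) \<partial>lborel)"
    using I by (intro nn_integral_mono) (auto split: split_indicator)
  also have "\<dots> = emeasure lborel S * ennreal (M * kern_mass TYPE('a) s)"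
    by (simp add: nn_integral_multc)
  also have "2 * \<dots> < \<infinity>" using S by (simp add: ennreal_mult_less_top)
  finally show ?thesis by (simp add: mult_left_mono)
qed

subsection \<open>Smooth functions with compact support\<close>

text \<open>Coinduction for smoothness: any class closed under directional derivatives will do,
  which replaces an induction on the order of differentiability in each application.\<close>

lemma smooth_coinduct:
  fixes f :: "'a::euclidean_space \<Rightarrow> real"
  assumes "f \<in> C"
    and C: "\<And>g. g \<in> C \<Longrightarrow> \<exists>g'. (\<forall>x. (g has_derivative g' x) (at x)) \<and> (\<forall>v. (\<lambda>x. g' x v) \<in> C)"
  shows "smooth f"
proof -
  have "\<forall>g\<in>C. Ck_on k g UNIV" for k
  proof (induction k)
    case 0
    show ?case
      using C by (metis Ck_on.simps(1) continuous_at_imp_continuous_on has_derivative_continuous)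
  next
    case (Suc k)
    show ?case
    proof
      fix g assume "g \<in> C"
      then obtain g' where g': "\<And>x. (g has_derivative g' x) (at x)" "\<And>v. (\<lambda>x. g' x v) \<in> C"
        using C by blast
      have "frechet_derivative g (at x) = g' x" for x
        using frechet_derivative_at[OF g'(1)] by simp
      then show "Ck_on (Suc k) g UNIV"
        using g' Suc by (auto simp: differentiable_def)
    qed
  qed
  then show ?thesis using \<open>f \<in> C\<close> by (simp add: smooth_def)
qed

lemma smooth_has_derivative:
  "smooth f \<Longrightarrow> (f has_derivative frechet_derivative f (at x)) (at x)"
  unfolding smooth_def using frechet_derivative_works by (metis Ck_on.simps(2) UNIV_I)

lemma smooth_frechet_derivative:
  assumes "smooth f" shows "smooth (\<lambda>x. frechet_derivative f (at x) v)"
  unfolding smooth_def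
proof
  fix k
  have "Ck_on (Suc k) f UNIV" using assms unfolding smooth_def by blast
  then show "Ck_on k (\<lambda>x. frechet_derivative f (at x) v) UNIV" by simp
qed

lemma smooth_continuous: "smooth f \<Longrightarrow> continuous_on UNIV f"
  unfolding smooth_def by (metis Ck_on.simps(1))

lemma smooth_measurable: "smooth f \<Longrightarrow> f \<in> borel_measurable borel"
  by (intro borel_measurable_continuous_onI smooth_continuous)

lemma test_functions_smooth: "f \<in> test_functions \<Omega> \<Longrightarrow> smooth f"
  by (simp add: test_functions_def)

lemma test_functions_measurable: "f \<in> test_functions \<Omega> \<Longrightarrow> f \<in> borel_measurable borel"
  by (simp add: test_functions_smooth smooth_measurable)

lemma zero_outside_closure_support: "x \<notin> closure {x. f x \<noteq> 0} \<Longrightarrow> f x = 0"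
  using closure_subset[of "{x. f x \<noteq> 0}"] by auto

lemma test_functionsI:
  assumes "smooth f" "compact K" "K \<subseteq> \<Omega>" "\<And>x. x \<notin> K \<Longrightarrow> f x = 0"
  shows "f \<in> test_functions \<Omega>"
proof -
  have "closure {x. f x \<noteq> 0} \<subseteq> K"
    using assms by (intro closure_minimal compact_imp_closed) auto
  then show ?thesis
    using assms compact_Int_closed[OF assms(2) closed_closure, of "{x. f x \<noteq> 0}"]
    by (auto simp: test_functions_def Int_absorb1)
qed

lemma frechet_derivative_test_functions:
  assumes "f \<in> test_functions \<Omega>"
  shows "(\<lambda>x. frechet_derivative f (at x) v) \<in> test_functions \<Omega>"
proof (rule test_functionsI)
  let ?K = "closure {x. f x \<noteq> 0}"
  show "smooth (\<lambda>x. frechet_derivative f (at x) v)" "compact ?K" "?K \<subseteq> \<Omega>"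
    using assms by (auto simp: test_functions_def intro: smooth_frechet_derivative)
  fix x assume "x \<notin> ?K"
  have "(f has_derivative (\<lambda>h. 0)) (at x)"
  proof (rule has_derivative_transform_within_open)
    show "((\<lambda>_. 0) has_derivative (\<lambda>h. 0)) (at x)" by simp
    show "open (- ?K)" "x \<in> - ?K" using \<open>x \<notin> ?K\<close> by auto
    show "0 = f y" if "y \<in> - ?K" for y using that zero_outside_closure_support[of y f] by simp
  qed
  then show "frechet_derivative f (at x) v = 0"
    using frechet_derivative_at[of f "\<lambda>h. 0" x] by (metis (no_types))
qed

lemma test_functions_bounded:
  assumes "f \<in> test_functions \<Omega>"
  obtains M where "0 \<le> M" "\<And>x. \<bar>f x\<bar> \<le> M"
proof -
  let ?K = "closure {x. f x \<noteq> 0}"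
  have "compact (f ` ?K)"
    using assms by (intro compact_continuous_image continuous_on_subset[OF smooth_continuous]) (auto simp: test_functions_def)
  then obtain M where M: "\<And>y. y \<in> f ` ?K \<Longrightarrow> norm y \<le> M" by (meson compact_imp_bounded bounded_iff)
  have "\<bar>f x\<bar> \<le> max 0 M" for x
  proof (cases "f x = 0")
    case False
    then have "x \<in> ?K" using zero_outside_closure_support[of x f] by blast
    then show ?thesis using M[of "f x"] by auto
  qed simp
  then show ?thesis by (intro that[of "max 0 M"]) auto
qed

lemma test_functions_derivative_bounded:
  fixes f :: "'a::euclidean_space \<Rightarrow> real"
  assumes f: "f \<in> test_functions \<Omega>"
  obtains L where "0 \<le> L" "\<And>x h. \<bar>frechet_derivative f (at x) h\<bar> \<le> L * norm h"
proof -
  have "\<exists>M. 0 \<le> M \<and> (\<forall>x. \<bar>frechet_derivative f (at x) b\<bar> \<le> M)" for b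
    using test_functions_bounded[OF frechet_derivative_test_functions[OF f]] by metis
  then obtain M where M: "\<And>b. 0 \<le> M b" "\<And>b x. \<bar>frechet_derivative f (at x) b\<bar> \<le> M b" by metis
  have "\<bar>frechet_derivative f (at x) h\<bar> \<le> (\<Sum>b\<in>Basis. M b) * norm h" for x h
  proof -
    have lin: "linear (frechet_derivative f (at x))"
      using smooth_has_derivative[OF test_functions_smooth[OF f]] by (rule has_derivative_linear)
    have "\<bar>frechet_derivative f (at x) h\<bar> = \<bar>\<Sum>b\<in>Basis. (h \<bullet> b) * frechet_derivative f (at x) b\<bar>"
      by (subst euclidean_representation[symmetric, of h], subst linear_sum[OF lin]) (simp add: linear_scale[OF lin])
    also have "\<dots> \<le> (\<Sum>b\<in>Basis. norm h * M b)"
      by (rule order_trans[OF sum_abs], intro sum_mono)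
         (auto simp: abs_mult intro!: mult_mono M Basis_le_norm)
    finally show ?thesis by (simp add: sum_distrib_left mult.commute sum_distrib_right)
  qed
  then show ?thesis by (intro that[of "\<Sum>b\<in>Basis. M b"]) (auto intro: sum_nonneg M)
qed

lemma test_functions_lipschitz:
  fixes f :: "'a::euclidean_space \<Rightarrow> real"
  assumes f: "f \<in> test_functions \<Omega>"
  obtains L where "0 \<le> L" "\<And>x y. \<bar>f x - f y\<bar> \<le> L * norm (x - y)"
proof -
  obtain L where L: "0 \<le> L" "\<And>x h. \<bar>frechet_derivative f (at x) h\<bar> \<le> L * norm h"
    using test_functions_derivative_bounded[OF f] by blast
  have "norm (f x - f y) \<le> L * norm (x - y)" for x y
    by (rule differentiable_bound[OF convex_UNIV])
       (auto intro!: onorm_bound L smooth_has_derivative test_functions_smooth[OF f])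
  then show ?thesis using L by (intro that[of L]) auto
qed

text \<open>Directional derivatives of a test function are test functions, hence Lipschitz; the mean
  value inequality for the linearisation turns this into a quadratic remainder, uniform in
  \<open>x\<close>.\<close>

lemma test_functions_taylor:
  fixes f :: "'a::euclidean_space \<Rightarrow> real"
  assumes f: "f \<in> test_functions \<Omega>"
  obtains M where "0 \<le> M" "\<And>x h. \<bar>f (x + h) - f x - frechet_derivative f (at x) h\<bar> \<le> M * (norm h)\<^sup>2"
proof -
  have "\<exists>L. 0 \<le> L \<and> (\<forall>x y. \<bar>frechet_derivative f (at x) b - frechet_derivative f (at y) b\<bar> \<le> L * norm (x - y))" for b
    using test_functions_lipschitz[OF frechet_derivative_test_functions[OF f]] by metis
  then obtain L where L: "\<And>b. 0 \<le> L b"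
    "\<And>b x y. \<bar>frechet_derivative f (at x) b - frechet_derivative f (at y) b\<bar> \<le> L b * norm (x - y)" by metis
  define M where "M = (\<Sum>b\<in>Basis. L b)"
  have M: "0 \<le> M" unfolding M_def by (intro sum_nonneg L)
  note der = smooth_has_derivative[OF test_functions_smooth[OF f]]
  have lip: "\<bar>frechet_derivative f (at x) v - frechet_derivative f (at y) v\<bar> \<le> M * norm (x - y) * norm v" for x y v
  proof -
    have lin: "linear (frechet_derivative f (at z))" for z using der by (rule has_derivative_linear)
    have rep: "frechet_derivative f (at z) v = (\<Sum>b\<in>Basis. (v \<bullet> b) * frechet_derivative f (at z) b)" for z
      by (subst euclidean_representation[symmetric, of v], subst linear_sum[OF lin]) (simp add: linear_scale[OF lin])
    have "\<bar>frechet_derivative f (at x) v - frechet_derivative f (at y) v\<bar> 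
        = \<bar>\<Sum>b\<in>Basis. (v \<bullet> b) * (frechet_derivative f (at x) b - frechet_derivative f (at y) b)\<bar>"
      unfolding rep[of x] rep[of y] by (simp add: sum_subtractf right_diff_distrib)
    also have "\<dots> \<le> (\<Sum>b\<in>Basis. norm v * (L b * norm (x - y)))"
      by (rule order_trans[OF sum_abs], intro sum_mono)
         (auto simp: abs_mult intro!: mult_mono L Basis_le_norm)
    also have "\<dots> = M * norm (x - y) * norm v"
      by (simp add: M_def sum_distrib_left sum_distrib_right mult_ac)
    finally show ?thesis .
  qed
  have "\<bar>f (x + h) - f x - frechet_derivative f (at x) h\<bar> \<le> M * (norm h)\<^sup>2" for x h
  proof -
    have "norm (f (x + h) - f x - frechet_derivative f (at x) (x + h - x)) \<le> norm (x + h - x) * (M * norm h)"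
    proof (rule differentiable_bound_linearization[where S="cball x (norm h)"])
      show "x + t *\<^sub>R (x + h - x) \<in> cball x (norm h)" if "t \<in> {0..1}" for t
        using that by (auto simp: dist_norm mult_left_le_one_le)
      show "(f has_derivative frechet_derivative f (at y)) (at y within cball x (norm h))" for y
        using der by (rule has_derivative_at_withinI)
      show "onorm (frechet_derivative f (at y) - frechet_derivative f (at x)) \<le> M * norm h"
        if "y \<in> cball x (norm h)" for y
      proof (rule onorm_bound)
        fix v :: 'a
        have "M * norm (y - x) * norm v \<le> M * norm h * norm v"
          using that M by (intro mult_right_mono mult_left_mono) (auto simp: dist_norm norm_minus_commute)
        then show "norm ((frechet_derivative f (at y) - frechet_derivative f (at x)) v) \<le> M * norm h * norm v"
          using lip[of y v x] by simp
      qed (use M in auto)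
    qed auto
    then show ?thesis by (simp add: power2_eq_square mult_ac)
  qed
  then show ?thesis using M that by blast
qed

text \<open>Serves where a derivative is read off from an estimate: for \<open>flat\<close> at 0,
  and for integrals depending on a parameter.\<close>

lemma has_derivative_of_quadratic_error:
  fixes f :: "'a::euclidean_space \<Rightarrow> real"
  assumes "bounded_linear D" "\<And>h. \<bar>f (x + h) - f x - D h\<bar> \<le> K * (norm h)\<^sup>2"
  shows "(f has_derivative D) (at x)"
  unfolding has_derivative_at
proof (intro conjI assms(1))
  have le: "norm (f (x + h) - f x - D h) / norm h \<le> K * norm h" for h
    using assms(2)[of h] by (cases "h = 0") (auto simp: field_simps power2_eq_square)
  have "((\<lambda>h. K * norm h) \<longlongrightarrow> 0) (at (0::'a))"
    by (intro tendsto_mult_right_zero tendsto_norm_zero tendsto_ident_at)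
  then show "(\<lambda>h. norm (f (x + h) - f x - D h) / norm h) \<midarrow>0\<rightarrow> 0"
    by (rule tendsto_sandwich[OF _ _ tendsto_const, rotated 2]) (use le in \<open>simp_all add: always_eventually\<close>)
qed

subsection \<open>Mollifiers\<close>

text \<open>The functions \<open>exp (- 1 / t) / t ^ k\<close>, extended by zero, are closed under differentiation up
  to linear combinations.\<close>

definition flat :: "nat \<Rightarrow> real \<Rightarrow> real" where
  "flat k t = (if t \<le> 0 then 0 else exp (- 1 / t) / t ^ k)"

text \<open>With \<open>n = k + 2\<close>,
  \<open>exp (1 / t) \<ge> (1 + 1 / (n t)) ^ n \<ge> (1 / (n t)) ^ n\<close>. Inverting and dividing
  by \<open>t ^ k\<close> leaves \<open>t\<^sup>2\<close>, just enough for a zero derivative at the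
  origin.\<close>

lemma flat_bound: "\<bar>flat k t\<bar> \<le> real (k + 2) ^ (k + 2) * t\<^sup>2"
proof (cases "t \<le> 0")
  case False
  let ?n = "k + 2"
  have "(1 / (real ?n * t)) ^ ?n \<le> (1 + (1 / t) / real ?n) ^ ?n"
    using False by (intro power_mono) (auto simp: field_simps)
  also have "\<dots> \<le> exp (1 / t)"
    using False by (intro exp_ge_one_plus_x_over_n_power_n) (auto intro: order_trans[of _ 0])
  finally have le: "(1 / (real ?n * t)) ^ ?n \<le> exp (1 / t)" .
  have "exp (- 1 / t) = 1 / exp (1 / t)" by (simp add: exp_minus divide_inverse)
  also have "\<dots> \<le> 1 / (1 / (real ?n * t)) ^ ?n"
    using False by (intro divide_left_mono le mult_pos_pos zero_less_power) auto
  also have "\<dots> = (real ?n * t) ^ ?n" by (simp only: power_one_over) simp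
  finally have "exp (- 1 / t) \<le> (real ?n * t) ^ ?n" .
  then have "exp (- 1 / t) / t ^ k \<le> (real ?n * t) ^ ?n / t ^ k"
    using False by (intro divide_right_mono) auto
  also have "\<dots> = real ?n ^ ?n * t\<^sup>2"
    using False by (simp add: power_mult_distrib power_add power2_eq_square)
  finally show ?thesis using False by (simp add: flat_def)
qed (simp add: flat_def)

lemma DERIV_flat: "(flat k has_real_derivative flat (k + 2) t - real k * flat (k + 1) t) (at t)"
proof -
  consider "t < 0" | "t = 0" | "0 < t" by linarith
  then show ?thesis
  proof cases
    case 1
    have "((\<lambda>_. 0) has_real_derivative flat (k + 2) t - real k * flat (k + 1) t) (at t)"
      using 1 by (simp add: flat_def)
    then show ?thesis
      by (rule has_field_derivative_transform_within_open[of _ _ _ "{..<0}"]) (use 1 in \<open>auto simp: flat_def\<close>)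
  next
    case 2
    have "(flat k has_derivative (*) 0) (at 0)"
      by (rule has_derivative_of_quadratic_error) (use flat_bound in \<open>auto simp: flat_def[of _ 0] bounded_linear_mult_right\<close>)
    then show ?thesis using 2 by (simp add: has_field_derivative_def flat_def[of _ 0])
  next
    case 3
    \<comment> \<open>For \<open>m = 0\<close> the truncated exponent is wrong, but the factor
      \<open>real m\<close> is then 0.\<close>
    have pow: "real m * t ^ (m - Suc 0) * t = real m * t ^ m" for m by (cases m) auto
    have "((\<lambda>t. exp (- 1 / t) * inverse (t ^ k)) has_real_derivative
        exp (- 1 / t) * (1 / t\<^sup>2) * inverse (t ^ k) - exp (- 1 / t) * (real k * t ^ (k - Suc 0)) * inverse (t ^ k) * inverse (t ^ k)) (at t)"
      using 3 by (auto intro!: derivative_eq_intros simp: power2_eq_square)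
    also have "exp (- 1 / t) * (1 / t\<^sup>2) * inverse (t ^ k) = flat (k + 2) t"
      using 3 by (simp add: flat_def field_simps power_add power2_eq_square)
    also have "exp (- 1 / t) * (real k * t ^ (k - Suc 0)) * inverse (t ^ k) * inverse (t ^ k) = real k * flat (k + 1) t"
      using 3 pow[of k] by (simp add: flat_def field_simps)
    finally have "((\<lambda>t. exp (- 1 / t) / t ^ k) has_real_derivative flat (k + 2) t - real k * flat (k + 1) t) (at t)"
      by (simp add: divide_inverse)
    then show ?thesis
      by (rule has_field_derivative_transform_within_open[of _ _ _ "{0<..}"]) (use 3 in \<open>auto simp: flat_def\<close>)
  qed
qed

text \<open>The chain rule for \<open>flat k (r\<^sup>2 - x \<bullet> x)\<close> brings out a factor
  linear in \<open>x\<close>. The remaining generators are there to close the class under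
  derivatives, as \<open>smooth_coinduct\<close> demands.\<close>

inductive_set flat_algebra :: "real \<Rightarrow> ('a::euclidean_space \<Rightarrow> real) set" for r where
  flat: "(\<lambda>x. flat k (r\<^sup>2 - x \<bullet> x)) \<in> flat_algebra r"
| inner: "(\<lambda>x. x \<bullet> v) \<in> flat_algebra r"
| const: "(\<lambda>x. a) \<in> flat_algebra r"
| add: "f \<in> flat_algebra r \<Longrightarrow> g \<in> flat_algebra r \<Longrightarrow> (\<lambda>x. f x + g x) \<in> flat_algebra r"
| mult: "f \<in> flat_algebra r \<Longrightarrow> g \<in> flat_algebra r \<Longrightarrow> (\<lambda>x. f x * g x) \<in> flat_algebra r"

lemma flat_algebra_derivative:
  assumes "f \<in> flat_algebra r"
  shows "\<exists>f'. (\<forall>x. (f has_derivative f' x) (at x)) \<and> (\<forall>v. (\<lambda>x. f' x v) \<in> flat_algebra r)"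
  using assms
proof induction
  case (flat k)
  let ?D = "\<lambda>x v. (flat (k + 2) (r\<^sup>2 - x \<bullet> x) + (- real k) * flat (k + 1) (r\<^sup>2 - x \<bullet> x)) * ((-2) * (x \<bullet> v))"
  have "((\<lambda>x. flat k (r\<^sup>2 - x \<bullet> x)) has_derivative ?D x) (at x)" for x :: 'a
  proof -
    have "((\<lambda>x. r\<^sup>2 - x \<bullet> x) has_derivative (\<lambda>v. (-2) * (x \<bullet> v))) (at x)"
      by (auto intro!: derivative_eq_intros simp: inner_commute)
    from has_derivative_compose[OF this DERIV_flat[of k, unfolded has_field_derivative_def]]
    show ?thesis by (rule has_derivative_eq_rhs) (simp add: fun_eq_iff)
  qed
  then show ?case by (intro exI[of _ ?D] conjI allI flat_algebra.intros) auto
next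
  case (inner v)
  show ?case
    by (intro exI[of _ "\<lambda>x h. h \<bullet> v"]) (auto intro!: derivative_eq_intros flat_algebra.intros)
next
  case (const a)
  show ?case by (intro exI[of _ "\<lambda>x h. 0"]) (auto intro!: flat_algebra.intros)
next
  case (add f g)
  then obtain f' g' where "\<And>x. (f has_derivative f' x) (at x)" "\<And>v. (\<lambda>x. f' x v) \<in> flat_algebra r"
    "\<And>x. (g has_derivative g' x) (at x)" "\<And>v. (\<lambda>x. g' x v) \<in> flat_algebra r" by metis
  then show ?case
    by (intro exI[of _ "\<lambda>x h. f' x h + g' x h"]) (auto intro!: has_derivative_add flat_algebra.add)
next
  case (mult f g)
  then obtain f' g' where "\<And>x. (f has_derivative f' x) (at x)" "\<And>v. (\<lambda>x. f' x v) \<in> flat_algebra r"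
    "\<And>x. (g has_derivative g' x) (at x)" "\<And>v. (\<lambda>x. g' x v) \<in> flat_algebra r" by metis
  then show ?case using mult(1,2)
    by (intro exI[of _ "\<lambda>x h. f x * g' x h + f' x h * g x"])
       (auto intro!: has_derivative_mult flat_algebra.add flat_algebra.mult)
qed

lemma flat_algebra_smooth: "f \<in> flat_algebra r \<Longrightarrow> smooth f"
  by (rule smooth_coinduct[of _ "flat_algebra r"]) (auto dest: flat_algebra_derivative)

definition mollifier :: "real \<Rightarrow> ('a::euclidean_space \<Rightarrow> real) \<Rightarrow> bool" where
  "mollifier r \<rho> \<longleftrightarrow> smooth \<rho> \<and> (\<forall>x. 0 \<le> \<rho> x) \<and> (\<forall>x. r \<le> norm x \<longrightarrow> \<rho> x = 0) \<and>
     integrable lborel \<rho> \<and> (LINT x|lborel. \<rho> x) = 1"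

lemma mollifier_test_function: "mollifier r \<rho> \<Longrightarrow> \<rho> \<in> test_functions UNIV"
  by (rule test_functionsI[of _ "cball 0 r"]) (auto simp: mollifier_def)

lemma test_functions_integrable:
  assumes f: "f \<in> test_functions \<Omega>" shows "integrable lborel f"
proof -
  let ?K = "closure {x. f x \<noteq> 0}"
  obtain M where M: "0 \<le> M" "\<And>x. \<bar>f x\<bar> \<le> M" using test_functions_bounded[OF f] by blast
  have K: "compact ?K" using f by (simp add: test_functions_def)
  have [measurable]: "f \<in> borel_measurable borel" using f by (rule test_functions_measurable)
  have "integrable lborel (\<lambda>x. indicator ?K x * M)"
    using emeasure_compact_finite[OF K] K by (intro integrable_mult_left integrable_real_indicator) (auto simp: compact_imp_closed)
  then show ?thesis
  proof (rule Bochner_Integration.integrable_bound)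
    have "\<bar>f x\<bar> \<le> \<bar>indicator ?K x * M\<bar>" for x
      using M(2)[of x] zero_outside_closure_support[of x f] by (cases "x \<in> ?K") auto
    then show "AE x in lborel. norm (f x) \<le> norm (indicator ?K x * M)" by simp
  qed simp
qed

lemma mollifier_exists:
  assumes "0 < r" shows "\<exists>\<rho> :: 'a::euclidean_space \<Rightarrow> real. mollifier r \<rho>"
proof -
  define \<phi> :: "'a \<Rightarrow> real" where "\<phi> x = flat 0 (r\<^sup>2 - x \<bullet> x)" for x
  have sm: "smooth (\<lambda>x. a * \<phi> x)" for a
    unfolding \<phi>_def by (intro flat_algebra_smooth[of _ r] flat_algebra.intros)
  have z: "\<phi> x = 0" if "r \<le> norm x" for x
  proof -
    have "r\<^sup>2 \<le> (norm x)\<^sup>2" using that assms by (intro power_mono) auto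
    then show ?thesis by (simp add: \<phi>_def flat_def dot_square_norm)
  qed
  have nn: "0 \<le> \<phi> x" for x by (simp add: \<phi>_def flat_def)
  have pos: "0 < \<phi> x" if "norm x < r" for x
  proof -
    have "(norm x)\<^sup>2 < r\<^sup>2" using that assms by (intro power_strict_mono) auto
    then show ?thesis by (simp add: \<phi>_def flat_def dot_square_norm)
  qed
  have int: "integrable lborel \<phi>"
    using sm[of 1] z by (intro test_functions_integrable[of _ UNIV] test_functionsI[of _ "cball 0 r"]) auto
  define I where "I = (LINT x|lborel. \<phi> x)"
  have "I \<noteq> 0"
  proof
    assume "I = 0"
    then have "AE x in lborel. \<phi> x = 0"
      using integral_nonneg_eq_0_iff_AE[OF int] nn by (auto simp: I_def)
    then have "AE x in lborel. x \<notin> ball (0::'a) r" by eventually_elim (use pos in force)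
    then have "emeasure lborel (ball (0::'a) r) = 0"
      by (subst (asm) AE_iff_measurable[of "ball 0 r"]) auto
    then show False using assms unit_ball_vol_pos[of "real DIM('a)"] by (simp add: emeasure_ball)
  qed
  moreover have "0 \<le> I" unfolding I_def by (intro integral_nonneg_AE) (auto simp: nn)
  ultimately have "0 < I" by simp
  then have "mollifier r (\<lambda>x. 1 / I * \<phi> x)"
    unfolding mollifier_def using sm[of "1 / I"] z nn int by (auto simp: I_def)
  then show ?thesis by blast
qed

section \<open>Approximation by convolution\<close>

definition mollify :: "('a::euclidean_space \<Rightarrow> real) \<Rightarrow> ('a \<Rightarrow> real) \<Rightarrow> 'a \<Rightarrow> real" where
  "mollify \<rho> w x = (LINT h|lborel. \<rho> h * w (x - h))"

text \<open>Here \<open>x\<close> occurs only in the smooth factor, which is the form for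
  differentiation. The defining form, an average of translates of \<open>w\<close>, is the one for
  convergence.\<close>

lemma mollify_eq:
  assumes [measurable]: "\<rho> \<in> borel_measurable borel" "w \<in> borel_measurable borel"
  shows "mollify \<rho> w x = (LINT y|lborel. w y * \<rho> (x - y))"
  unfolding mollify_def
  using integral_lborel_diff_left[of "\<lambda>y. w y * \<rho> (x - y)" x] by (simp add: mult.commute)

lemma integrable_test_function_mult:
  assumes f: "\<rho> \<in> test_functions \<Omega>" and w: "integrable lborel w"
  shows "integrable lborel (\<lambda>y. w y * \<rho> (x - y))"
proof -
  obtain M where M: "0 \<le> M" "\<And>x. \<bar>\<rho> x\<bar> \<le> M" using test_functions_bounded[OF f] by blast
  have [measurable]: "\<rho> \<in> borel_measurable borel" using f by (rule test_functions_measurable)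
  have [measurable]: "w \<in> borel_measurable borel" using w by auto
  show ?thesis
  proof (rule Bochner_Integration.integrable_bound)
    show "integrable lborel (\<lambda>y. w y * M)" using w by simp
    show "AE y in lborel. norm (w y * \<rho> (x - y)) \<le> norm (w y * M)"
      using M by (auto simp: abs_mult intro!: mult_left_mono order_trans[OF M(2)])
  qed simp
qed

text \<open>The coinductive class consists of the convolutions of the fixed \<open>w\<close> with
  all test functions; differentiating replaces \<rho> by a directional derivative. The uniform
  Taylor remainder of \<rho> integrates against \<open>\<bar>w\<bar>\<close>, so differentiation
  under the integral needs no limit theorem.\<close>

lemma smooth_mollify:
  fixes w :: "'a::euclidean_space \<Rightarrow> real"
  assumes \<rho>: "\<rho> \<in> test_functions UNIV" and w: "integrable lborel w"
  shows "smooth (mollify \<rho> w)"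
proof (rule smooth_coinduct[where C="{g. \<exists>\<rho>\<in>test_functions UNIV. g = (\<lambda>x. LINT y|lborel. w y * \<rho> (x - y))}"])
  have "\<rho> \<in> borel_measurable borel" "w \<in> borel_measurable borel"
    using test_functions_measurable[OF \<rho>] w by auto
  from mollify_eq[OF this]
  show "mollify \<rho> w \<in> {g. \<exists>\<rho>\<in>test_functions UNIV. g = (\<lambda>x. LINT y|lborel. w y * \<rho> (x - y))}"
    using \<rho> by (auto simp: fun_eq_iff)
next
  fix g assume "g \<in> {g. \<exists>\<rho>\<in>test_functions UNIV. g = (\<lambda>x. LINT y|lborel. w y * \<rho> (x - y))}"
  then obtain \<rho> where \<rho>: "\<rho> \<in> test_functions UNIV" and g: "g = (\<lambda>x. LINT y|lborel. w y * \<rho> (x - y))" by blast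
  let ?D = "\<lambda>x h. frechet_derivative \<rho> (at x) h"
  have D: "(\<lambda>x. ?D x h) \<in> test_functions UNIV" for h using \<rho> by (rule frechet_derivative_test_functions)
  note i0 = integrable_test_function_mult[OF \<rho> w] and i1 = integrable_test_function_mult[OF D w]
  obtain L where L: "0 \<le> L" "\<And>x h. \<bar>?D x h\<bar> \<le> L * norm h" using test_functions_derivative_bounded[OF \<rho>] by blast
  obtain M where M: "0 \<le> M" "\<And>x h. \<bar>\<rho> (x + h) - \<rho> x - ?D x h\<bar> \<le> M * (norm h)\<^sup>2" using test_functions_taylor[OF \<rho>] by blast
  have bl: "bounded_linear (?D x)" for x
    using smooth_has_derivative[OF test_functions_smooth[OF \<rho>]] by (rule has_derivative_bounded_linear)
  define G where "G x h = (LINT y|lborel. w y * ?D (x - y) h)" for x h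
  have nw: "integrable lborel (\<lambda>y. \<bar>w y\<bar> * a)" for a using w by simp
  have "(g has_derivative G x) (at x)" for x
  proof (rule has_derivative_of_quadratic_error)
    show "bounded_linear (G x)"
    proof (rule bounded_linear_intro)
      show "G x (a + b) = G x a + G x b" for a b
        unfolding G_def by (simp add: linear_add[OF bounded_linear.linear[OF bl]] distrib_left Bochner_Integration.integral_add[OF i1 i1])
      show "G x (r *\<^sub>R a) = r *\<^sub>R G x a" for r a
        unfolding G_def by (simp add: linear_scale[OF bounded_linear.linear[OF bl]] mult.left_commute)
      show "norm (G x a) \<le> norm a * (LINT y|lborel. \<bar>w y\<bar> * L)" for a
      proof -
        have "norm (G x a) \<le> (LINT y|lborel. norm (w y * ?D (x - y) a))" unfolding G_def by (rule integral_norm_bound)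
        also have "\<dots> \<le> (LINT y|lborel. \<bar>w y\<bar> * (L * norm a))"
          by (intro integral_mono integrable_norm i1 nw) (auto simp: abs_mult intro!: mult_left_mono L)
        finally show ?thesis by (simp add: mult_ac)
      qed
    qed
    fix h
    have eq: "g (x + h) - g x - G x h = (LINT y|lborel. w y * (\<rho> ((x - y) + h) - \<rho> (x - y) - ?D (x - y) h))"
    proof -
      have e: "\<rho> (x - y + h) = \<rho> (x + h - y)" for y by (simp add: algebra_simps)
      show ?thesis
        unfolding g G_def e using i0[of x] i0[of "x + h"] i1[of x h]
        by (simp add: right_diff_distrib Bochner_Integration.integral_diff)
    qed
    have "\<bar>g (x + h) - g x - G x h\<bar> \<le> (LINT y|lborel. norm (w y * (\<rho> ((x - y) + h) - \<rho> (x - y) - ?D (x - y) h)))"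
      unfolding eq real_norm_def[symmetric] by (rule integral_norm_bound)
    also have "\<dots> \<le> (LINT y|lborel. \<bar>w y\<bar> * (M * (norm h)\<^sup>2))"
    proof (intro integral_mono nw integrable_norm)
      have e: "\<rho> (x - y + h) = \<rho> (x + h - y)" for y by (simp add: algebra_simps)
      show "integrable lborel (\<lambda>y. w y * (\<rho> ((x - y) + h) - \<rho> (x - y) - ?D (x - y) h))"
        unfolding e using i0[of x] i0[of "x + h"] i1[of x h] by (simp add: right_diff_distrib)
    qed (auto simp: abs_mult intro!: mult_left_mono M)
    finally show "\<bar>g (x + h) - g x - G x h\<bar> \<le> ((LINT y|lborel. \<bar>w y\<bar>) * M) * (norm h)\<^sup>2" by (simp add: mult_ac)
  qed
  then show "\<exists>g'. (\<forall>x. (g has_derivative g' x) (at x)) \<and>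
      (\<forall>v. (\<lambda>x. g' x v) \<in> {g. \<exists>\<rho>\<in>test_functions UNIV. g = (\<lambda>x. LINT y|lborel. w y * \<rho> (x - y))})"
    using D by (intro exI[of _ G]) (auto simp: G_def[abs_def])
qed

lemma mollifier_measurable: "mollifier r \<rho> \<Longrightarrow> \<rho> \<in> borel_measurable borel"
  by (auto simp: mollifier_def intro: smooth_measurable)

text \<open>The variance of \<open>F\<close> under the probability density \<rho> is nonnegative. If
  the right side is infinite there is nothing to prove; otherwise all integrals in the expansion
  exist.\<close>

lemma mollifier_jensen:
  fixes F :: "'a::euclidean_space \<Rightarrow> real"
  assumes \<rho>: "mollifier r \<rho>" and [measurable]: "F \<in> borel_measurable borel"
  shows "ennreal ((LINT h|lborel. \<rho> h * F h)\<^sup>2) \<le> (\<integral>\<^sup>+h. ennreal (\<rho> h * (F h)\<^sup>2) \<partial>lborel)"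
proof (cases "(\<integral>\<^sup>+h. ennreal (\<rho> h * (F h)\<^sup>2) \<partial>lborel) = \<infinity>")
  case False
  have [measurable]: "\<rho> \<in> borel_measurable borel" using \<rho> by (rule mollifier_measurable)
  have nn: "\<And>h. 0 \<le> \<rho> h" and i0: "integrable lborel \<rho>" and one: "(LINT h|lborel. \<rho> h) = 1"
    using \<rho> by (auto simp: mollifier_def)
  have i2: "integrable lborel (\<lambda>h. \<rho> h * (F h)\<^sup>2)"
    using False nn by (intro integrableI_bounded) (auto simp: less_top)
  have i1: "integrable lborel (\<lambda>h. \<rho> h * F h)"
  proof (rule Bochner_Integration.integrable_bound)
    show "integrable lborel (\<lambda>h. \<rho> h + \<rho> h * (F h)\<^sup>2)" using i0 i2 by simp
    have "\<bar>a\<bar> \<le> 1 + a\<^sup>2" for a :: real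
      using sum_squares_bound[of 1 "\<bar>a\<bar>"] by simp
    then have "\<rho> h * \<bar>F h\<bar> \<le> \<rho> h * (1 + (F h)\<^sup>2)" for h by (intro mult_left_mono nn)
    then show "AE h in lborel. norm (\<rho> h * F h) \<le> norm (\<rho> h + \<rho> h * (F h)\<^sup>2)"
      using nn by (auto simp: abs_mult algebra_simps)
  qed simp
  define m where "m = (LINT h|lborel. \<rho> h * F h)"
  have "0 \<le> (LINT h|lborel. \<rho> h * (F h - m)\<^sup>2)"
    by (intro integral_nonneg_AE) (auto simp: nn)
  also have "\<dots> = (LINT h|lborel. \<rho> h * (F h)\<^sup>2 - 2 * m * (\<rho> h * F h) + m\<^sup>2 * \<rho> h)"
    by (intro Bochner_Integration.integral_cong) (auto simp: power2_eq_square algebra_simps)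
  also have "\<dots> = (LINT h|lborel. \<rho> h * (F h)\<^sup>2) - 2 * m * m + m\<^sup>2 * 1"
    using i0 i1 i2 one by (simp add: m_def)
  finally have "m\<^sup>2 \<le> (LINT h|lborel. \<rho> h * (F h)\<^sup>2)" by (simp add: power2_eq_square)
  then have "ennreal (m\<^sup>2) \<le> ennreal (LINT h|lborel. \<rho> h * (F h)\<^sup>2)" by (rule ennreal_leI)
  also have "\<dots> = (\<integral>\<^sup>+h. ennreal (\<rho> h * (F h)\<^sup>2) \<partial>lborel)"
    using nn by (intro nn_integral_eq_integral[symmetric] i2) auto
  finally show ?thesis by (simp add: m_def)
qed simp

text \<open>Jensen pointwise, then Fubini: the average of differences is no larger than the worst
  difference. The map \<open>T\<close> allows shifts by \<open>h\<close> on the space as well as by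
  \<open>(h, h)\<close> on pairs.\<close>

lemma l2_mollifier_average:
  fixes F :: "'b::euclidean_space \<Rightarrow> real" and T :: "'a::euclidean_space \<Rightarrow> 'b"
  assumes \<rho>: "mollifier r \<rho>" and [measurable]: "F \<in> borel_measurable borel" "T \<in> borel_measurable borel"
    and e: "\<And>h. norm h < r \<Longrightarrow> l2 (\<lambda>z. F (z - T h) - F z) \<le> e"
  shows "l2 (\<lambda>z. LINT h|lborel. \<rho> h * (F (z - T h) - F z)) \<le> e"
proof -
  have [measurable]: "\<rho> \<in> borel_measurable borel" using \<rho> by (rule mollifier_measurable)
  have nn: "\<And>h. 0 \<le> \<rho> h" and i0: "integrable lborel \<rho>" and one: "(LINT h|lborel. \<rho> h) = 1"
    and supp: "\<And>h. r \<le> norm h \<Longrightarrow> \<rho> h = 0"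
    using \<rho> by (auto simp: mollifier_def)
  have "l2 (\<lambda>z. LINT h|lborel. \<rho> h * (F (z - T h) - F z))
      \<le> (\<integral>\<^sup>+z. \<integral>\<^sup>+h. ennreal (\<rho> h * (F (z - T h) - F z)\<^sup>2) \<partial>lborel \<partial>lborel)"
    unfolding l2_def by (intro nn_integral_mono mollifier_jensen[OF \<rho>]) measurable
  also have "\<dots> = (\<integral>\<^sup>+h. \<integral>\<^sup>+z. ennreal (\<rho> h * (F (z - T h) - F z)\<^sup>2) \<partial>lborel \<partial>lborel)"
    by (rule lborel_pair.Fubini') measurable
  also have "\<dots> = (\<integral>\<^sup>+h. ennreal (\<rho> h) * l2 (\<lambda>z. F (z - T h) - F z) \<partial>lborel)"
    unfolding l2_def by (intro nn_integral_cong, subst nn_integral_cmult[symmetric]) (auto simp: ennreal_mult nn)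
  also have "\<dots> \<le> (\<integral>\<^sup>+h. ennreal (\<rho> h) * e \<partial>lborel)"
  proof (intro nn_integral_mono)
    fix h show "ennreal (\<rho> h) * l2 (\<lambda>z. F (z - T h) - F z) \<le> ennreal (\<rho> h) * e"
      using e[of h] supp[of h] by (cases "norm h < r") (auto intro: mult_left_mono)
  qed
  also have "\<dots> = e"
    using nn_integral_eq_integral[OF i0] nn one by (simp add: nn_integral_multc)
  finally show ?thesis .
qed

lemma integrable_mollify_integrand:
  fixes w :: "'a::euclidean_space \<Rightarrow> real"
  assumes \<rho>: "\<rho> \<in> test_functions UNIV" and w: "integrable lborel w"
  shows "integrable lborel (\<lambda>h. \<rho> h * w (x - h))"
proof -
  have [measurable]: "\<rho> \<in> borel_measurable borel" using \<rho> by (rule test_functions_measurable)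
  have [measurable]: "w \<in> borel_measurable borel" using w by auto
  have "integrable (distr lborel borel (\<lambda>h. x - h)) (\<lambda>y. w y * \<rho> (x - y))"
    unfolding lborel_distr_diff_left by (rule integrable_test_function_mult[OF \<rho> w])
  then show ?thesis by (subst (asm) integrable_distr_eq) (auto simp: mult.commute)
qed

lemma mollify_approx:
  fixes w :: "'a::euclidean_space \<Rightarrow> real"
  assumes w: "integrable lborel w" and fin: "l2 w < \<infinity>" "gagliardo s w < \<infinity>" and "0 < e"
  shows "\<exists>d>0. \<forall>r \<rho>. r \<le> d \<longrightarrow> mollifier r \<rho> \<longrightarrow>
     l2 (\<lambda>x. mollify \<rho> w x - w x) \<le> e \<and> gagliardo s (\<lambda>x. mollify \<rho> w x - w x) \<le> e"
proof -
  have [measurable]: "w \<in> borel_measurable borel" using w by auto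
  obtain d1 where d1: "0 < d1" "\<And>h. norm h < d1 \<Longrightarrow> l2 (\<lambda>x. w (x - h) - w x) < e"
    using l2_shift_continuous[of w e] fin \<open>0 < e\<close> by auto
  obtain d2 where d2: "0 < d2" "\<And>h. norm h < d2 \<Longrightarrow> l2 (\<lambda>z. quot s w (z - h) - quot s w z) < e"
    using l2_shift_continuous[of "quot s w" e] fin \<open>0 < e\<close> by (auto simp: gagliardo_def)
  \<comment> \<open>A diagonal shift may be twice as long, hence the radius \<open>d2 / 2\<close>
    below.\<close>
  have nrm: "norm (h, h) \<le> 2 * norm h" for h :: 'a
    using norm_Pair_le[of h h] by simp
  show ?thesis
  proof (intro exI conjI allI impI)
    show "0 < min d1 (d2 / 2)" using d1 d2 by simp
    fix r and \<rho> :: "'a \<Rightarrow> real" assume r: "r \<le> min d1 (d2 / 2)" and \<rho>: "mollifier r \<rho>"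
    have [measurable]: "\<rho> \<in> borel_measurable borel" using \<rho> by (rule mollifier_measurable)
    note int = integrable_mollify_integrand[OF mollifier_test_function[OF \<rho>] w]
    have i0: "integrable lborel \<rho>" and one: "(LINT h|lborel. \<rho> h) = 1"
      using \<rho> by (auto simp: mollifier_def)
    have eq: "mollify \<rho> w x - w x = (LINT h|lborel. \<rho> h * (w (x - h) - w x))" for x
      unfolding mollify_def using int[of x] i0 one by (simp add: right_diff_distrib)
    have int': "integrable lborel (\<lambda>h. \<rho> h * (w (x - h) - w x))" for x
      using int[of x] i0 by (simp add: right_diff_distrib)
    \<comment> \<open>The kernel is unchanged by diagonal shifts, so the quotient of an average of
      translates is the average of the translated quotients.\<close>
    have eq2: "quot s (\<lambda>x. mollify \<rho> w x - w x) z = (LINT h|lborel. \<rho> h * (quot s w (z - (h, h)) - quot s w z))" for z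
      unfolding quot_def eq Bochner_Integration.integral_diff[OF int' int', symmetric]
      by (subst integral_mult_left_zero[symmetric]) (simp add: algebra_simps)
    show "l2 (\<lambda>x. mollify \<rho> w x - w x) \<le> e"
      unfolding eq using d1 r by (intro l2_mollifier_average[OF \<rho>, of w "\<lambda>h. h"]) (auto intro: less_imp_le)
    have [measurable]: "(\<lambda>h::'a. (h, h)) \<in> borel_measurable borel"
      by (intro borel_measurable_continuous_onI continuous_intros)
    show "gagliardo s (\<lambda>x. mollify \<rho> w x - w x) \<le> e"
      unfolding gagliardo_def eq2
    proof (rule l2_mollifier_average[OF \<rho>, of "quot s w" "\<lambda>h. (h, h)"])
      fix h :: 'a assume "norm h < r"
      then have "norm (h, h) < d2" using r nrm[of h] by simp
      then show "l2 (\<lambda>z. quot s w (z - (h, h)) - quot s w z) \<le> e" using d2(2) by (simp add: less_imp_le)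
    qed measurable
  qed
qed

lemma mollify_eq_0:
  assumes \<rho>: "mollifier r \<rho>" and "\<And>h. norm h \<le> r \<Longrightarrow> w (x - h) = 0"
  shows "mollify \<rho> w x = 0"
proof -
  have "\<rho> h * w (x - h) = 0" for h
    using assms(2)[of h] \<rho> by (cases "norm h \<le> r") (auto simp: mollifier_def)
  then show ?thesis unfolding mollify_def by (simp only: integral_zero)
qed

lemma mollify_nonneg:
  assumes "mollifier r \<rho>" "\<And>x. 0 \<le> w x" shows "0 \<le> mollify \<rho> w x"
  unfolding mollify_def using assms by (intro integral_nonneg_AE) (auto simp: mollifier_def)

lemma mollify_bounded:
  assumes \<rho>: "mollifier r \<rho>" and w: "integrable lborel w" and B: "\<And>x. \<bar>w x\<bar> \<le> B"
  shows "\<bar>mollify \<rho> w x\<bar> \<le> B"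
proof -
  have nn: "\<And>h. 0 \<le> \<rho> h" and i0: "integrable lborel \<rho>" and one: "(LINT h|lborel. \<rho> h) = 1"
    using \<rho> by (auto simp: mollifier_def)
  have "\<bar>mollify \<rho> w x\<bar> \<le> (LINT h|lborel. norm (\<rho> h * w (x - h)))"
    unfolding mollify_def real_norm_def[symmetric] by (rule integral_norm_bound)
  also have "\<dots> \<le> (LINT h|lborel. \<rho> h * B)"
  proof (rule integral_mono)
    show "integrable lborel (\<lambda>h. norm (\<rho> h * w (x - h)))"
      by (intro integrable_norm integrable_mollify_integrand mollifier_test_function[OF \<rho>] w)
    show "integrable lborel (\<lambda>h. \<rho> h * B)" using i0 by simp
  qed (auto simp: abs_mult nn intro!: mult_left_mono B)
  finally show ?thesis using one by simp
qed

text \<open>The compact set \<open>K'\<close> is chosen before \<open>r\<close> and \<rho>: a whole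
  sequence of mollifications then shares one support, as needed for dominated convergence against
  locally integrable functions.\<close>

lemma mollify_test_function:
  fixes w :: "'a::euclidean_space \<Rightarrow> real"
  assumes K: "compact K" "open \<Omega>" "K \<subseteq> \<Omega>" and w: "integrable lborel w" "\<And>x. x \<notin> K \<Longrightarrow> w x = 0"
  shows "\<exists>d>0. \<exists>K'. compact K' \<and> K' \<subseteq> \<Omega> \<and> (\<forall>r \<rho>. r \<le> d \<longrightarrow> mollifier r \<rho> \<longrightarrow>
           mollify \<rho> w \<in> test_functions \<Omega> \<and> (\<forall>x. x \<notin> K' \<longrightarrow> mollify \<rho> w x = 0))"
proof -
  obtain d where d: "0 < d" "(\<Union>x\<in>K. cball x d) \<subseteq> \<Omega>"
    using compact_subset_open_imp_cball_epsilon_subset[OF K] by blast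
  define K' where "K' = {x + y | x y. x \<in> K \<and> y \<in> cball 0 d}"
  have "compact K'" unfolding K'_def by (intro compact_sums K compact_cball)
  moreover have "K' \<subseteq> \<Omega>"
  proof
    fix z assume "z \<in> K'"
    then obtain x y where "z = x + y" "x \<in> K" "norm y \<le> d" by (auto simp: K'_def)
    then have "z \<in> cball x d" by (simp add: dist_norm)
    then show "z \<in> \<Omega>" using d \<open>x \<in> K\<close> by blast
  qed
  moreover have "mollify \<rho> w \<in> test_functions \<Omega> \<and> (\<forall>x. x \<notin> K' \<longrightarrow> mollify \<rho> w x = 0)"
    if "r \<le> d" "mollifier r \<rho>" for r \<rho>
  proof -
    have z: "mollify \<rho> w x = 0" if x: "x \<notin> K'" for x
    proof (rule mollify_eq_0[OF \<open>mollifier r \<rho>\<close>])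
      fix h :: 'a assume "norm h \<le> r"
      then have "x - h \<notin> K" using x \<open>r \<le> d\<close> by (force simp: K'_def)
      then show "w (x - h) = 0" by (rule w(2))
    qed
    moreover have "smooth (mollify \<rho> w)"
      by (intro smooth_mollify mollifier_test_function[OF that(2)] w)
    ultimately show ?thesis
      using \<open>compact K'\<close> \<open>K' \<subseteq> \<Omega>\<close> by (auto intro: test_functionsI)
  qed
  ultimately show ?thesis using d(1) by blast
qed

subsection \<open>Density of test functions\<close>

text \<open>The Borel representatives, vanishing everywhere outside \<open>\<Omega>\<close>, of the functions in
  \<^const>\<open>energy_space0\<close>; they turn Lebesgue integrals into Borel integrals.\<close>

definition hs0 :: "real \<Rightarrow> 'a::euclidean_space set \<Rightarrow> ('a \<Rightarrow> real) \<Rightarrow> bool" where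
  "hs0 s \<Omega> w \<longleftrightarrow> w \<in> borel_measurable borel \<and> (\<forall>x. x \<notin> \<Omega> \<longrightarrow> w x = 0) \<and> l2 w < \<infinity> \<and> gagliardo s w < \<infinity>"

text \<open>Nonnegative approximants are demanded because they later enter through their minimum
  with a nonnegative solution, which must stay bounded and nonnegative.\<close>

definition approximable :: "real \<Rightarrow> 'a::euclidean_space set \<Rightarrow> ('a \<Rightarrow> real) \<Rightarrow> bool" where
  "approximable s \<Omega> w \<longleftrightarrow> (\<forall>e>0. \<exists>v\<in>test_functions \<Omega>. (\<forall>x. 0 \<le> v x) \<and>
     l2 (\<lambda>x. v x - w x) \<le> e \<and> gagliardo s (\<lambda>x. v x - w x) \<le> e)"

lemma hs0_integrable:
  assumes "hs0 s S w" and [measurable]: "S \<in> sets borel" and "emeasure lborel S < \<infinity>"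
  shows "integrable lborel w"
proof (rule Bochner_Integration.integrable_bound)
  have [measurable]: "w \<in> borel_measurable borel" using assms by (simp add: hs0_def)
  show "integrable lborel (\<lambda>x. indicator S x + (w x)\<^sup>2)"
    using assms by (intro Bochner_Integration.integrable_add l2_finite_integrable(1)) (auto simp: hs0_def)
  have "\<bar>w x\<bar> \<le> \<bar>indicator S x + (w x)\<^sup>2\<bar>" for x
  proof (cases "x \<in> S")
    case True
    have "2 * (1 * \<bar>w x\<bar>) \<le> 1 + (w x)\<^sup>2" using sum_squares_bound[of 1 "\<bar>w x\<bar>"] by simp
    then show ?thesis using True by simp
  next
    case False then show ?thesis using assms(1) by (simp add: hs0_def)
  qed
  then show "AE x in lborel. norm (w x) \<le> norm (indicator S x + (w x)\<^sup>2)" by simp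
  show "w \<in> borel_measurable lborel" by simp
qed

lemma approximable_compact:
  fixes w :: "'a::euclidean_space \<Rightarrow> real"
  assumes K: "compact K" "open \<Omega>" "K \<subseteq> \<Omega>" and w: "hs0 s K w" "\<And>x. 0 \<le> w x"
  shows "approximable s \<Omega> w"
  unfolding approximable_def
proof (intro allI impI)
  fix e :: ennreal assume "0 < e"
  have iw: "integrable lborel w"
    using hs0_integrable[OF w(1)] K(1) emeasure_compact_finite[OF K(1)] compact_imp_closed[OF K(1)] by auto
  obtain d1 where d1: "0 < d1" "\<And>r \<rho>. r \<le> d1 \<Longrightarrow> mollifier r \<rho> \<Longrightarrow>
     l2 (\<lambda>x. mollify \<rho> w x - w x) \<le> e \<and> gagliardo s (\<lambda>x. mollify \<rho> w x - w x) \<le> e"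
    using mollify_approx[OF iw, of s e] w(1) \<open>0 < e\<close> unfolding hs0_def by blast
  obtain d2 where d2: "0 < d2" "\<And>r \<rho>. r \<le> d2 \<Longrightarrow> mollifier r \<rho> \<Longrightarrow> mollify \<rho> w \<in> test_functions \<Omega>"
    using mollify_test_function[OF K iw] w(1) unfolding hs0_def by blast
  obtain \<rho> :: "'a \<Rightarrow> real" where \<rho>: "mollifier (min d1 d2) \<rho>" using mollifier_exists[of "min d1 d2"] d1 d2 by auto
  show "\<exists>v\<in>test_functions \<Omega>. (\<forall>x. 0 \<le> v x) \<and> l2 (\<lambda>x. v x - w x) \<le> e \<and> gagliardo s (\<lambda>x. v x - w x) \<le> e"
    using d1(2)[OF _ \<rho>] d2(2)[OF _ \<rho>] mollify_nonneg[OF \<rho>, of w] w(2)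
    by (intro bexI[of _ "mollify \<rho> w"]) auto
qed

text \<open>Tolerance budget for the triangle inequality with factor 2. Passing to a real number
  below \<open>e\<close> covers \<open>e = \<infinity>\<close>.\<close>

lemma ennreal_quarter: 
  fixes e :: ennreal assumes "0 < e" obtains e' where "0 < e'" "2 * e' + 2 * e' \<le> e"
proof -
  obtain y where y: "0 < y" "y < e" using dense[OF assms] by blast
  then obtain t where t: "y = ennreal t" "0 < t" by (cases y) auto
  have "2 * ennreal (t / 4) + 2 * ennreal (t / 4) = ennreal t"
    using t(2) by (simp add: ennreal_mult[symmetric] ennreal_plus[symmetric] flip: ennreal_numeral)
  then show ?thesis using t y by (intro that[of "ennreal (t / 4)"]) auto
qed

lemma test_function_diff_measurable:
  "v \<in> test_functions \<Omega> \<Longrightarrow> hs0 s \<Omega> w \<Longrightarrow> (\<lambda>x. v x - w x) \<in> borel_measurable borel"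
  by (auto simp: hs0_def dest: test_functions_measurable)

lemma smooth_add:
  fixes f g :: "'a::euclidean_space \<Rightarrow> real"
  assumes "smooth f" "smooth g" shows "smooth (\<lambda>x. f x + g x)"
proof (rule smooth_coinduct[where C="{\<lambda>x. f x + g x | f g. smooth f \<and> smooth g}"])
  show "(\<lambda>x. f x + g x) \<in> {\<lambda>x. f x + g x | f g. smooth f \<and> smooth g}" using assms by blast
  fix k :: "'a \<Rightarrow> real" assume "k \<in> {\<lambda>x. f x + g x | f g. smooth f \<and> smooth g}"
  then obtain f g where fg: "k = (\<lambda>x. f x + g x)" "smooth f" "smooth g" by blast
  show "\<exists>k'. (\<forall>x. (k has_derivative k' x) (at x)) \<and> (\<forall>v. (\<lambda>x. k' x v) \<in> {\<lambda>x. f x + g x | f g. smooth f \<and> smooth g})"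
  proof (intro exI[of _ "\<lambda>x v. frechet_derivative f (at x) v + frechet_derivative g (at x) v"] conjI allI)
    show "(k has_derivative (\<lambda>v. frechet_derivative f (at x) v + frechet_derivative g (at x) v)) (at x)" for x
      unfolding fg(1) by (intro has_derivative_add smooth_has_derivative fg)
    show "(\<lambda>x. frechet_derivative f (at x) v + frechet_derivative g (at x) v) \<in> {\<lambda>x. f x + g x | f g. smooth f \<and> smooth g}" for v
      unfolding mem_Collect_eq
      by (intro exI[of _ "\<lambda>x. frechet_derivative f (at x) v"] exI[of _ "\<lambda>x. frechet_derivative g (at x) v"]
          conjI refl smooth_frechet_derivative fg)
  qed
qed

lemma approximable_add:
  assumes v: "hs0 s \<Omega> v" "approximable s \<Omega> v" and w: "hs0 s \<Omega> w" "approximable s \<Omega> w"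
  shows "approximable s \<Omega> (\<lambda>x. v x + w x)"
  unfolding approximable_def
proof (intro allI impI)
  fix e :: ennreal assume "0 < e"
  then obtain e' where e': "0 < e'" "2 * e' + 2 * e' \<le> e" by (rule ennreal_quarter)
  obtain a where a: "a \<in> test_functions \<Omega>" "\<And>x. 0 \<le> a x" "l2 (\<lambda>x. a x - v x) \<le> e'" "gagliardo s (\<lambda>x. a x - v x) \<le> e'"
    using v(2) e'(1) unfolding approximable_def by blast
  obtain b where b: "b \<in> test_functions \<Omega>" "\<And>x. 0 \<le> b x" "l2 (\<lambda>x. b x - w x) \<le> e'" "gagliardo s (\<lambda>x. b x - w x) \<le> e'"
    using w(2) e'(1) unfolding approximable_def by blast
  note [measurable] = test_function_diff_measurable[OF a(1) v(1)] test_function_diff_measurable[OF b(1) w(1)]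
  have eq: "(\<lambda>x. (a x + b x) - (v x + w x)) = (\<lambda>x. (a x - v x) + (b x - w x))" by auto
  have le: "2 * X + 2 * Y \<le> e" if "X \<le> e'" "Y \<le> e'" for X Y
    by (rule order_trans[OF add_mono e'(2)]) (auto intro!: mult_left_mono that)
  have "(\<lambda>x. a x + b x) \<in> test_functions \<Omega>"
  proof (rule test_functionsI)
    show "smooth (\<lambda>x. a x + b x)"
      using a(1) b(1) by (intro smooth_add test_functions_smooth)
    show "compact (closure {x. a x \<noteq> 0} \<union> closure {x. b x \<noteq> 0})" "closure {x. a x \<noteq> 0} \<union> closure {x. b x \<noteq> 0} \<subseteq> \<Omega>"
      using a b by (auto simp: test_functions_def)
    show "a x + b x = 0" if "x \<notin> closure {x. a x \<noteq> 0} \<union> closure {x. b x \<noteq> 0}" for x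
      using that zero_outside_closure_support[of x a] zero_outside_closure_support[of x b] by auto
  qed
  then show "\<exists>u\<in>test_functions \<Omega>. (\<forall>x. 0 \<le> u x) \<and> l2 (\<lambda>x. u x - (v x + w x)) \<le> e \<and> gagliardo s (\<lambda>x. u x - (v x + w x)) \<le> e"
  proof (intro bexI[of _ "\<lambda>x. a x + b x"] conjI allI)
    show "0 \<le> a x + b x" for x using a(2) b(2) by simp
    show "l2 (\<lambda>x. a x + b x - (v x + w x)) \<le> e"
      unfolding eq by (rule order_trans[OF l2_add_le le[OF a(3) b(3)]]) measurable
    show "gagliardo s (\<lambda>x. a x + b x - (v x + w x)) \<le> e"
      unfolding eq by (rule order_trans[OF gagliardo_add_le le[OF a(4) b(4)]]) measurable
  qed
qed

lemma approximable_limit: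
  assumes w: "hs0 s \<Omega> w"
    and lim: "\<And>e. 0 < e \<Longrightarrow> \<exists>v. hs0 s \<Omega> v \<and> approximable s \<Omega> v \<and> l2 (\<lambda>x. v x - w x) \<le> e \<and> gagliardo s (\<lambda>x. v x - w x) \<le> e"
  shows "approximable s \<Omega> w"
  unfolding approximable_def
proof (intro allI impI)
  fix e :: ennreal assume "0 < e"
  then obtain e' where e': "0 < e'" "2 * e' + 2 * e' \<le> e" by (rule ennreal_quarter)
  obtain v where v: "hs0 s \<Omega> v" "approximable s \<Omega> v" "l2 (\<lambda>x. v x - w x) \<le> e'" "gagliardo s (\<lambda>x. v x - w x) \<le> e'"
    using lim[OF e'(1)] by blast
  obtain a where a: "a \<in> test_functions \<Omega>" "\<And>x. 0 \<le> a x" "l2 (\<lambda>x. a x - v x) \<le> e'" "gagliardo s (\<lambda>x. a x - v x) \<le> e'"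
    using v(2) e'(1) unfolding approximable_def by blast
  have [measurable]: "(\<lambda>x. v x - w x) \<in> borel_measurable borel" using v(1) w by (auto simp: hs0_def)
  note [measurable] = test_function_diff_measurable[OF a(1) v(1)]
  have eq: "(\<lambda>x. a x - w x) = (\<lambda>x. (a x - v x) + (v x - w x))" by auto
  have le: "2 * X + 2 * Y \<le> e" if "X \<le> e'" "Y \<le> e'" for X Y
    by (rule order_trans[OF add_mono e'(2)]) (auto intro!: mult_left_mono that)
  show "\<exists>u\<in>test_functions \<Omega>. (\<forall>x. 0 \<le> u x) \<and> l2 (\<lambda>x. u x - w x) \<le> e \<and> gagliardo s (\<lambda>x. u x - w x) \<le> e"
  proof (intro bexI[of _ a] conjI allI a)
    show "l2 (\<lambda>x. a x - w x) \<le> e"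
      unfolding eq by (rule order_trans[OF l2_add_le le[OF a(3) v(3)]]) measurable
    show "gagliardo s (\<lambda>x. a x - w x) \<le> e"
      unfolding eq by (rule order_trans[OF gagliardo_add_le le[OF a(4) v(4)]]) measurable
  qed
qed

text \<open>On the closure of the piece the graph inequality holds only weakly. Moving by
  \<open>t\<close> along \<open>e\<close> leaves the argument of \<gamma> unchanged and raises the
  height, so the inequality becomes strict and the moved support is a compact subset of \<Omega>, to
  which mollification applies.\<close>

lemma approximable_boundary:
  fixes w :: "'a::euclidean_space \<Rightarrow> real"
  assumes "open \<Omega>" "0 < r" and e: "norm e = 1" and \<gamma>: "smooth \<gamma>"
    and graph: "\<Omega> \<inter> ball p r = {x \<in> ball p r. \<gamma> (x - (x \<bullet> e) *\<^sub>R e) < x \<bullet> e}"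
    and w: "hs0 s \<Omega> w" "\<And>x. 0 \<le> w x" "\<And>x. x \<notin> cball p (r / 2) \<Longrightarrow> w x = 0"
  shows "approximable s \<Omega> w"
proof (rule approximable_limit[OF w(1)])
  fix E :: ennreal assume "0 < E"
  have [measurable]: "w \<in> borel_measurable borel" using w(1) by (simp add: hs0_def)
  have fin: "l2 w < \<infinity>" "gagliardo s w < \<infinity>" using w(1) by (auto simp: hs0_def)
  obtain d1 where d1: "0 < d1" "\<And>h. norm h < d1 \<Longrightarrow> l2 (\<lambda>x. w (x - h) - w x) < E"
    using l2_shift_continuous[of w E] fin \<open>0 < E\<close> by auto
  obtain d2 where d2: "0 < d2" "\<And>h. norm h < d2 \<Longrightarrow> l2 (\<lambda>z. quot s w (z - h) - quot s w z) < E"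
    using l2_shift_continuous[of "quot s w" E] fin \<open>0 < E\<close> by (auto simp: gagliardo_def)
  \<comment> \<open>\<open>r / 4\<close> keeps the moved piece, which starts within
    \<open>r / 2\<close> of \<open>p\<close>, inside the chart. Halving \<open>d1\<close> gives
    strict inequality, and \<open>d2 / 4\<close> also allows for the doubled length of a diagonal
    shift.\<close>
  define t where "t = min (r / 4) (min (d1 / 2) (d2 / 4))"
  have t: "0 < t" "t < r / 2" "t < d1" "2 * t < d2" using d1 d2 \<open>0 < r\<close> by (auto simp: t_def)
  define v where "v x = w (x - t *\<^sub>R e)" for x
  define K where "K = (\<lambda>y. y + t *\<^sub>R e) ` closure (\<Omega> \<inter> cball p (r / 2))"
  have "compact K"
    unfolding K_def by (intro compact_continuous_image continuous_intros) (simp add: bounded_Int)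
  have "K \<subseteq> \<Omega>"
  proof
    fix x assume "x \<in> K"
    then obtain y where y: "y \<in> closure (\<Omega> \<inter> cball p (r / 2))" and x: "x = y + t *\<^sub>R e" by (auto simp: K_def)
    have cont: "continuous_on UNIV (\<lambda>x. \<gamma> (x - (x \<bullet> e) *\<^sub>R e))"
      by (rule continuous_on_compose2[OF smooth_continuous[OF \<gamma>]]) (auto intro!: continuous_intros)
    have "closure (\<Omega> \<inter> cball p (r / 2)) \<subseteq> {x. \<gamma> (x - (x \<bullet> e) *\<^sub>R e) \<le> x \<bullet> e} \<inter> cball p (r / 2)"
    proof (rule closure_minimal)
      show "\<Omega> \<inter> cball p (r / 2) \<subseteq> {x. \<gamma> (x - (x \<bullet> e) *\<^sub>R e) \<le> x \<bullet> e} \<inter> cball p (r / 2)"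
      proof
        fix x assume x: "x \<in> \<Omega> \<inter> cball p (r / 2)"
        then have "x \<in> \<Omega> \<inter> ball p r" using \<open>0 < r\<close> by auto
        then show "x \<in> {x. \<gamma> (x - (x \<bullet> e) *\<^sub>R e) \<le> x \<bullet> e} \<inter> cball p (r / 2)"
          unfolding graph using x by simp
      qed
      show "closed ({x. \<gamma> (x - (x \<bullet> e) *\<^sub>R e) \<le> x \<bullet> e} \<inter> cball p (r / 2))"
        by (intro closed_Int closed_Collect_le cont closed_cball continuous_intros)
    qed
    then have y1: "\<gamma> (y - (y \<bullet> e) *\<^sub>R e) \<le> y \<bullet> e" and y2: "dist p y \<le> r / 2" using y by auto
    have "e \<bullet> e = 1" using e by (simp add: dot_square_norm)
    then have xe: "x \<bullet> e = y \<bullet> e + t" by (simp add: x inner_add_left)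
    then have "x - (x \<bullet> e) *\<^sub>R e = y - (y \<bullet> e) *\<^sub>R e" by (simp add: x algebra_simps)
    then have "\<gamma> (x - (x \<bullet> e) *\<^sub>R e) < x \<bullet> e" using y1 xe t by simp
    moreover have "dist p x < r"
    proof -
      have "dist p x \<le> dist p y + dist y x" by (rule dist_triangle)
      also have "dist y x = t" using t e by (simp add: x dist_norm)
      finally show ?thesis using y2 t by simp
    qed
    ultimately show "x \<in> \<Omega>" using graph by auto
  qed
  have [measurable]: "v \<in> borel_measurable borel" unfolding v_def by measurable
  have vK: "hs0 s K v"
    unfolding hs0_def
  proof (intro conjI allI impI)
    show "l2 v < \<infinity>" unfolding v_def using fin by (simp add: l2_diff_right)
    show "gagliardo s v < \<infinity>" unfolding v_def gagliardo_def quot_shift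
      using fin by (subst l2_diff_right) (auto simp: gagliardo_def)
    fix x assume "x \<notin> K"
    then have "x - t *\<^sub>R e \<notin> \<Omega> \<inter> cball p (r / 2)"
      using closure_subset[of "\<Omega> \<inter> cball p (r / 2)"] by (force simp: K_def image_iff)
    then show "v x = 0" using w(1,3) by (auto simp: v_def hs0_def)
  qed measurable
  have "approximable s \<Omega> v"
    using \<open>compact K\<close> \<open>open \<Omega>\<close> \<open>K \<subseteq> \<Omega>\<close> vK w(2) by (intro approximable_compact) (auto simp: v_def)
  moreover have "hs0 s \<Omega> v" using vK \<open>K \<subseteq> \<Omega>\<close> by (auto simp: hs0_def)
  moreover have "l2 (\<lambda>x. v x - w x) \<le> E" using d1(2)[of "t *\<^sub>R e"] t e by (simp add: v_def less_imp_le)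
  moreover have "gagliardo s (\<lambda>x. v x - w x) \<le> E"
  proof -
    have "norm (t *\<^sub>R e, t *\<^sub>R e) < d2" using norm_Pair_le[of "t *\<^sub>R e" "t *\<^sub>R e"] t e by simp
    then show ?thesis using d2(2) unfolding v_def gagliardo_def quot_diff quot_shift by (simp add: less_imp_le)
  qed
  ultimately show "\<exists>v. hs0 s \<Omega> v \<and> approximable s \<Omega> v \<and> l2 (\<lambda>x. v x - w x) \<le> E \<and> gagliardo s (\<lambda>x. v x - w x) \<le> E"
    by blast
qed

section \<open>Lipschitz cut-offs and the density of test functions\<close>

definition tent :: "'a::euclidean_space \<Rightarrow> real \<Rightarrow> 'a \<Rightarrow> real" where
  "tent p r x = max 0 (min 1 (2 - 2 / r * norm (x - p)))"

lemma tent_range: "0 \<le> tent p r x" "tent p r x \<le> 1"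
  by (auto simp: tent_def)

lemma tent_measurable [measurable]: "tent p r \<in> borel_measurable borel"
  unfolding tent_def by measurable

lemma tent_eq_1: "0 < r \<Longrightarrow> x \<in> ball p (r / 2) \<Longrightarrow> tent p r x = 1"
  by (auto simp: tent_def dist_norm norm_minus_commute field_simps)

lemma tent_eq_0: "0 < r \<Longrightarrow> x \<notin> cball p r \<Longrightarrow> tent p r x = 0"
  by (auto simp: tent_def dist_norm norm_minus_commute field_simps)

text \<open>The 1 in the maximum comes from the range in \<open>[0, 1]\<close>, the
  \<open>4 / r\<^sup>2\<close> from the squared slope \<open>2 / r\<close>.\<close>

lemma tent_lipschitz:
  assumes "0 < r"
  shows "(tent p r x - tent p r y)\<^sup>2 \<le> max 1 (4 / r\<^sup>2) * min 1 ((norm (x - y))\<^sup>2)"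
proof -
  have 1: "\<bar>tent p r x - tent p r y\<bar> \<le> 1" using tent_range[of p r x] tent_range[of p r y] by auto
  have "\<bar>tent p r x - tent p r y\<bar> \<le> \<bar>2 / r * norm (x - p) - 2 / r * norm (y - p)\<bar>" unfolding tent_def by linarith
  also have "\<dots> = 2 / r * \<bar>norm (x - p) - norm (y - p)\<bar>"
    unfolding right_diff_distrib[symmetric] abs_mult using assms by (simp only: abs_of_pos divide_pos_pos zero_less_numeral)
  also have "\<dots> \<le> 2 / r * norm (x - y)"
    using norm_triangle_ineq3[of "x - p" "y - p"] assms by (intro mult_left_mono) auto
  finally have "(tent p r x - tent p r y)\<^sup>2 \<le> (2 / r * norm (x - y))\<^sup>2"
    using assms by (subst abs_le_square_iff[symmetric]) simp
  then have 2: "(tent p r x - tent p r y)\<^sup>2 \<le> 4 / r\<^sup>2 * (norm (x - y))\<^sup>2"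
    by (simp add: power_mult_distrib power_divide)
  have "(tent p r x - tent p r y)\<^sup>2 \<le> 1\<^sup>2" using 1 by (subst abs_le_square_iff[symmetric]) simp
  then have 3: "(tent p r x - tent p r y)\<^sup>2 \<le> max 1 (4 / r\<^sup>2) * 1" by simp
  have 4: "4 / r\<^sup>2 * (norm (x - y))\<^sup>2 \<le> max 1 (4 / r\<^sup>2) * (norm (x - y))\<^sup>2" by (intro mult_right_mono) auto
  show ?thesis using 2 3 4 by (auto simp: min_def)
qed

lemma hs0_mult:
  fixes w \<eta> :: "'a::euclidean_space \<Rightarrow> real"
  assumes "0 < s" "s < 1" "0 \<le> M" and w: "hs0 s \<Omega> w" and [measurable]: "\<eta> \<in> borel_measurable borel"
    and \<eta>: "\<And>x. \<bar>\<eta> x\<bar> \<le> 1" "\<And>x y. (\<eta> x - \<eta> y)\<^sup>2 \<le> M * min 1 ((norm (x - y))\<^sup>2)"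
  shows "hs0 s \<Omega> (\<lambda>x. \<eta> x * w x)"
proof -
  have [measurable]: "w \<in> borel_measurable borel" using w by (simp add: hs0_def)
  have "l2 (\<lambda>x. \<eta> x * w x) \<le> l2 w"
    using \<eta>(1) by (intro l2_mono) (simp add: abs_mult mult_left_le_one_le)
  moreover have "gagliardo s (\<lambda>x. \<eta> x * w x) \<le> 2 * gagliardo s w + ennreal (2 * M * kern_mass TYPE('a) s) * l2 w"
    using assms by (intro gagliardo_mult_le) auto
  moreover have "2 * gagliardo s w + ennreal (2 * M * kern_mass TYPE('a) s) * l2 w < \<infinity>"
    using w by (simp add: hs0_def ennreal_mult_less_top)
  ultimately show ?thesis using w unfolding hs0_def by (auto intro: order.strict_trans1)
qed

text \<open>No normalised partition of unity is formed; balls are removed one at a time. With a tent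
  \<eta> on the first ball, \<open>\<eta> w\<close> is treated locally, while
  \<open>(1 - \<eta>) w\<close> vanishes on the half ball and so is covered by the remaining half
  balls. Both factors keep the seminorm finite and the sign.\<close>

proposition density_nonneg:
  fixes w :: "'a::euclidean_space \<Rightarrow> real"
  assumes s: "0 < s" "s < 1" and dom: "bounded_smooth_domain \<Omega>"
    and w: "hs0 s \<Omega> w" "\<And>x. 0 \<le> w x"
  shows "approximable s \<Omega> w"
proof -
  have "open \<Omega>" "bounded \<Omega>" "smooth_boundary \<Omega>" using dom by (auto simp: bounded_smooth_domain_def)
  \<comment> \<open>A radius at which local approximation is already known: a ball inside \<Omega>
    at interior points, half of the chart radius at boundary points.\<close>
  define good where "good p r \<longleftrightarrow> 0 < r \<and> (\<forall>w. hs0 s \<Omega> w \<longrightarrow> (\<forall>x. 0 \<le> w x) \<longrightarrow>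
      (\<forall>x. x \<notin> cball p r \<longrightarrow> w x = 0) \<longrightarrow> approximable s \<Omega> w)" for p r
  have ex_good: "\<exists>r. good p r" if p: "p \<in> closure \<Omega>" for p
  proof (cases "p \<in> \<Omega>")
    case True
    then obtain r where r: "0 < r" "cball p r \<subseteq> \<Omega>" using \<open>open \<Omega>\<close> open_contains_cball by blast
    have "good p r" unfolding good_def
    proof (intro conjI allI impI r)
      fix w :: "'a \<Rightarrow> real" assume "hs0 s \<Omega> w" "\<forall>x. 0 \<le> w x" "\<forall>x. x \<notin> cball p r \<longrightarrow> w x = 0"
      then show "approximable s \<Omega> w"
        using r \<open>open \<Omega>\<close> by (intro approximable_compact[of "cball p r"]) (auto simp: hs0_def)
    qed
    then show ?thesis ..
  next
    case False
    then have "p \<in> frontier \<Omega>" using p \<open>open \<Omega>\<close> by (simp add: frontier_def interior_open)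
    then obtain r e \<gamma> where "0 < r" "norm e = 1" "smooth \<gamma>"
      "\<Omega> \<inter> ball p r = {x \<in> ball p r. \<gamma> (x - (x \<bullet> e) *\<^sub>R e) < x \<bullet> e}"
      using \<open>smooth_boundary \<Omega>\<close> unfolding smooth_boundary_def by blast
    then have "good p (r / 2)" unfolding good_def
      using approximable_boundary[OF \<open>open \<Omega>\<close>, of r e \<gamma> p s] by auto
    then show ?thesis ..
  qed
  then obtain R where R: "\<And>p. p \<in> closure \<Omega> \<Longrightarrow> good p (R p)" by metis
  have "compact (closure \<Omega>)" using \<open>bounded \<Omega>\<close> by simp
  moreover have "closure \<Omega> \<subseteq> (\<Union>p\<in>closure \<Omega>. ball p (R p / 2))"
  proof
    fix x assume "x \<in> closure \<Omega>"
    then show "x \<in> (\<Union>p\<in>closure \<Omega>. ball p (R p / 2))" using R[of x] by (auto simp: good_def intro!: bexI[of _ x])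
  qed
  ultimately obtain F where F: "F \<subseteq> closure \<Omega>" "finite F" "closure \<Omega> \<subseteq> (\<Union>p\<in>F. ball p (R p / 2))"
    using compactE_image[of "closure \<Omega>" "closure \<Omega>" "\<lambda>p. ball p (R p / 2)"] by (metis open_ball)
  \<comment> \<open>General in \<open>w\<close>, since the induction hypothesis is applied to the
    remainder \<open>(1 - ?\<eta> x) * w x\<close>.\<close>
  have main: "finite F \<Longrightarrow> F \<subseteq> closure \<Omega> \<Longrightarrow> hs0 s \<Omega> w \<Longrightarrow> (\<And>x. 0 \<le> w x) \<Longrightarrow>
      (\<And>x. w x \<noteq> 0 \<Longrightarrow> x \<in> (\<Union>p\<in>F. ball p (R p / 2))) \<Longrightarrow> approximable s \<Omega> w" for F w
  proof (induction F arbitrary: w rule: finite_induct)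
    case empty
    then have "w = (\<lambda>_. 0)" by auto
    moreover have "(\<lambda>_. 0::real) \<in> test_functions \<Omega>"
      by (rule test_functionsI[of _ "{}"]) (auto intro: flat_algebra_smooth flat_algebra.const)
    ultimately show ?case
      unfolding approximable_def by (intro allI impI bexI[of _ "\<lambda>_. 0"]) (auto simp: l2_def gagliardo_def quot_def)
  next
    case (insert p F)
    define r where "r = R p"
    have gp: "good p r" using insert R by (simp add: r_def)
    then have r: "0 < r" by (simp add: good_def)
    let ?\<eta> = "tent p r"
    have 1: "hs0 s \<Omega> (\<lambda>x. ?\<eta> x * w x)"
      using tent_range[of p r] tent_lipschitz[OF r] by (intro hs0_mult[OF s _ insert.prems(2), of "max 1 (4 / r\<^sup>2)"]) auto
    have 2: "hs0 s \<Omega> (\<lambda>x. (1 - ?\<eta> x) * w x)"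
    proof (intro hs0_mult[OF s _ insert.prems(2), of "max 1 (4 / r\<^sup>2)"])
      show "((1 - tent p r x) - (1 - tent p r y))\<^sup>2 \<le> max 1 (4 / r\<^sup>2) * min 1 ((norm (x - y))\<^sup>2)" for x y
        using tent_lipschitz[OF r, of p x y] by (simp add: power2_commute)
      show "\<bar>1 - tent p r x\<bar> \<le> 1" for x using tent_range[of p r x] by auto
    qed auto
    have a1: "approximable s \<Omega> (\<lambda>x. ?\<eta> x * w x)"
      using gp 1 insert.prems(3) tent_range(1)[of p r] tent_eq_0[OF r, of _ p] unfolding good_def by simp
    have a2: "approximable s \<Omega> (\<lambda>x. (1 - ?\<eta> x) * w x)"
    proof (rule insert.IH[OF _ 2])
      show "F \<subseteq> closure \<Omega>" using insert.prems by simp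
      show "0 \<le> (1 - ?\<eta> x) * w x" for x using tent_range(2)[of p r x] insert.prems(3)[of x] by simp
      fix x assume x: "(1 - ?\<eta> x) * w x \<noteq> 0"
      then have "x \<notin> ball p (r / 2)" using tent_eq_1[OF r, of x p] by auto
      then show "x \<in> (\<Union>p\<in>F. ball p (R p / 2))" using insert.prems(4)[of x] x by (auto simp: r_def)
    qed
    have "approximable s \<Omega> (\<lambda>x. ?\<eta> x * w x + (1 - ?\<eta> x) * w x)" by (intro approximable_add 1 2 a1 a2)
    then show ?case by (simp add: algebra_simps)
  qed
  have "x \<in> (\<Union>p\<in>F. ball p (R p / 2))" if "w x \<noteq> 0" for x
  proof -
    have "x \<in> closure \<Omega>" using that w(1) closure_subset[of \<Omega>] unfolding hs0_def by blast
    then show ?thesis using F(3) by blast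
  qed
  then show ?thesis using main[OF F(2,1) w] by simp
qed

subsection \<open>The fractional Laplacian of a test function\<close>

text \<open>In the Taylor expansions at \<open>z\<close> and \<open>- z\<close> the linear terms
  cancel. What is left is of second order near 0 and bounded far away, exactly what
  \<open>kern_integrable_min\<close> can absorb.\<close>

lemma test_functions_second_difference:
  fixes f :: "'a::euclidean_space \<Rightarrow> real"
  assumes f: "f \<in> test_functions \<Omega>"
  obtains C where "0 \<le> C" "\<And>x z. \<bar>2 * f x - f (x + z) - f (x - z)\<bar> \<le> C * min 1 ((norm z)\<^sup>2)"
proof -
  obtain M where M: "0 \<le> M" "\<And>x. \<bar>f x\<bar> \<le> M" using test_functions_bounded[OF f] by blast
  obtain T where T: "0 \<le> T" "\<And>x h. \<bar>f (x + h) - f x - frechet_derivative f (at x) h\<bar> \<le> T * (norm h)\<^sup>2"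
    using test_functions_taylor[OF f] by blast
  have "\<bar>2 * f x - f (x + z) - f (x - z)\<bar> \<le> max (4 * M) (2 * T) * min 1 ((norm z)\<^sup>2)" for x z
  proof (cases "1 \<le> (norm z)\<^sup>2")
    case True
    have "\<bar>2 * f x - f (x + z) - f (x - z)\<bar> \<le> 4 * M"
      using M(2)[of x] M(2)[of "x + z"] M(2)[of "x - z"] by linarith
    then show ?thesis using True by simp
  next
    case False
    have "linear (frechet_derivative f (at x))"
      using smooth_has_derivative[OF test_functions_smooth[OF f]] by (rule has_derivative_linear)
    then have "frechet_derivative f (at x) (- z) = - frechet_derivative f (at x) z" by (rule linear_neg)
    then have "\<bar>2 * f x - f (x + z) - f (x - z)\<bar> \<le> 2 * T * (norm z)\<^sup>2"
      using T(2)[of x z] T(2)[of x "- z"] by simp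
    also have "\<dots> \<le> max (4 * M) (2 * T) * (norm z)\<^sup>2" by (intro mult_right_mono) auto
    finally show ?thesis using False by simp
  qed
  then show ?thesis using M by (intro that[of "max (4 * M) (2 * T)"]) auto
qed

lemma test_functions_square_difference:
  fixes f :: "'a::euclidean_space \<Rightarrow> real"
  assumes f: "f \<in> test_functions \<Omega>"
  obtains C where "0 \<le> C" "\<And>x y. (f x - f y)\<^sup>2 \<le> C * min 1 ((norm (x - y))\<^sup>2)"
proof -
  obtain M where M: "0 \<le> M" "\<And>x. \<bar>f x\<bar> \<le> M" using test_functions_bounded[OF f] by blast
  obtain L where L: "0 \<le> L" "\<And>x y. \<bar>f x - f y\<bar> \<le> L * norm (x - y)" using test_functions_lipschitz[OF f] by blast
  have "(f x - f y)\<^sup>2 \<le> max ((2 * M)\<^sup>2) (L\<^sup>2) * min 1 ((norm (x - y))\<^sup>2)" for x y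
  proof (cases "1 \<le> (norm (x - y))\<^sup>2")
    case True
    have "\<bar>f x - f y\<bar> \<le> \<bar>2 * M\<bar>" using M(2)[of x] M(2)[of y] by linarith
    then have "(f x - f y)\<^sup>2 \<le> (2 * M)\<^sup>2" by (simp only: abs_le_square_iff)
    then show ?thesis using True by simp
  next
    case False
    have "\<bar>f x - f y\<bar> \<le> \<bar>L * norm (x - y)\<bar>" using L(1) L(2)[of x y] by simp
    then have "(f x - f y)\<^sup>2 \<le> (L * norm (x - y))\<^sup>2" by (simp only: abs_le_square_iff)
    also have "\<dots> \<le> max ((2 * M)\<^sup>2) (L\<^sup>2) * (norm (x - y))\<^sup>2"
      unfolding power_mult_distrib[of L] by (intro mult_right_mono) auto
    finally show ?thesis using False by simp
  qed
  then show ?thesis by (intro that[of "max ((2 * M)\<^sup>2) (L\<^sup>2)"]) (auto simp: le_max_iff_disj)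
qed

lemma test_functions_supportE:
  assumes "f \<in> test_functions \<Omega>"
  obtains K where "compact K" "K \<subseteq> \<Omega>" "\<And>x. x \<notin> K \<Longrightarrow> f x = 0"
proof
  show "compact (closure {x. f x \<noteq> 0})" "closure {x. f x \<noteq> 0} \<subseteq> \<Omega>"
    using assms by (simp_all add: test_functions_def)
qed (rule zero_outside_closure_support)

lemma test_functions_hs0:
  fixes f :: "'a::euclidean_space \<Rightarrow> real"
  assumes "0 < s" "s < 1" and f: "f \<in> test_functions \<Omega>"
  shows "hs0 s \<Omega> f"
proof -
  obtain K where K: "compact K" "K \<subseteq> \<Omega>" and z: "\<And>x. x \<notin> K \<Longrightarrow> f x = 0"
    using test_functions_supportE[OF f] by blast
  have [measurable]: "K \<in> sets borel" using K(1) by (simp add: compact_imp_closed)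
  have [measurable]: "f \<in> borel_measurable borel" using f by (rule test_functions_measurable)
  obtain M where M: "0 \<le> M" "\<And>x. \<bar>f x\<bar> \<le> M" using test_functions_bounded[OF f] by blast
  obtain C where C: "0 \<le> C" "\<And>x y. (f x - f y)\<^sup>2 \<le> C * min 1 ((norm (x - y))\<^sup>2)"
    using test_functions_square_difference[OF f] by blast
  have "gagliardo s f < \<infinity>"
    using emeasure_compact_finite[OF K(1)] z C assms
    by (intro gagliardo_finite_of_lipschitz[of s C f K]) auto
  moreover have "l2 f \<le> (\<integral>\<^sup>+x. ennreal (M\<^sup>2) * indicator K x \<partial>lborel)"
    unfolding l2_def
  proof (intro nn_integral_mono)
    fix x show "ennreal ((f x)\<^sup>2) \<le> ennreal (M\<^sup>2) * indicator K x"
    proof (cases "x \<in> K")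
      case True
      have "(f x)\<^sup>2 \<le> M\<^sup>2" using M(1) M(2)[of x] by (subst abs_le_square_iff[symmetric]) simp
      then show ?thesis using True by (simp add: ennreal_leI)
    qed (simp add: z)
  qed
  moreover have "(\<integral>\<^sup>+x. ennreal (M\<^sup>2) * indicator K x \<partial>lborel) < \<infinity>"
    using emeasure_compact_finite[OF K(1)] by (subst nn_integral_cmult_indicator) (auto simp: ennreal_mult_less_top)
  ultimately show ?thesis using z K(2) unfolding hs0_def by (auto intro: order.strict_trans1)
qed

definition lap_truncated :: "real \<Rightarrow> ('a::euclidean_space \<Rightarrow> real) \<Rightarrow> real \<Rightarrow> 'a \<Rightarrow> real" where
  "lap_truncated s f \<epsilon> x = (LINT y|lborel. indicator {y. \<epsilon> < norm (x - y)} y * ((f x - f y) * kern s (x - y)))"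

text \<open>The principal value averaged over \<open>z\<close> and \<open>- z\<close>, hence the
  factor 1/2. For test functions the integral converges absolutely; the constant \<open>c\<close> is
  left out.\<close>

definition lap :: "real \<Rightarrow> ('a::euclidean_space \<Rightarrow> real) \<Rightarrow> 'a \<Rightarrow> real" where
  "lap s f x = 1 / 2 * (LINT z|lborel. (2 * f x - f (x + z) - f (x - z)) * kern s z)"

lemma integrable_truncated:
  fixes f :: "'a::euclidean_space \<Rightarrow> real"
  assumes s: "0 < s" "s < 1" and f: "f \<in> test_functions \<Omega>" and "0 < \<epsilon>"
  shows "integrable lborel (\<lambda>z. indicator {z. \<epsilon> < norm z} z * ((f x - f (x - z)) * kern s z))"
    and "integrable lborel (\<lambda>z. indicator {z. \<epsilon> < norm z} z * ((f x - f (x + z)) * kern s z))"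
    and "integrable lborel (\<lambda>y. indicator {y. \<epsilon> < norm (x - y)} y * ((f x - f y) * kern s (x - y)))"
proof -
  obtain M where M: "0 \<le> M" "\<And>x. \<bar>f x\<bar> \<le> M" using test_functions_bounded[OF f] by blast
  have [measurable]: "f \<in> borel_measurable borel" using f by (rule test_functions_measurable)
  have bd: "integrable lborel (\<lambda>z. indicator {z. \<epsilon> < norm z} z * ((f x - f (T z)) * kern s z))"
    if [measurable]: "T \<in> borel_measurable borel" for T :: "'a \<Rightarrow> 'a"
  proof (rule Bochner_Integration.integrable_bound)
    show "integrable lborel (\<lambda>z::'a. 2 * M * (indicator {z. \<epsilon> < norm z} z * kern s z))"
      using kern_integrable_tail[OF s \<open>0 < \<epsilon>\<close>] by (rule integrable_mult_right)
    have "\<bar>f x - f (T z)\<bar> \<le> 2 * M" for z using M(2)[of x] M(2)[of "T z"] by linarith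
    then have "\<bar>f x - f (T z)\<bar> * kern s z \<le> 2 * M * kern s z" for z by (intro mult_right_mono) auto
    then show "AE z in lborel. norm (indicator {z. \<epsilon> < norm z} z * ((f x - f (T z)) * kern s z))
        \<le> norm (2 * M * (indicator {z. \<epsilon> < norm z} z * kern s z))"
      using M(1) by (intro AE_I2) (auto simp: abs_mult split: split_indicator)
  qed measurable
  show 1: "integrable lborel (\<lambda>z. indicator {z. \<epsilon> < norm z} z * ((f x - f (x - z)) * kern s z))"
    by (rule bd) measurable
  show "integrable lborel (\<lambda>z. indicator {z. \<epsilon> < norm z} z * ((f x - f (x + z)) * kern s z))"
    by (rule bd) measurable
  have "integrable (distr lborel borel (\<lambda>y. x - y)) (\<lambda>z. indicator {z. \<epsilon> < norm z} z * ((f x - f (x - z)) * kern s z))"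
    unfolding lborel_distr_diff_left by (rule 1)
  then show "integrable lborel (\<lambda>y. indicator {y. \<epsilon> < norm (x - y)} y * ((f x - f y) * kern s (x - y)))"
    by (subst (asm) integrable_distr_eq) (auto simp: indicator_def)
qed

lemma lap_truncated_eq:
  fixes f :: "'a::euclidean_space \<Rightarrow> real"
  assumes s: "0 < s" "s < 1" and f: "f \<in> test_functions \<Omega>" and "0 < \<epsilon>"
  shows "lap_truncated s f \<epsilon> x =
    1 / 2 * (LINT z|lborel. indicator {z. \<epsilon> < norm z} z * ((2 * f x - f (x + z) - f (x - z)) * kern s z))"
proof -
  have [measurable]: "f \<in> borel_measurable borel" using f by (rule test_functions_measurable)
  note int = integrable_truncated[OF s f \<open>0 < \<epsilon>\<close>, of x]
  have 1: "lap_truncated s f \<epsilon> x = (LINT z|lborel. indicator {z. \<epsilon> < norm z} z * ((f x - f (x - z)) * kern s z))"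
    unfolding lap_truncated_def
    using integral_lborel_diff_left[of "\<lambda>z. indicator {z. \<epsilon> < norm z} z * ((f x - f (x - z)) * kern s z)" x]
    by (simp add: indicator_def)
  also have "\<dots> = (LINT z|lborel. indicator {z. \<epsilon> < norm z} z * ((f x - f (x + z)) * kern s z))"
    using integral_lborel_diff_left[of "\<lambda>z. indicator {z. \<epsilon> < norm z} z * ((f x - f (x - z)) * kern s z)" 0]
    by (simp add: indicator_def)
  finally have 2: "lap_truncated s f \<epsilon> x = \<dots>" .
  have "(LINT z|lborel. indicator {z. \<epsilon> < norm z} z * ((2 * f x - f (x + z) - f (x - z)) * kern s z))
      = (LINT z|lborel. indicator {z. \<epsilon> < norm z} z * ((f x - f (x - z)) * kern s z) + indicator {z. \<epsilon> < norm z} z * ((f x - f (x + z)) * kern s z))"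
    by (intro Bochner_Integration.integral_cong) (auto simp: algebra_simps)
  also have "\<dots> = lap_truncated s f \<epsilon> x + lap_truncated s f \<epsilon> x"
    unfolding Bochner_Integration.integral_add[OF int(1,2)] using 1 2 by simp
  finally show ?thesis by simp
qed

text \<open>A single majorant \<open>W\<close> bounds the truncated integrals and removes the
  truncation. Uniformity in both \<epsilon> and \<open>x\<close> permits dominated convergence later
  against a function that is merely integrable.\<close>

lemma lap_truncated_bound:
  fixes f :: "'a::euclidean_space \<Rightarrow> real"
  assumes s: "0 < s" "s < 1" and f: "f \<in> test_functions \<Omega>"
  obtains C where "0 \<le> C" "\<And>\<epsilon> x. 0 < \<epsilon> \<Longrightarrow> \<bar>lap_truncated s f \<epsilon> x\<bar> \<le> C" "\<And>x. \<bar>lap s f x\<bar> \<le> C"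
    "\<And>x X. X \<longlonglongrightarrow> 0 \<Longrightarrow> (\<And>k. 0 < X k) \<Longrightarrow> (\<lambda>k. lap_truncated s f (X k) x) \<longlonglongrightarrow> lap s f x"
proof -
  obtain C where C: "0 \<le> C" "\<And>x z. \<bar>2 * f x - f (x + z) - f (x - z)\<bar> \<le> C * min 1 ((norm z)\<^sup>2)"
    using test_functions_second_difference[OF f] by blast
  have [measurable]: "f \<in> borel_measurable borel" using f by (rule test_functions_measurable)
  define W where "W z = C * (min 1 ((norm z)\<^sup>2) * kern s z)" for z :: 'a
  have W: "integrable lborel W" unfolding W_def by (intro integrable_mult_right kern_integrable_min s)
  have bd: "\<bar>(2 * f x - f (x + z) - f (x - z)) * kern s z\<bar> \<le> W z" for x z
    using mult_right_mono[OF C(2)[of x z] kern_nonneg[of s z]] by (simp add: W_def abs_mult mult.assoc)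
  have bd': "\<bar>indicator {z. \<epsilon> < norm z} z * ((2 * f x - f (x + z) - f (x - z)) * kern s z)\<bar> \<le> W z" for x z \<epsilon>
    using bd[of x z] by (auto simp: indicator_def)
  have i1: "integrable lborel (\<lambda>z. (2 * f x - f (x + z) - f (x - z)) * kern s z)" for x
    by (rule Bochner_Integration.integrable_bound[OF W]) (auto intro!: order_trans[OF bd])
  have i2: "integrable lborel (\<lambda>z. indicator {z. \<epsilon> < norm z} z * ((2 * f x - f (x + z) - f (x - z)) * kern s z))" for x \<epsilon>
    by (rule Bochner_Integration.integrable_bound[OF W]) (measurable, auto intro!: AE_I2 order_trans[OF bd'])
  define B where "B = (LINT z|lborel. W z)"
  have Wnn: "0 \<le> W z" for z using C by (simp add: W_def)
  have B: "0 \<le> B" unfolding B_def by (intro integral_nonneg_AE) (simp add: Wnn)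
  have half: "\<bar>1 / 2 * t\<bar> \<le> B" if "\<bar>t\<bar> \<le> B" for t using B that by linarith
  have "\<bar>LINT z|lborel. (2 * f x - f (x + z) - f (x - z)) * kern s z\<bar> \<le> B" for x
    unfolding B_def by (rule order_trans[OF integral_abs_bound integral_mono[OF integrable_abs[OF i1] W bd]])
  then have b1: "\<bar>lap s f x\<bar> \<le> B" for x unfolding lap_def by (rule half)
  have "\<bar>LINT z|lborel. indicator {z. \<epsilon> < norm z} z * ((2 * f x - f (x + z) - f (x - z)) * kern s z)\<bar> \<le> B" for x \<epsilon>
    unfolding B_def by (rule order_trans[OF integral_abs_bound integral_mono[OF integrable_abs[OF i2] W bd']])
  then have b2: "\<bar>lap_truncated s f \<epsilon> x\<bar> \<le> B" if "0 < \<epsilon>" for x \<epsilon>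
    unfolding lap_truncated_eq[OF s f that] by (rule half)
  have lim: "(\<lambda>k. lap_truncated s f (X k) x) \<longlonglongrightarrow> lap s f x" if X: "X \<longlonglongrightarrow> 0" "\<And>k. 0 < X k" for x and X :: "nat \<Rightarrow> real"
    unfolding lap_truncated_eq[OF s f X(2)] lap_def
  proof (intro tendsto_mult_left integral_dominated_convergence[where w=W])
    show "AE z in lborel. norm (indicator {z. X k < norm z} z * ((2 * f x - f (x + z) - f (x - z)) * kern s z)) \<le> W z" for k
      using bd' by simp
    show "AE z in lborel. (\<lambda>k. indicator {z. X k < norm z} z * ((2 * f x - f (x + z) - f (x - z)) * kern s z))
        \<longlonglongrightarrow> (2 * f x - f (x + z) - f (x - z)) * kern s z"
    proof (rule AE_I2)
      fix z :: 'a
      show "(\<lambda>k. indicator {z. X k < norm z} z * ((2 * f x - f (x + z) - f (x - z)) * kern s z))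
        \<longlonglongrightarrow> (2 * f x - f (x + z) - f (x - z)) * kern s z"
      proof (cases "z = 0")
        case False
        then have "\<forall>\<^sub>F k in sequentially. X k < norm z" using X(1) by (intro order_tendstoD(2)) auto
        then have "\<forall>\<^sub>F k in sequentially. indicator {z. X k < norm z} z * ((2 * f x - f (x + z) - f (x - z)) * kern s z)
            = (2 * f x - f (x + z) - f (x - z)) * kern s z" by eventually_elim simp
        then show ?thesis by (rule tendsto_eventually)
      qed simp
    qed
  qed (use W in \<open>simp_all, measurable\<close>)
  show ?thesis using that[OF B b2 b1 lim] by blast
qed

lemma has_frac_laplacian_test_function:
  fixes f :: "'a::euclidean_space \<Rightarrow> real"
  assumes s: "0 < s" "s < 1" and f: "f \<in> test_functions \<Omega>"
  shows "has_frac_laplacian c s f x (c * lap s f x)"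
proof -
  have [measurable]: "f \<in> borel_measurable borel" using f by (rule test_functions_measurable)
  have eq: "indicator {y. \<epsilon> < norm (x - y)} y *\<^sub>R ((f x - f y) / norm (x - y) powr (real DIM('a) + 2 * s))
     = indicator {y. \<epsilon> < norm (x - y)} y * ((f x - f y) * kern s (x - y))" for \<epsilon> y
    by (simp add: kern_def)
  have m: "(\<lambda>y. indicator {y. \<epsilon> < norm (x - y)} y * ((f x - f y) * kern s (x - y))) \<in> borel_measurable lborel" for \<epsilon>
    by measurable
  have "set_integrable lebesgue {y. \<epsilon> < norm (x - y)} (\<lambda>y. (f x - f y) / norm (x - y) powr (real DIM('a) + 2 * s))" if "0 < \<epsilon>" for \<epsilon>
    unfolding set_integrable_def eq integrable_completion[OF m] by (rule integrable_truncated(3)[OF s f that])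
  moreover have "(LINT y:{y. \<epsilon> < norm (x - y)}|lebesgue. (f x - f y) / norm (x - y) powr (real DIM('a) + 2 * s)) = lap_truncated s f \<epsilon> x" for \<epsilon>
    unfolding set_lebesgue_integral_def eq integral_completion[OF m] lap_truncated_def ..
  moreover have "((\<lambda>\<epsilon>. c * lap_truncated s f \<epsilon> x) \<longlongrightarrow> c * lap s f x) (at_right 0)"
    unfolding tendsto_at_iff_sequentially comp_def
    using lap_truncated_bound[OF s f] by (auto intro!: tendsto_mult_left)
  ultimately show ?thesis unfolding has_frac_laplacian_def by simp
qed

lemma frac_laplacian_test_function:
  fixes f :: "'a::euclidean_space \<Rightarrow> real"
  assumes s: "0 < s" "s < 1" and f: "f \<in> test_functions \<Omega>"
  shows "frac_laplacian c s f x = c * lap s f x"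
  unfolding frac_laplacian_def
proof (rule the_equality)
  show "has_frac_laplacian c s f x (c * lap s f x)" by (rule has_frac_laplacian_test_function[OF s f])
  fix L assume "has_frac_laplacian c s f x L"
  then show "L = c * lap s f x"
    using has_frac_laplacian_test_function[OF s f, of c x] unfolding has_frac_laplacian_def
    using tendsto_unique[OF trivial_limit_at_right_real] by blast
qed

text \<open>The polarised form of \<open>gagliardo\<close>. Each unordered pair is counted twice,
  which is the origin of the factor 1/2 in the next lemma.\<close>

definition bil :: "real \<Rightarrow> ('a::euclidean_space \<Rightarrow> real) \<Rightarrow> ('a \<Rightarrow> real) \<Rightarrow> real" where
  "bil s v w = (LINT z|lborel. quot s v z * quot s w z)"

text \<open>The integrals are truncated away from the diagonal, where Fubini and the antisymmetry of
  \<open>f x - f y\<close> apply; dominated convergence removes the truncation on both sides.\<close>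

lemma integral_mult_lap:
  fixes f v :: "'a::euclidean_space \<Rightarrow> real"
  assumes s: "0 < s" "s < 1" and f: "f \<in> test_functions \<Omega>"
    and v: "integrable lborel v" "gagliardo s v < \<infinity>"
  shows "(LINT x|lborel. v x * lap s f x) = 1 / 2 * bil s v f"
proof -
  have [measurable]: "f \<in> borel_measurable borel" using f by (rule test_functions_measurable)
  have [measurable]: "v \<in> borel_measurable borel" using v by auto
  have gf: "gagliardo s f < \<infinity>" using test_functions_hs0[OF s f] by (simp add: hs0_def)
  obtain M where M: "0 \<le> M" "\<And>x. \<bar>f x\<bar> \<le> M" using test_functions_bounded[OF f] by blast
  obtain C where C: "0 \<le> C" "\<And>\<epsilon> x. 0 < \<epsilon> \<Longrightarrow> \<bar>lap_truncated s f \<epsilon> x\<bar> \<le> C" "\<And>x. \<bar>lap s f x\<bar> \<le> C"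
    and lim: "\<And>x X. X \<longlonglongrightarrow> 0 \<Longrightarrow> (\<And>k. 0 < X k) \<Longrightarrow> (\<lambda>k. lap_truncated s f (X k) x) \<longlonglongrightarrow> lap s f x"
    using lap_truncated_bound[OF s f] by metis
  have [measurable]: "lap_truncated s f \<epsilon> \<in> borel_measurable borel" for \<epsilon>
    unfolding lap_truncated_def[abs_def] by measurable
  have [measurable]: "lap s f \<in> borel_measurable borel"
    unfolding lap_def[abs_def] by measurable
  have qv: "integrable lborel (\<lambda>z. quot s v z * quot s f z)"
    using v(2) gf unfolding gagliardo_def by (intro l2_product_integrable) auto
  define X :: "nat \<Rightarrow> real" where "X k = 1 / (real k + 1)" for k
  have X: "X \<longlonglongrightarrow> 0" "\<And>k. 0 < X k"
    unfolding X_def using LIMSEQ_inverse_real_of_nat by (auto simp: inverse_eq_divide add.commute)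
  have trunc: "(LINT x|lborel. v x * lap_truncated s f \<epsilon> x)
      = 1 / 2 * (LINT z|lborel. indicator {z. \<epsilon> < norm (fst z - snd z)} z * (quot s v z * quot s f z))" if \<epsilon>: "0 < \<epsilon>" for \<epsilon>
  proof -
    define H where "H z = indicator {z. \<epsilon> < norm (fst z - snd z)} z * (v (fst z) * ((f (fst z) - f (snd z)) * kern s (fst z - snd z)))" for z :: "'a \<times> 'a"
    have mp: "(\<lambda>z::'a\<times>'a. indicator {z. \<epsilon> < norm (fst z - snd z)} z :: real) \<in> borel_measurable borel"
      by (intro borel_measurable_indicator borel_open open_Collect_less continuous_intros)
    have [measurable]: "H \<in> borel_measurable borel"
      unfolding H_def using mp unfolding borel_prod[symmetric] by measurable
    \<comment> \<open>The kernel mass beyond \<epsilon>, the same around every point; it makes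
      \<open>H\<close> absolutely integrable for integrable \<open>v\<close> and bounded
      \<open>f\<close>.\<close>
    define T where "T = (LINT z|lborel. indicator {z::'a. \<epsilon> < norm z} z * kern s z)"
    have tail: "(\<integral>\<^sup>+y. ennreal (indicator {z. \<epsilon> < norm z} (x - y) * kern s (x - y)) \<partial>lborel) = ennreal T" for x :: 'a
    proof -
      have "(\<integral>\<^sup>+y. ennreal (indicator {z. \<epsilon> < norm z} (x - y) * kern s (x - y)) \<partial>lborel) = (\<integral>\<^sup>+z. ennreal (indicator {z::'a. \<epsilon> < norm z} z * kern s z) \<partial>lborel)"
        by (rule nn_integral_lborel_diff_left) measurable
      also have "\<dots> = ennreal T" unfolding T_def
        by (intro nn_integral_eq_integral kern_integrable_tail s \<epsilon>) auto
      finally show ?thesis .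
    qed
    have Hbd: "ennreal (norm (H (x, y))) \<le> ennreal (2 * M * \<bar>v x\<bar>) * ennreal (indicator {z. \<epsilon> < norm z} (x - y) * kern s (x - y))" for x y
    proof -
      have "\<bar>f x - f y\<bar> \<le> 2 * M" using M(2)[of x] M(2)[of y] by linarith
      then have "\<bar>v x\<bar> * \<bar>f x - f y\<bar> * kern s (x - y) \<le> \<bar>v x\<bar> * (2 * M) * kern s (x - y)"
        by (intro mult_right_mono mult_left_mono) auto
      then have "norm (H (x, y)) \<le> (2 * M * \<bar>v x\<bar>) * (indicator {z. \<epsilon> < norm z} (x - y) * kern s (x - y))"
        by (auto simp: H_def abs_mult mult_ac split: split_indicator)
      then show ?thesis using M(1) by (simp flip: ennreal_mult add: ennreal_leI)
    qed
    have "(\<integral>\<^sup>+z. ennreal (norm (H z)) \<partial>lborel) = (\<integral>\<^sup>+x. \<integral>\<^sup>+y. ennreal (norm (H (x, y))) \<partial>lborel \<partial>lborel)"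
      by (rule nn_integral_lborel_pair) measurable
    also have "\<dots> \<le> (\<integral>\<^sup>+x. \<integral>\<^sup>+y. ennreal (2 * M * \<bar>v x\<bar>) * ennreal (indicator {z. \<epsilon> < norm z} (x - y) * kern s (x - y)) \<partial>lborel \<partial>lborel)"
      by (intro nn_integral_mono Hbd)
    also have "\<dots> = (\<integral>\<^sup>+x. ennreal (2 * M * \<bar>v x\<bar>) * ennreal T \<partial>lborel)"
      by (subst nn_integral_cmult) (auto simp: tail)
    also have "\<dots> = (\<integral>\<^sup>+x. ennreal (2 * M * \<bar>v x\<bar>) \<partial>lborel) * ennreal T"
      by (rule nn_integral_multc) measurable
    also have "\<dots> < \<infinity>"
    proof -
      have "integrable lborel (\<lambda>x. 2 * M * \<bar>v x\<bar>)" using v(1) by auto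
      then have "(\<integral>\<^sup>+x. ennreal (2 * M * \<bar>v x\<bar>) \<partial>lborel) = ennreal (LINT x|lborel. 2 * M * \<bar>v x\<bar>)"
        using M(1) by (intro nn_integral_eq_integral) auto
      then show ?thesis by (simp add: ennreal_mult_less_top)
    qed
    finally have iH: "integrable lborel H" by (intro integrableI_bounded) auto
    have iHp: "integrable (lborel \<Otimes>\<^sub>M lborel) H" using iH by (simp add: lborel_prod)
    have inner: "(LINT y|lborel. H (x, y)) = v x * lap_truncated s f \<epsilon> x" for x
    proof -
      have "H (x, y) = v x * (indicator {y. \<epsilon> < norm (x - y)} y * ((f x - f y) * kern s (x - y)))" for y
        by (simp add: H_def indicator_def)
      then show ?thesis unfolding lap_truncated_def by (simp only: integral_mult_right_zero)
    qed
    have 1: "(LINT z|lborel. H z) = (LINT x|lborel. v x * lap_truncated s f \<epsilon> x)"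
      using lborel_pair.integral_fst'[OF iHp] by (simp add: inner lborel_prod)
    have 2: "(LINT z|lborel. H (snd z, fst z)) = (LINT z|lborel. H z)"
      using lborel_pair.integral_product_swap[of H] iHp by (simp add: lborel_prod case_prod_unfold borel_measurable_integrable)
    have 3: "integrable lborel (\<lambda>z. H (snd z, fst z))"
      using lborel_pair.integrable_product_swap[OF iHp] by (simp add: lborel_prod case_prod_unfold)
    have "(LINT z|lborel. H z) + (LINT z|lborel. H (snd z, fst z)) = (LINT z|lborel. H z + H (snd z, fst z))"
      using iH 3 by simp
    also have "\<dots> = (LINT z|lborel. indicator {z. \<epsilon> < norm (fst z - snd z)} z * (quot s v z * quot s f z))"
    proof (rule Bochner_Integration.integral_cong)
      fix z :: "'a \<times> 'a"
      have "quot s v z * quot s f z = (v (fst z) - v (snd z)) * (f (fst z) - f (snd z)) * (sqrt (kern s (fst z - snd z)) * sqrt (kern s (fst z - snd z)))"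
        by (simp add: quot_def mult_ac)
      also have "sqrt (kern s (fst z - snd z)) * sqrt (kern s (fst z - snd z)) = kern s (fst z - snd z)" by simp
      finally show "H z + H (snd z, fst z) = indicator {z. \<epsilon> < norm (fst z - snd z)} z * (quot s v z * quot s f z)"
        unfolding H_def using kern_diff_commute[of s "snd z" "fst z"]
        by (auto simp: indicator_def norm_minus_commute algebra_simps)
    qed simp
    finally show ?thesis using 1 2 by simp
  qed
  have L: "(\<lambda>k. LINT x|lborel. v x * lap_truncated s f (X k) x) \<longlonglongrightarrow> (LINT x|lborel. v x * lap s f x)"
  proof (rule integral_dominated_convergence[where w="\<lambda>x. \<bar>v x\<bar> * C"])
    show "integrable lborel (\<lambda>x. \<bar>v x\<bar> * C)" using v(1) by auto
    show "AE x in lborel. (\<lambda>k. v x * lap_truncated s f (X k) x) \<longlonglongrightarrow> v x * lap s f x"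
      using lim[OF X] by (auto intro!: tendsto_mult_left)
    show "AE x in lborel. norm (v x * lap_truncated s f (X k) x) \<le> \<bar>v x\<bar> * C" for k
      using C(2)[OF X(2)] by (auto simp: abs_mult intro!: mult_left_mono)
  qed measurable
  have mi: "(\<lambda>z::'a\<times>'a. indicator {z. \<epsilon> < norm (fst z - snd z)} z * (quot s v z * quot s f z)) \<in> borel_measurable lborel" for \<epsilon>
  proof -
    have [measurable]: "(\<lambda>z::'a\<times>'a. indicator {z. \<epsilon> < norm (fst z - snd z)} z :: real) \<in> borel_measurable borel"
      by (intro borel_measurable_indicator borel_open open_Collect_less continuous_intros)
    show ?thesis by measurable
  qed
  have R: "(\<lambda>k. LINT z|lborel. indicator {z. X k < norm (fst z - snd z)} z * (quot s v z * quot s f z)) \<longlonglongrightarrow> bil s v f"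
    unfolding bil_def
  proof (rule integral_dominated_convergence[where w="\<lambda>z. \<bar>quot s v z * quot s f z\<bar>"])
    show "AE z in lborel. (\<lambda>k. indicator {z. X k < norm (fst z - snd z)} z * (quot s v z * quot s f z)) \<longlonglongrightarrow> quot s v z * quot s f z"
    proof (rule AE_I2)
      fix z :: "'a \<times> 'a"
      show "(\<lambda>k. indicator {z. X k < norm (fst z - snd z)} z * (quot s v z * quot s f z)) \<longlonglongrightarrow> quot s v z * quot s f z"
      proof (cases "fst z = snd z")
        case False
        then have "\<forall>\<^sub>F k in sequentially. X k < norm (fst z - snd z)" using X(1) by (intro order_tendstoD(2)) auto
        then have "\<forall>\<^sub>F k in sequentially. indicator {z. X k < norm (fst z - snd z)} z * (quot s v z * quot s f z) = quot s v z * quot s f z"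
          by eventually_elim simp
        then show ?thesis by (rule tendsto_eventually)
      qed (simp add: quot_def)
    qed
    show "AE z in lborel. norm (indicator {z. X k < norm (fst z - snd z)} z * (quot s v z * quot s f z)) \<le> \<bar>quot s v z * quot s f z\<bar>" for k
      by (auto simp: indicator_def)
  qed (use qv mi in auto)
  have "(\<lambda>k. LINT x|lborel. v x * lap_truncated s f (X k) x) \<longlonglongrightarrow> 1 / 2 * bil s v f"
    unfolding trunc[OF X(2)] by (intro tendsto_mult_left R)
  then show ?thesis using L LIMSEQ_unique by blast
qed

subsection \<open>Convergence in square mean\<close>

definition ip :: "('a::euclidean_space \<Rightarrow> real) \<Rightarrow> ('a \<Rightarrow> real) \<Rightarrow> real" where
  "ip f g = (LINT x|lborel. f x * g x)"

lemma bil_eq_ip: "bil s v w = ip (quot s v) (quot s w)"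
  by (simp add: bil_def ip_def)

lemma ip_self:
  assumes "f \<in> borel_measurable borel" "l2 f < \<infinity>"
  shows "ip f f = enn2real (l2 f)"
  using l2_finite_integrable(2)[OF assms] by (simp add: ip_def power2_eq_square)

lemma ip_diff_right:
  assumes [measurable]: "f \<in> borel_measurable borel" "g \<in> borel_measurable borel" "h \<in> borel_measurable borel"
    and "l2 f < \<infinity>" "l2 g < \<infinity>" "l2 h < \<infinity>"
  shows "ip f (\<lambda>x. g x - h x) = ip f g - ip f h"
  using l2_product_integrable[of f g] l2_product_integrable[of f h] assms
  by (simp add: ip_def right_diff_distrib)

text \<open>Free of finiteness assumptions: if the product is not integrable, the integral on the
  left is 0 by convention.\<close>

lemma ip_Cauchy_Schwarz:
  assumes [measurable]: "f \<in> borel_measurable borel" "g \<in> borel_measurable borel"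
  shows "ennreal ((ip f g)\<^sup>2) \<le> l2 f * l2 g"
proof (cases "integrable lborel (\<lambda>x. f x * g x)")
  case True
  have "ennreal \<bar>ip f g\<bar> \<le> (\<integral>\<^sup>+x. ennreal \<bar>f x\<bar> * ennreal \<bar>g x\<bar> \<partial>lborel)"
    using integral_norm_bound_ennreal[OF True] by (simp add: ip_def abs_mult ennreal_mult)
  then have "(ennreal \<bar>ip f g\<bar>)\<^sup>2 \<le> (\<integral>\<^sup>+x. ennreal \<bar>f x\<bar> * ennreal \<bar>g x\<bar> \<partial>lborel)\<^sup>2"
    by (rule power_mono) simp
  also have "\<dots> \<le> (\<integral>\<^sup>+x. (ennreal \<bar>f x\<bar>)\<^sup>2 \<partial>lborel) * (\<integral>\<^sup>+x. (ennreal \<bar>g x\<bar>)\<^sup>2 \<partial>lborel)"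
    by (rule Cauchy_Schwarz_nn_integral) measurable
  finally show ?thesis by (simp add: l2_def ennreal_power)
qed (simp add: ip_def not_integrable_integral_eq)

lemma tendsto_0_of_square_ennreal:
  fixes t :: "nat \<Rightarrow> real"
  assumes "(\<lambda>k. ennreal ((t k)\<^sup>2)) \<longlonglongrightarrow> 0"
  shows "t \<longlonglongrightarrow> 0"
proof -
  have "(\<lambda>k. ennreal ((t k)\<^sup>2)) \<longlonglongrightarrow> ennreal 0" using assms by simp
  then have "(\<lambda>k. (t k)\<^sup>2) \<longlonglongrightarrow> 0" by (subst (asm) tendsto_ennreal_iff) auto
  then have "(\<lambda>k. sqrt ((t k)\<^sup>2)) \<longlonglongrightarrow> sqrt 0" by (rule tendsto_real_sqrt)
  then show ?thesis by (simp add: tendsto_rabs_zero_iff)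
qed

lemma l2_diff_finite:
  assumes "f \<in> borel_measurable borel" "g \<in> borel_measurable borel" "l2 f < \<infinity>" "l2 g < \<infinity>"
  shows "l2 (\<lambda>x. f x - g x) < \<infinity>"
  using assms(3,4) by (intro order.strict_trans1[OF l2_diff_le[OF assms(1,2)]]) (simp add: ennreal_mult_less_top)

lemma ip_tendsto:
  assumes [measurable]: "f \<in> borel_measurable borel" "g \<in> borel_measurable borel" "\<And>k. G k \<in> borel_measurable borel"
    and fin: "l2 f < \<infinity>" "l2 g < \<infinity>" "\<And>k. l2 (G k) < \<infinity>"
    and lim: "(\<lambda>k. l2 (\<lambda>x. G k x - g x)) \<longlonglongrightarrow> 0"
  shows "(\<lambda>k. ip f (G k)) \<longlonglongrightarrow> ip f g"
proof -
  have "(\<lambda>k. l2 f * l2 (\<lambda>x. G k x - g x)) \<longlonglongrightarrow> l2 f * 0"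
    using fin lim by (intro ennreal_tendsto_cmult) auto
  then have "(\<lambda>k. ennreal ((ip f (\<lambda>x. G k x - g x))\<^sup>2)) \<longlonglongrightarrow> 0"
    by (intro tendsto_0_ennreal_le[OF ip_Cauchy_Schwarz]) auto
  then have "(\<lambda>k. ip f (\<lambda>x. G k x - g x)) \<longlonglongrightarrow> 0" by (rule tendsto_0_of_square_ennreal)
  then have "(\<lambda>k. ip f (G k) - ip f g) \<longlonglongrightarrow> 0"
    using fin by (simp add: ip_diff_right)
  then show ?thesis by (simp add: LIM_zero_iff)
qed

text \<open>Expanding the square of \<open>G k - g\<close> expresses the norm of \<open>G k\<close>
  through the norm of the difference and the product with \<open>g\<close>, both of which
  converge.\<close>

lemma l2_tendsto:
  assumes [measurable]: "g \<in> borel_measurable borel" "\<And>k. G k \<in> borel_measurable borel"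
    and fin: "l2 g < \<infinity>" "\<And>k. l2 (G k) < \<infinity>"
    and lim: "(\<lambda>k. l2 (\<lambda>x. G k x - g x)) \<longlonglongrightarrow> 0"
  shows "(\<lambda>k. enn2real (l2 (G k))) \<longlonglongrightarrow> enn2real (l2 g)"
proof -
  have d: "l2 (\<lambda>x. G k x - g x) < \<infinity>" for k
    using fin by (intro l2_diff_finite) auto
  have eq: "enn2real (l2 (G k)) = enn2real (l2 (\<lambda>x. G k x - g x)) + 2 * ip g (G k) - enn2real (l2 g)" for k
  proof -
    have "ip (\<lambda>x. G k x - g x) (\<lambda>x. G k x - g x) = (LINT x|lborel. G k x * G k x - 2 * (g x * G k x) + g x * g x)"
      unfolding ip_def by (intro Bochner_Integration.integral_cong) (auto simp: algebra_simps)
    also have "\<dots> = ip (G k) (G k) - 2 * ip g (G k) + ip g g"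
      using fin l2_product_integrable[of "G k" "G k"] l2_product_integrable[of g "G k"] l2_product_integrable[of g g]
      by (simp add: ip_def)
    finally show ?thesis using fin d by (simp add: ip_self)
  qed
  have "(\<lambda>k. enn2real (l2 (\<lambda>x. G k x - g x))) \<longlonglongrightarrow> 0"
    using lim by (intro tendsto_enn2real) auto
  moreover have "(\<lambda>k. ip g (G k)) \<longlonglongrightarrow> ip g g" using fin lim by (intro ip_tendsto) auto
  ultimately have "(\<lambda>k. enn2real (l2 (\<lambda>x. G k x - g x)) + 2 * ip g (G k) - enn2real (l2 g)) \<longlonglongrightarrow> 0 + 2 * ip g g - enn2real (l2 g)"
    by (intro tendsto_add tendsto_diff tendsto_mult_left tendsto_const)
  then show ?thesis unfolding eq using fin by (simp add: ip_self)
qed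

lemma l2_AE_subseq:
  assumes [measurable]: "\<And>k. G k \<in> borel_measurable borel" "g \<in> borel_measurable borel"
    and fin: "\<And>k. l2 (\<lambda>x. G k x - g x) < \<infinity>"
    and lim: "(\<lambda>k. l2 (\<lambda>x. G k x - g x)) \<longlonglongrightarrow> 0"
  obtains r :: "nat \<Rightarrow> nat" where "strict_mono r" "AE x in lborel. (\<lambda>k. G (r k) x) \<longlonglongrightarrow> g x"
proof -
  have "\<exists>r::nat\<Rightarrow>nat. strict_mono r \<and> (AE x in lborel. (\<lambda>n. (G (r n) x - g x)\<^sup>2) \<longlonglongrightarrow> 0)"
  proof (rule tendsto_L1_AE_subseq)
    show "integrable lborel (\<lambda>x. (G n x - g x)\<^sup>2)" for n using fin by (intro l2_finite_integrable) auto
    have "(\<lambda>n. enn2real (l2 (\<lambda>x. G n x - g x))) \<longlonglongrightarrow> 0"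
      using lim by (intro tendsto_enn2real) auto
    then show "(\<lambda>n. LINT x|lborel. norm ((G n x - g x)\<^sup>2)) \<longlonglongrightarrow> 0"
      using fin by (simp add: l2_finite_integrable(2))
  qed
  then obtain r :: "nat \<Rightarrow> nat" where r: "strict_mono r" "AE x in lborel. (\<lambda>n. (G (r n) x - g x)\<^sup>2) \<longlonglongrightarrow> 0" by blast
  from r(2) have "AE x in lborel. (\<lambda>k. G (r k) x) \<longlonglongrightarrow> g x"
  proof eventually_elim
    case (elim x)
    then have "(\<lambda>n. sqrt ((G (r n) x - g x)\<^sup>2)) \<longlonglongrightarrow> sqrt 0" by (rule tendsto_real_sqrt)
    then show ?case by (simp add: tendsto_rabs_zero_iff LIM_zero_iff)
  qed
  with r(1) show ?thesis by (rule that)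
qed

section \<open>Sequences of test functions and limits of the bilinear form\<close>

lemma hs0_measurable: "hs0 s \<Omega> w \<Longrightarrow> w \<in> borel_measurable borel"
  by (simp add: hs0_def)

lemma hs0_finite: "hs0 s \<Omega> w \<Longrightarrow> l2 w < \<infinity>" "hs0 s \<Omega> w \<Longrightarrow> gagliardo s w < \<infinity>"
  by (auto simp: hs0_def)

lemma hs0_diff_finite:
  assumes "hs0 s A v" "hs0 s B w"
  shows "l2 (\<lambda>x. v x - w x) < \<infinity>" "gagliardo s (\<lambda>x. v x - w x) < \<infinity>"
  unfolding gagliardo_def quot_diff
  by (intro l2_diff_finite quot_measurable hs0_measurable[OF assms(1)] hs0_measurable[OF assms(2)]
      hs0_finite[OF assms(1)] hs0_finite[OF assms(2)] hs0_finite(2)[OF assms(1), unfolded gagliardo_def]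
      hs0_finite(2)[OF assms(2), unfolded gagliardo_def])+

lemma inverse_Suc_ennreal_tendsto: "(\<lambda>k. ennreal (inverse (real (Suc k)))) \<longlonglongrightarrow> 0"
  using tendsto_ennrealI[OF LIMSEQ_inverse_real_of_nat] by simp

lemma density_sequence:
  fixes w :: "'a::euclidean_space \<Rightarrow> real"
  assumes s: "0 < s" "s < 1" and dom: "bounded_smooth_domain \<Omega>"
    and w: "hs0 s \<Omega> w" "\<And>x. 0 \<le> w x"
  obtains \<xi> where "\<And>k. \<xi> k \<in> test_functions \<Omega>" "\<And>k x. 0 \<le> \<xi> k x"
    "(\<lambda>k. l2 (\<lambda>x. \<xi> k x - w x)) \<longlonglongrightarrow> 0" "(\<lambda>k. gagliardo s (\<lambda>x. \<xi> k x - w x)) \<longlonglongrightarrow> 0"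
    "AE x in lborel. (\<lambda>k. \<xi> k x) \<longlonglongrightarrow> w x"
proof -
  have "\<exists>v\<in>test_functions \<Omega>. (\<forall>x. 0 \<le> v x) \<and> l2 (\<lambda>x. v x - w x) \<le> ennreal (inverse (real (Suc k)))
      \<and> gagliardo s (\<lambda>x. v x - w x) \<le> ennreal (inverse (real (Suc k)))" for k
    using density_nonneg[OF s dom w] unfolding approximable_def by simp
  then obtain v where v: "\<And>k. v k \<in> test_functions \<Omega>" "\<And>k x. 0 \<le> v k x"
    "\<And>k. l2 (\<lambda>x. v k x - w x) \<le> ennreal (inverse (real (Suc k)))"
    "\<And>k. gagliardo s (\<lambda>x. v k x - w x) \<le> ennreal (inverse (real (Suc k)))" by metis
  have 1: "(\<lambda>k. l2 (\<lambda>x. v k x - w x)) \<longlonglongrightarrow> 0" "(\<lambda>k. gagliardo s (\<lambda>x. v k x - w x)) \<longlonglongrightarrow> 0"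
    using v by (auto intro!: tendsto_0_ennreal_le[OF _ inverse_Suc_ennreal_tendsto])
  obtain r where r: "strict_mono r" "AE x in lborel. (\<lambda>k. v (r k) x) \<longlonglongrightarrow> w x"
    using l2_AE_subseq[OF test_functions_measurable[OF v(1)] hs0_measurable[OF w(1)] hs0_diff_finite(1)[OF test_functions_hs0[OF s v(1)] w(1)] 1(1)]
    by blast
  show ?thesis
    by (rule that[of "\<lambda>k. v (r k)"])
       (use v r LIMSEQ_subseq_LIMSEQ[OF 1(1) r(1)] LIMSEQ_subseq_LIMSEQ[OF 1(2) r(1)] in \<open>auto simp: o_def\<close>)
qed

text \<open>For bounded \<open>w\<close> with compact support, mollification alone provides one
  bound and one compact support for the whole sequence, which general density does not.\<close>

lemma mollify_sequence:
  fixes w :: "'a::euclidean_space \<Rightarrow> real"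
  assumes s: "0 < s" "s < 1" and K: "compact K" "open \<Omega>" "K \<subseteq> \<Omega>"
    and w: "hs0 s K w" "\<And>x. \<bar>w x\<bar> \<le> B"
  obtains K' \<xi> where "compact K'" "K' \<subseteq> \<Omega>" "\<And>k. \<xi> k \<in> test_functions \<Omega>" "\<And>k x. \<bar>\<xi> k x\<bar> \<le> B"
    "\<And>k x. x \<notin> K' \<Longrightarrow> \<xi> k x = 0"
    "(\<lambda>k. gagliardo s (\<lambda>x. \<xi> k x - w x)) \<longlonglongrightarrow> 0"
    "AE x in lborel. (\<lambda>k. \<xi> k x) \<longlonglongrightarrow> w x"
proof -
  have iw: "integrable lborel w"
    using hs0_integrable[OF w(1)] K(1) emeasure_compact_finite[OF K(1)] compact_imp_closed[OF K(1)] by auto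
  have "\<exists>d>0. \<exists>K'. compact K' \<and> K' \<subseteq> \<Omega> \<and> (\<forall>r \<rho>. r \<le> d \<longrightarrow> mollifier r \<rho> \<longrightarrow>
           mollify \<rho> w \<in> test_functions \<Omega> \<and> (\<forall>x. x \<notin> K' \<longrightarrow> mollify \<rho> w x = 0))"
    using mollify_test_function[OF K iw] w(1) by (auto simp: hs0_def)
  then obtain d K' where d: "0 < d" and K': "compact K'" "K' \<subseteq> \<Omega>"
    and dK: "\<And>r \<rho>. r \<le> d \<Longrightarrow> mollifier r \<rho> \<Longrightarrow> mollify \<rho> w \<in> test_functions \<Omega> \<and> (\<forall>x. x \<notin> K' \<longrightarrow> mollify \<rho> w x = 0)"
    by blast
  have "\<exists>v. v \<in> test_functions \<Omega> \<and> (\<forall>x. \<bar>v x\<bar> \<le> B) \<and> (\<forall>x. x \<notin> K' \<longrightarrow> v x = 0) \<and>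
      l2 (\<lambda>x. v x - w x) \<le> ennreal (inverse (real (Suc k)))
      \<and> gagliardo s (\<lambda>x. v x - w x) \<le> ennreal (inverse (real (Suc k)))" for k
  proof -
    obtain d1 where d1: "0 < d1" "\<And>r \<rho>. r \<le> d1 \<Longrightarrow> mollifier r \<rho> \<Longrightarrow>
       l2 (\<lambda>x. mollify \<rho> w x - w x) \<le> ennreal (inverse (real (Suc k))) \<and> gagliardo s (\<lambda>x. mollify \<rho> w x - w x) \<le> ennreal (inverse (real (Suc k)))"
      using mollify_approx[OF iw hs0_finite[OF w(1)], of "ennreal (inverse (real (Suc k)))"] by auto
    obtain \<rho> :: "'a \<Rightarrow> real" where \<rho>: "mollifier (min d d1) \<rho>" using mollifier_exists[of "min d d1"] d d1 by auto
    show ?thesis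
      using dK[OF _ \<rho>] d1(2)[OF _ \<rho>] mollify_bounded[OF \<rho> iw w(2)] by (intro exI[of _ "mollify \<rho> w"]) auto
  qed
  then have "\<exists>v. \<forall>k. v k \<in> test_functions \<Omega> \<and> (\<forall>x. \<bar>v k x\<bar> \<le> B) \<and> (\<forall>x. x \<notin> K' \<longrightarrow> v k x = 0) \<and>
      l2 (\<lambda>x. v k x - w x) \<le> ennreal (inverse (real (Suc k)))
      \<and> gagliardo s (\<lambda>x. v k x - w x) \<le> ennreal (inverse (real (Suc k)))" by (intro choice allI)
  then obtain v where v: "\<And>k. v k \<in> test_functions \<Omega>" "\<And>k x. \<bar>v k x\<bar> \<le> B" "\<And>k x. x \<notin> K' \<Longrightarrow> v k x = 0"
    "\<And>k. l2 (\<lambda>x. v k x - w x) \<le> ennreal (inverse (real (Suc k)))"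
    "\<And>k. gagliardo s (\<lambda>x. v k x - w x) \<le> ennreal (inverse (real (Suc k)))" by blast
  have 1: "(\<lambda>k. l2 (\<lambda>x. v k x - w x)) \<longlonglongrightarrow> 0" "(\<lambda>k. gagliardo s (\<lambda>x. v k x - w x)) \<longlonglongrightarrow> 0"
    using v by (auto intro!: tendsto_0_ennreal_le[OF _ inverse_Suc_ennreal_tendsto])
  obtain r where r: "strict_mono r" "AE x in lborel. (\<lambda>k. v (r k) x) \<longlonglongrightarrow> w x"
    using l2_AE_subseq[OF test_functions_measurable[OF v(1)] hs0_measurable[OF w(1)] hs0_diff_finite(1)[OF test_functions_hs0[OF s v(1)] w(1)] 1(1)]
    by blast
  show ?thesis
    by (rule that[of K' "\<lambda>k. v (r k)"])
       (use v r K' LIMSEQ_subseq_LIMSEQ[OF 1(2) r(1)] in \<open>auto simp: o_def\<close>)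
qed

lemma bil_tendsto:
  assumes "hs0 s A v" "hs0 s B w" "\<And>k. hs0 s C (\<xi> k)" "(\<lambda>k. gagliardo s (\<lambda>x. \<xi> k x - w x)) \<longlonglongrightarrow> 0"
  shows "(\<lambda>k. bil s v (\<xi> k)) \<longlonglongrightarrow> bil s v w"
  unfolding bil_eq_ip
  using assms hs0_finite(2)[OF assms(1)] hs0_finite(2)[OF assms(2)] hs0_finite(2)[OF assms(3)]
  by (intro ip_tendsto quot_measurable) (auto intro: hs0_measurable simp: gagliardo_def quot_diff)

subsection \<open>Stable solutions vanish\<close>

text \<open>Extends the equation beyond smooth test functions. Local integrability of
  \<open>F\<close> is enough, because \<open>B * \<bar>indicator K' x * F x\<bar>\<close> dominates
  every approximating integrand.\<close>

lemma weak_form_bounded: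
  fixes v w F :: "'a::euclidean_space \<Rightarrow> real"
  assumes s: "0 < s" "s < 1" and K: "compact K" "open \<Omega>" "K \<subseteq> \<Omega>"
    and v: "hs0 s \<Omega> v" and [measurable]: "F \<in> borel_measurable borel"
    and loc: "\<And>K. compact K \<Longrightarrow> K \<subseteq> \<Omega> \<Longrightarrow> integrable lborel (\<lambda>x. indicator K x * F x)"
    and weak: "\<And>\<phi>. \<phi> \<in> test_functions \<Omega> \<Longrightarrow> a * bil s v \<phi> = (LINT x|lborel. F x * \<phi> x)"
    and w: "hs0 s K w" "\<And>x. \<bar>w x\<bar> \<le> B"
  shows "a * bil s v w = (LINT x|lborel. F x * w x)" "integrable lborel (\<lambda>x. F x * w x)"
proof -
  have [measurable]: "w \<in> borel_measurable borel" using w(1) by (rule hs0_measurable)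
  have B: "0 \<le> B" using w(2)[of undefined] by linarith
  obtain K' \<xi> where K': "compact K'" "K' \<subseteq> \<Omega>" and \<xi>: "\<And>k. \<xi> k \<in> test_functions \<Omega>" "\<And>k x. \<bar>\<xi> k x\<bar> \<le> B"
    "\<And>k x. x \<notin> K' \<Longrightarrow> \<xi> k x = 0"
    "(\<lambda>k. gagliardo s (\<lambda>x. \<xi> k x - w x)) \<longlonglongrightarrow> 0"
    "AE x in lborel. (\<lambda>k. \<xi> k x) \<longlonglongrightarrow> w x"
    by (rule mollify_sequence[OF s K w]) (rule that)
  have [measurable]: "\<xi> k \<in> borel_measurable borel" for k using \<xi>(1) by (rule test_functions_measurable)
  have int: "integrable lborel (\<lambda>x. B * \<bar>indicator K' x * F x\<bar>)" using loc[OF K'] by auto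
  have "(\<lambda>k. LINT x|lborel. F x * \<xi> k x) \<longlonglongrightarrow> (LINT x|lborel. F x * w x)"
  proof (rule integral_dominated_convergence[OF _ _ int])
    show "AE x in lborel. (\<lambda>k. F x * \<xi> k x) \<longlonglongrightarrow> F x * w x"
      using \<xi>(5) by eventually_elim (intro tendsto_mult_left)
    show "AE x in lborel. norm (F x * \<xi> k x) \<le> B * \<bar>indicator K' x * F x\<bar>" for k
    proof (rule AE_I2)
      fix x show "norm (F x * \<xi> k x) \<le> B * \<bar>indicator K' x * F x\<bar>"
        using \<xi>(2)[of k x] \<xi>(3)[of x k] mult_right_mono[OF \<xi>(2)[of k x], of "\<bar>F x\<bar>"]
        by (cases "x \<in> K'") (auto simp: abs_mult mult.commute)
    qed
  qed measurable
  moreover have "(\<lambda>k. a * bil s v (\<xi> k)) \<longlonglongrightarrow> a * bil s v w"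
    using v w(1) test_functions_hs0[OF s \<xi>(1)] \<xi>(4) by (intro tendsto_mult_left bil_tendsto)
  ultimately show "a * bil s v w = (LINT x|lborel. F x * w x)"
    using weak[OF \<xi>(1)] LIMSEQ_unique by auto
  show "integrable lborel (\<lambda>x. F x * w x)"
  proof (rule Bochner_Integration.integrable_bound)
    show "integrable lborel (\<lambda>x. B * \<bar>indicator K x * F x\<bar>)" using loc[OF K(1,3)] by auto
    have "\<bar>F x * w x\<bar> \<le> \<bar>B * \<bar>indicator K x * F x\<bar>\<bar>" for x
      using mult_right_mono[OF w(2)[of x], of "\<bar>F x\<bar>"] B w(1)
      by (cases "x \<in> K") (auto simp: abs_mult mult.commute hs0_def)
    then show "AE x in lborel. norm (F x * w x) \<le> norm (B * \<bar>indicator K x * F x\<bar>)" by simp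
  qed measurable
qed

lemma C1_has_continuous_deriv:
  fixes f :: "real \<Rightarrow> real"
  assumes "f C1_differentiable_on UNIV"
  shows "(f has_real_derivative deriv f x) (at x)" "continuous_on UNIV f" "continuous_on UNIV (deriv f)"
proof -
  obtain D where D: "\<And>x. (f has_vector_derivative D x) (at x)" "continuous_on UNIV D"
    using assms by (auto simp: C1_differentiable_on_def)
  have "(f has_real_derivative D x) (at x)" for x
    using D(1) by (simp add: has_real_derivative_iff_has_vector_derivative)
  moreover from this have "deriv f = D" by (auto simp: fun_eq_iff intro!: DERIV_imp_deriv)
  ultimately show der: "(f has_real_derivative deriv f x) (at x)" for x by simp
  show "continuous_on UNIV f"
    using DERIV_isCont[OF der] by (simp add: continuous_at_imp_continuous_on)
  show "continuous_on UNIV (deriv f)" using D \<open>deriv f = D\<close> by simp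
qed

text \<open>Strictness is lost when difference quotients pass to the limit. So the weak tangent
  inequality is taken at the midpoint \<open>m\<close>, and strict convexity there,
  \<open>f m < (f x + f y) / 2\<close>, restores it.\<close>

lemma strictly_convex_tangent:
  assumes "strictly_convex f" "f C1_differentiable_on UNIV" "x \<noteq> y"
  shows "f x + deriv f x * (y - x) < f y"
proof -
  define m where "m = (x + y) / 2"
  have "(f has_real_derivative deriv f x) (at x)"
    using assms(2) by (rule C1_has_continuous_deriv)
  define q where "q t = (f (x + t * (m - x)) - f x) / t" for t
  have conv: "f ((1 - t) * a + t * b) \<le> (1 - t) * f a + t * f b" if "0 \<le> t" "t \<le> 1" for a b t
  proof (cases "a = b \<or> t = 0 \<or> t = 1")
    case True then show ?thesis by (auto simp: algebra_simps)
  next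
    case False then show ?thesis using assms(1) that by (auto simp: strictly_convex_def intro!: less_imp_le)
  qed
  have "q t \<le> f m - f x" if "0 < t" "t < 1" for t
  proof -
    have "f (x + t * (m - x)) \<le> (1 - t) * f x + t * f m"
      using conv[of t x m] that by (simp add: algebra_simps)
    then show ?thesis using that by (simp add: q_def field_simps)
  qed
  then have ev: "\<forall>\<^sub>F t in at_right 0. q t \<le> f m - f x"
    unfolding eventually_at_right_field by (intro exI[of _ 1]) auto
  have "((\<lambda>t. f (x + t * (m - x))) has_real_derivative deriv f x * (m - x)) (at 0)"
    by (rule DERIV_chain2[where g="\<lambda>t. x + t * (m - x)"])
       (use \<open>(f has_real_derivative deriv f x) (at x)\<close> in \<open>auto intro!: derivative_eq_intros\<close>)
  then have "(q \<longlongrightarrow> deriv f x * (m - x)) (at 0)"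
    by (simp add: has_field_derivative_iff q_def[abs_def])
  then have "(q \<longlongrightarrow> deriv f x * (m - x)) (at_right 0)" by (rule tendsto_within_subset) simp
  from tendsto_upperbound[OF this ev] have "deriv f x * (m - x) \<le> f m - f x" by simp
  moreover have "f m < (f x + f y) / 2"
    using assms(1)[unfolded strictly_convex_def, rule_format, of x y "1 / 2"] assms(3)
    by (simp add: m_def add_divide_distrib)
  moreover have "m - x = (y - x) / 2" by (simp add: m_def field_simps)
  ultimately show ?thesis by (simp add: field_simps)
qed

text \<open>With \<open>R = a G - b N\<close>, stability gives
  \<open>\<integral> h v\<^sup>2 \<le> R\<close> and the equation gives
  \<open>R \<le> \<integral> g v\<close>, while \<open>g v \<le> h v\<^sup>2\<close> pointwise. So
  equality holds almost everywhere, which strict convexity forbids where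
  \<open>v \<noteq> 0\<close>. In the application \<open>a\<close> is \<open>c / 2\<close>.\<close>

proposition stable_solution_vanishes:
  fixes v :: "'a::euclidean_space \<Rightarrow> real"
  assumes s: "0 < s" "s < 1" and a: "0 < a" and dom: "bounded_smooth_domain \<Omega>"
    and f: "f C1_differentiable_on UNIV" "strictly_convex f" "f 0 = 0"
    and v: "hs0 s \<Omega> v" "\<And>x. 0 \<le> v x"
    and loc: "\<And>K. compact K \<Longrightarrow> K \<subseteq> \<Omega> \<Longrightarrow> integrable lborel (\<lambda>x. indicator K x * f (v x))"
    and loc': "\<And>K. compact K \<Longrightarrow> K \<subseteq> \<Omega> \<Longrightarrow> integrable lborel (\<lambda>x. indicator K x * deriv f (v x))"
    and weak: "\<And>\<phi>. \<phi> \<in> test_functions \<Omega> \<Longrightarrow> a * bil s v \<phi> = (LINT x|lborel. f (v x) * \<phi> x)"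
    and stab: "\<And>\<xi>. \<xi> \<in> test_functions \<Omega> \<Longrightarrow> (LINT x|lborel. deriv f (v x) * (\<xi> x)\<^sup>2) \<le> a * enn2real (gagliardo s \<xi>)"
  shows "AE x in lborel. v x = 0"
proof -
  define b where "b = deriv f 0"
  define g where "g x = f (v x) - b * v x" for x
  define h where "h x = deriv f (v x) - b" for x
  have [measurable]: "v \<in> borel_measurable borel" using v(1) by (rule hs0_measurable)
  have [measurable]: "f \<in> borel_measurable borel" "deriv f \<in> borel_measurable borel"
    using C1_has_continuous_deriv(2,3)[OF f(1)] by (auto intro: borel_measurable_continuous_onI)
  have [measurable]: "g \<in> borel_measurable borel" "h \<in> borel_measurable borel"
    unfolding g_def[abs_def] h_def[abs_def] by measurable
  have "open \<Omega>" using dom by (simp add: bounded_smooth_domain_def)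
  \<comment> \<open>The tangent at 0 evaluated at \<open>v x\<close>, and the tangent at
    \<open>v x\<close> evaluated at 0; the second uses \<open>f 0 = 0\<close>.\<close>
  have pos: "0 < g x" "g x < h x * v x" if "v x \<noteq> 0" for x
    using strictly_convex_tangent[OF f(2,1), of 0 "v x"] strictly_convex_tangent[OF f(2,1), of "v x" 0] that f(3)
    by (auto simp: g_def h_def b_def algebra_simps)
  have g0: "0 \<le> g x" and gh: "g x \<le> h x * v x" for x
    using pos[of x] f(3) by (cases "v x = 0"; force simp: g_def)+
  have h0: "0 \<le> h x" for x
  proof (cases "v x = 0")
    case False
    then have "0 < h x * v x" using pos[of x] by linarith
    then show ?thesis using v(2)[of x] by (simp add: zero_less_mult_iff)
  qed (simp add: h_def b_def)
  obtain \<xi> where \<xi>: "\<And>k. \<xi> k \<in> test_functions \<Omega>" "\<And>k x. 0 \<le> \<xi> k x"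
    "(\<lambda>k. l2 (\<lambda>x. \<xi> k x - v x)) \<longlonglongrightarrow> 0" "(\<lambda>k. gagliardo s (\<lambda>x. \<xi> k x - v x)) \<longlonglongrightarrow> 0"
    "AE x in lborel. (\<lambda>k. \<xi> k x) \<longlonglongrightarrow> v x"
    using density_sequence[OF s dom v] by blast
  have [measurable]: "\<xi> k \<in> borel_measurable borel" for k using \<xi>(1) by (rule test_functions_measurable)
  note h\<xi> = test_functions_hs0[OF s \<xi>(1)]
  define G where "G = enn2real (gagliardo s v)"
  define N where "N = enn2real (l2 v)"
  have Nip: "ip v v = N" unfolding N_def using v(1) by (intro ip_self hs0_finite hs0_measurable)
  have Gbil: "bil s v v = G" unfolding G_def bil_eq_ip gagliardo_def
    using hs0_finite(2)[OF v(1)] by (intro ip_self) (auto simp: gagliardo_def)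
  define R where "R = a * G - b * N"

  have stab': "(\<integral>\<^sup>+x. ennreal (h x * (\<xi> k x)\<^sup>2) \<partial>lborel) \<le> ennreal (a * enn2real (gagliardo s (\<xi> k)) - b * enn2real (l2 (\<xi> k)))" for k
  proof -
    obtain K where K: "compact K" "K \<subseteq> \<Omega>" "\<And>x. x \<notin> K \<Longrightarrow> \<xi> k x = 0" using test_functions_supportE[OF \<xi>(1)] by blast
    obtain M where M: "0 \<le> M" "\<And>x. \<bar>\<xi> k x\<bar> \<le> M" using test_functions_bounded[OF \<xi>(1)] by blast
    have i1: "integrable lborel (\<lambda>x. deriv f (v x) * (\<xi> k x)\<^sup>2)"
    proof (rule Bochner_Integration.integrable_bound)
      show "integrable lborel (\<lambda>x. M\<^sup>2 * \<bar>indicator K x * deriv f (v x)\<bar>)" using loc'[OF K(1,2)] by auto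
      have "(\<xi> k x)\<^sup>2 \<le> M\<^sup>2" for x using M(1) M(2)[of x] by (subst abs_le_square_iff[symmetric]) simp
      then have "(\<xi> k x)\<^sup>2 * \<bar>deriv f (v x)\<bar> \<le> M\<^sup>2 * \<bar>deriv f (v x)\<bar>" for x by (intro mult_right_mono) auto
      then have "\<bar>deriv f (v x) * (\<xi> k x)\<^sup>2\<bar> \<le> \<bar>M\<^sup>2 * \<bar>indicator K x * deriv f (v x)\<bar>\<bar>" for x
        using K(3)[of x] by (cases "x \<in> K") (auto simp: abs_mult mult.commute)
      then show "AE x in lborel. norm (deriv f (v x) * (\<xi> k x)\<^sup>2) \<le> norm (M\<^sup>2 * \<bar>indicator K x * deriv f (v x)\<bar>)" by simp
    qed measurable
    have i2: "integrable lborel (\<lambda>x. (\<xi> k x)\<^sup>2)" "(LINT x|lborel. (\<xi> k x)\<^sup>2) = enn2real (l2 (\<xi> k))"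
      using h\<xi> by (auto intro!: l2_finite_integrable hs0_finite)
    have i3: "integrable lborel (\<lambda>x. h x * (\<xi> k x)\<^sup>2)" using i1 i2(1) by (simp add: h_def left_diff_distrib)
    have "(LINT x|lborel. h x * (\<xi> k x)\<^sup>2) = (LINT x|lborel. deriv f (v x) * (\<xi> k x)\<^sup>2) - b * enn2real (l2 (\<xi> k))"
      using i1 i2 by (simp add: h_def left_diff_distrib)
    also have "\<dots> \<le> a * enn2real (gagliardo s (\<xi> k)) - b * enn2real (l2 (\<xi> k))" using stab[OF \<xi>(1)] by simp
    finally show ?thesis using i3 h0 by (subst nn_integral_eq_integral) (auto intro: ennreal_leI)
  qed
  have lim: "(\<lambda>k. a * enn2real (gagliardo s (\<xi> k)) - b * enn2real (l2 (\<xi> k))) \<longlonglongrightarrow> R"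
    unfolding R_def G_def N_def
  proof (intro tendsto_diff tendsto_mult_left)
    show "(\<lambda>k. enn2real (l2 (\<xi> k))) \<longlonglongrightarrow> enn2real (l2 v)"
      using h\<xi> v(1) \<xi>(3) by (intro l2_tendsto hs0_finite hs0_measurable)
    show "(\<lambda>k. enn2real (gagliardo s (\<xi> k))) \<longlonglongrightarrow> enn2real (gagliardo s v)"
      unfolding gagliardo_def using hs0_finite(2)[OF h\<xi>] hs0_finite(2)[OF v(1)] \<xi>(4)
      by (intro l2_tendsto) (auto simp: gagliardo_def quot_diff)
  qed
  have fatou: "(\<integral>\<^sup>+x. ennreal (h x * (v x)\<^sup>2) \<partial>lborel) \<le> ennreal R"
  proof -
    have "(\<integral>\<^sup>+x. ennreal (h x * (v x)\<^sup>2) \<partial>lborel) = (\<integral>\<^sup>+x. liminf (\<lambda>k. ennreal (h x * (\<xi> k x)\<^sup>2)) \<partial>lborel)"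
    proof (rule nn_integral_cong_AE)
      show "AE x in lborel. ennreal (h x * (v x)\<^sup>2) = liminf (\<lambda>k. ennreal (h x * (\<xi> k x)\<^sup>2))"
        using \<xi>(5)
      proof eventually_elim
        case (elim x)
        then have "(\<lambda>k. ennreal (h x * (\<xi> k x)\<^sup>2)) \<longlonglongrightarrow> ennreal (h x * (v x)\<^sup>2)" by (intro tendsto_intros)
        then show ?case by (simp add: lim_imp_Liminf)
      qed
    qed
    also have "\<dots> \<le> liminf (\<lambda>k. \<integral>\<^sup>+x. ennreal (h x * (\<xi> k x)\<^sup>2) \<partial>lborel)"
      by (rule nn_integral_liminf) measurable
    also have "\<dots> \<le> liminf (\<lambda>k. ennreal (a * enn2real (gagliardo s (\<xi> k)) - b * enn2real (l2 (\<xi> k))))"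
      by (intro Liminf_mono always_eventually allI stab')
    also have "\<dots> = ennreal R" using tendsto_ennrealI[OF lim] by (simp add: lim_imp_Liminf)
    finally show ?thesis .
  qed
  have ih: "integrable lborel (\<lambda>x. h x * (v x)\<^sup>2)"
    using fatou h0 by (intro integrableI_bounded) (auto intro: order.strict_trans1)
  \<comment> \<open>Integrability of \<open>g v\<close> is not among the assumptions; it is
    inherited from \<open>h v\<^sup>2\<close>, which Fatou has just bounded.\<close>
  have ig: "integrable lborel (\<lambda>x. g x * v x)"
  proof (rule Bochner_Integration.integrable_bound[OF ih])
    have "g x * v x \<le> h x * v x * v x" for x by (intro mult_right_mono gh v)
    then show "AE x in lborel. norm (g x * v x) \<le> norm (h x * (v x)\<^sup>2)"
      using g0 h0 v(2) by (auto simp: power2_eq_square mult.assoc)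
  qed measurable

  \<comment> \<open>Below \<xi>, hence bounded with compact support and admissible in the equation;
    below \<open>v\<close>, hence \<open>g w \<le> g v\<close> without any bound on the
    sequence.\<close>
  define w where "w k x = min (v x) (\<xi> k x)" for k x
  have [measurable]: "w k \<in> borel_measurable borel" for k unfolding w_def[abs_def] by measurable
  \<comment> \<open>The error is minus the positive part of \<open>v - \<xi>\<close>. That map
    vanishes at 0 and is Lipschitz with constant 1, so \<xi>'s convergence to \<open>v\<close> in
    both norms carries over.\<close>
  have wv: "w k x - v x = - max 0 (v x - \<xi> k x)" for k x by (auto simp: w_def)
  have lw: "l2 (\<lambda>x. w k x - v x) \<le> l2 (\<lambda>x. \<xi> k x - v x)" for k
    unfolding wv by (rule l2_mono) auto
  have gw: "gagliardo s (\<lambda>x. w k x - v x) \<le> gagliardo s (\<lambda>x. \<xi> k x - v x)" for k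
    unfolding wv by (rule gagliardo_lipschitz) (auto simp: max_def)
  have w0: "0 \<le> w k x" "w k x \<le> v x" for k x using v(2)[of x] \<xi>(2)[of k x] by (auto simp: w_def)
  have whs: "\<exists>K B. compact K \<and> K \<subseteq> \<Omega> \<and> hs0 s K (w k) \<and> (\<forall>x. \<bar>w k x\<bar> \<le> B)" for k
  proof -
    obtain K where K: "compact K" "K \<subseteq> \<Omega>" "\<And>x. x \<notin> K \<Longrightarrow> \<xi> k x = 0" using test_functions_supportE[OF \<xi>(1)] by blast
    obtain M where M: "0 \<le> M" "\<And>x. \<bar>\<xi> k x\<bar> \<le> M" using test_functions_bounded[OF \<xi>(1)] by blast
    have "\<bar>w k x\<bar> \<le> M" for x using M(2)[of x] v(2)[of x] \<xi>(2)[of k x] by (auto simp: w_def)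
    moreover have "w k x = 0" if "x \<notin> K" for x using K(3)[OF that] v(2)[of x] by (auto simp: w_def)
    moreover have "l2 (w k) < \<infinity>"
      using l2_mono[of "w k" v] w0 v(2) hs0_finite(1)[OF v(1)] by (auto intro: order.strict_trans1)
    moreover have "gagliardo s (w k) < \<infinity>"
    proof -
      have "gagliardo s (w k) = gagliardo s (\<lambda>x. (w k x - v x) + v x)" by simp
      also have "\<dots> \<le> 2 * gagliardo s (\<lambda>x. w k x - v x) + 2 * gagliardo s v" by (rule gagliardo_add_le) measurable
      also have "\<dots> < \<infinity>"
        using order.strict_trans1[OF gw hs0_diff_finite(2)[OF h\<xi> v(1)]] hs0_finite(2)[OF v(1)]
        by (simp add: ennreal_mult_less_top)
      finally show ?thesis .
    qed
    ultimately show ?thesis using K by (intro exI[of _ K] exI[of _ M]) (auto simp: hs0_def)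
  qed
  have whs\<Omega>: "hs0 s \<Omega> (w k)" for k using whs[of k] by (auto simp: hs0_def)
  have fw: "a * bil s v (w k) = (LINT x|lborel. f (v x) * w k x)" "integrable lborel (\<lambda>x. f (v x) * w k x)" for k
  proof -
    obtain K B where KB: "compact K" "K \<subseteq> \<Omega>" "hs0 s K (w k)" "\<And>x. \<bar>w k x\<bar> \<le> B" using whs[of k] by blast
    show "a * bil s v (w k) = (LINT x|lborel. f (v x) * w k x)" "integrable lborel (\<lambda>x. f (v x) * w k x)"
      using weak_form_bounded[OF s KB(1) \<open>open \<Omega>\<close> KB(2) v(1) _ loc weak KB(3,4)] by auto
  qed
  have le: "a * bil s v (w k) - b * ip v (w k) \<le> (LINT x|lborel. g x * v x)" for k
  proof -
    have i: "integrable lborel (\<lambda>x. v x * w k x)"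
      using hs0_finite(1)[OF v(1)] hs0_finite(1)[OF whs\<Omega>] by (intro l2_product_integrable) auto
    have "a * bil s v (w k) - b * ip v (w k) = (LINT x|lborel. g x * w k x)"
      using i fw by (simp add: g_def ip_def left_diff_distrib mult.assoc)
    also have "\<dots> \<le> (LINT x|lborel. g x * v x)"
    proof (rule integral_mono[OF _ ig])
      show "integrable lborel (\<lambda>x. g x * w k x)" using i fw by (simp add: g_def left_diff_distrib mult.assoc)
      show "g x * w k x \<le> g x * v x" for x using w0 g0 by (intro mult_left_mono) auto
    qed
    finally show ?thesis .
  qed
  have "(\<lambda>k. bil s v (w k)) \<longlonglongrightarrow> bil s v v"
    using v(1) whs\<Omega> tendsto_0_ennreal_le[OF gw \<xi>(4)] by (intro bil_tendsto)
  moreover have "(\<lambda>k. ip v (w k)) \<longlonglongrightarrow> ip v v"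
    using v(1) whs\<Omega> tendsto_0_ennreal_le[OF lw \<xi>(3)] by (intro ip_tendsto hs0_finite hs0_measurable)
  ultimately have "(\<lambda>k. a * bil s v (w k) - b * ip v (w k)) \<longlonglongrightarrow> R"
    unfolding R_def Nip[symmetric] Gbil[symmetric] by (intro tendsto_intros)
  then have Rg: "R \<le> (LINT x|lborel. g x * v x)" by (rule LIMSEQ_le_const2) (use le in auto)
  \<comment> \<open>Should \<open>R\<close> be negative, \<open>ennreal R\<close> is 0 and so is the
    left integral, while the right one is nonnegative.\<close>
  have hR: "(LINT x|lborel. h x * (v x)\<^sup>2) \<le> (LINT x|lborel. g x * v x)"
  proof -
    have nn: "0 \<le> (LINT x|lborel. h x * (v x)\<^sup>2)" by (intro integral_nonneg_AE) (simp add: h0)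
    have "ennreal (LINT x|lborel. h x * (v x)\<^sup>2) \<le> ennreal R"
      using fatou ih h0 by (subst (asm) nn_integral_eq_integral) auto
    moreover have "0 \<le> (LINT x|lborel. g x * v x)" by (intro integral_nonneg_AE) (simp add: g0 v)
    ultimately show ?thesis using nn Rg by (cases "0 \<le> R") (auto simp: ennreal_neg)
  qed
  have nn: "0 \<le> h x * (v x)\<^sup>2 - g x * v x" for x
    using mult_right_mono[OF gh v(2), of x x] by (simp add: power2_eq_square)
  have "(LINT x|lborel. h x * (v x)\<^sup>2 - g x * v x) \<le> 0" using hR ih ig by simp
  moreover have "0 \<le> (LINT x|lborel. h x * (v x)\<^sup>2 - g x * v x)" by (intro integral_nonneg_AE AE_I2 nn)
  ultimately have "(LINT x|lborel. h x * (v x)\<^sup>2 - g x * v x) = 0" by simp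
  then have "AE x in lborel. h x * (v x)\<^sup>2 - g x * v x = 0"
    using integral_nonneg_eq_0_iff_AE[OF Bochner_Integration.integrable_diff[OF ih ig] AE_I2[OF nn]] by blast
  then show ?thesis
  proof eventually_elim
    case (elim x)
    show ?case
    proof (rule ccontr)
      assume "v x \<noteq> 0"
      then have "g x * v x < h x * v x * v x" using pos(2)[of x] v(2)[of x] by (intro mult_strict_right_mono) auto
      moreover have "h x * (v x)\<^sup>2 = h x * v x * v x" by (simp add: power2_eq_square)
      ultimately show False using elim by linarith
    qed
  qed
qed

subsection \<open>Compactness\<close>

text \<open>Each half-open grid cube is named by its lower corner. The grid is thus a measurable map
  whose fibres, the cubes, are automatically disjoint.\<close>

definition cube_index :: "real \<Rightarrow> 'a::euclidean_space \<Rightarrow> 'a" where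
  "cube_index \<delta> x = (\<Sum>b\<in>Basis. (\<delta> * of_int \<lfloor>x \<bullet> b / \<delta>\<rfloor>) *\<^sub>R b)"

definition cube :: "real \<Rightarrow> 'a::euclidean_space \<Rightarrow> 'a set" where
  "cube \<delta> p = {x. cube_index \<delta> x = p}"

lemma cube_index_measurable [measurable]: "cube_index \<delta> \<in> borel_measurable borel"
  unfolding cube_index_def by measurable

lemma cube_measurable [measurable]: "cube \<delta> p \<in> sets borel"
  unfolding cube_def by measurable

lemma cube_index_inner: "b \<in> Basis \<Longrightarrow> cube_index \<delta> x \<bullet> b = \<delta> * of_int \<lfloor>x \<bullet> b / \<delta>\<rfloor>"
  by (simp add: cube_index_def)

lemma cube_index_bounds:
  assumes "0 < \<delta>" "b \<in> Basis"
  shows "cube_index \<delta> x \<bullet> b \<le> x \<bullet> b" "x \<bullet> b < cube_index \<delta> x \<bullet> b + \<delta>"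
proof -
  show "cube_index \<delta> x \<bullet> b \<le> x \<bullet> b"
    using mult_left_mono[OF of_int_floor_le[of "x \<bullet> b / \<delta>"], of \<delta>] assms by (simp add: cube_index_inner)
  have "x \<bullet> b / \<delta> < of_int \<lfloor>x \<bullet> b / \<delta>\<rfloor> + 1" by linarith
  then show "x \<bullet> b < cube_index \<delta> x \<bullet> b + \<delta>"
    using assms by (simp add: cube_index_inner field_simps)
qed

lemma cube_diameter:
  fixes x y :: "'a::euclidean_space"
  assumes "0 < \<delta>" "cube_index \<delta> x = cube_index \<delta> y"
  shows "norm (x - y) \<le> real DIM('a) * \<delta>"
proof -
  have "norm (x - y) \<le> (\<Sum>b\<in>Basis. \<bar>(x - y) \<bullet> b\<bar>)" by (rule norm_le_l1)
  also have "\<dots> \<le> (\<Sum>b\<in>(Basis::'a set). \<delta>)"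
  proof (rule sum_mono)
    fix b :: 'a assume "b \<in> Basis"
    then show "\<bar>(x - y) \<bullet> b\<bar> \<le> \<delta>"
      using cube_index_bounds[OF assms(1), of b x] cube_index_bounds[OF assms(1), of b y] assms(2)
      by (simp add: inner_diff_left)
  qed
  finally show ?thesis by simp
qed

lemma emeasure_cube:
  fixes x0 :: "'a::euclidean_space"
  assumes "0 < \<delta>"
  shows "emeasure lborel (cube \<delta> (cube_index \<delta> x0)) = ennreal (\<delta> ^ DIM('a))"
proof (rule antisym)
  let ?p = "cube_index \<delta> x0"
  let ?u = "?p + (\<Sum>b\<in>Basis. \<delta> *\<^sub>R b)"
  have u: "?u \<bullet> b = ?p \<bullet> b + \<delta>" if "b \<in> Basis" for b using that by (simp add: inner_add_left)
  have "cube \<delta> ?p \<subseteq> cbox ?p ?u"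
  proof
    fix x assume "x \<in> cube \<delta> ?p"
    then have "cube_index \<delta> x = ?p" by (simp add: cube_def)
    then show "x \<in> cbox ?p ?u"
      unfolding mem_box using cube_index_bounds[OF assms, of _ x] u by (auto intro: less_imp_le)
  qed
  then have "emeasure lborel (cube \<delta> ?p) \<le> emeasure lborel (cbox ?p ?u)" by (intro emeasure_mono) auto
  also have "\<dots> = ennreal (\<delta> ^ DIM('a))"
    using assms u by (subst emeasure_lborel_cbox) (auto simp: inner_diff_left)
  finally show "emeasure lborel (cube \<delta> ?p) \<le> ennreal (\<delta> ^ DIM('a))" .
  have "box ?p ?u \<subseteq> cube \<delta> ?p"
  proof
    fix x assume x: "x \<in> box ?p ?u"
    have "cube_index \<delta> x \<bullet> b = ?p \<bullet> b" if b: "b \<in> Basis" for b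
    proof -
      have "\<delta> * of_int \<lfloor>x0 \<bullet> b / \<delta>\<rfloor> < x \<bullet> b" "x \<bullet> b < \<delta> * of_int \<lfloor>x0 \<bullet> b / \<delta>\<rfloor> + \<delta>"
        using x b u unfolding mem_box by (auto simp: cube_index_inner)
      then have "of_int \<lfloor>x0 \<bullet> b / \<delta>\<rfloor> < x \<bullet> b / \<delta>" "x \<bullet> b / \<delta> < of_int \<lfloor>x0 \<bullet> b / \<delta>\<rfloor> + 1"
        using assms by (simp_all add: field_simps)
      then have "\<lfloor>x \<bullet> b / \<delta>\<rfloor> = \<lfloor>x0 \<bullet> b / \<delta>\<rfloor>" by linarith
      then show ?thesis using b by (simp add: cube_index_inner)
    qed
    then show "x \<in> cube \<delta> ?p" by (simp add: cube_def euclidean_eq_iff[where 'a='a])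
  qed
  then have "emeasure lborel (box ?p ?u) \<le> emeasure lborel (cube \<delta> ?p)" by (intro emeasure_mono) auto
  moreover have "emeasure lborel (box ?p ?u) = ennreal (\<delta> ^ DIM('a))"
    using assms u by (subst emeasure_lborel_box) (auto simp: inner_diff_left)
  ultimately show "ennreal (\<delta> ^ DIM('a)) \<le> emeasure lborel (cube \<delta> ?p)" by simp
qed

lemma finite_cube_index_image:
  fixes S :: "'a::euclidean_space set"
  assumes "bounded S" "0 < \<delta>"
  shows "finite (cube_index \<delta> ` S)"
proof -
  obtain R where R: "\<And>x. x \<in> S \<Longrightarrow> norm x \<le> R" using assms(1) by (auto simp: bounded_iff)
  define m where "m = \<lceil>R / \<delta>\<rceil> + 1"
  have "cube_index \<delta> ` S \<subseteq> (\<lambda>k. \<Sum>b\<in>Basis. (\<delta> * of_int (k b)) *\<^sub>R b) ` (PiE Basis (\<lambda>_. {- m..m}))"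
  proof
    fix p assume "p \<in> cube_index \<delta> ` S"
    then obtain x where x: "x \<in> S" "p = cube_index \<delta> x" by blast
    let ?k = "\<lambda>b\<in>Basis. \<lfloor>x \<bullet> b / \<delta>\<rfloor>"
    have "\<lfloor>x \<bullet> b / \<delta>\<rfloor> \<in> {- m..m}" if "b \<in> Basis" for b
    proof -
      have "\<bar>x \<bullet> b\<bar> \<le> R" using Basis_le_norm[OF that, of x] R[OF x(1)] by linarith
      then have "\<bar>x \<bullet> b / \<delta>\<bar> \<le> R / \<delta>" using assms(2) by (simp add: abs_divide divide_right_mono)
      then show ?thesis unfolding m_def atLeastAtMost_iff by linarith
    qed
    then have "?k \<in> PiE Basis (\<lambda>_. {- m..m})" by auto
    moreover have "p = (\<Sum>b\<in>Basis. (\<delta> * of_int (?k b)) *\<^sub>R b)" unfolding x(2) cube_index_def by simp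
    ultimately show "p \<in> (\<lambda>k. \<Sum>b\<in>Basis. (\<delta> * of_int (k b)) *\<^sub>R b) ` (PiE Basis (\<lambda>_. {- m..m}))"
      by (intro image_eqI[where x="?k"])
  qed
  then show ?thesis by (rule finite_subset) (intro finite_imageI finite_PiE; simp)
qed

text \<open>Expansion of the square, with the integral over \<open>y\<close> taken first. The double
  integral is what the seminorm controls; the second claim, Cauchy-Schwarz on \<open>Q\<close>, is
  the nonnegativity of the same expression.\<close>

lemma variance_identity:
  fixes u :: "'a::euclidean_space \<Rightarrow> real"
  assumes [measurable]: "Q \<in> sets borel" and \<mu>: "emeasure lborel Q = ennreal \<mu>" "0 \<le> \<mu>"
    and [measurable]: "u \<in> borel_measurable borel" and fin: "l2 u < \<infinity>"
  defines "S \<equiv> (LINT x|lborel. indicator Q x * (u x)\<^sup>2)" and "A \<equiv> (LINT x|lborel. indicator Q x * u x)"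
  shows "(\<integral>\<^sup>+x. \<integral>\<^sup>+y. ennreal (indicator Q x * (indicator Q y * (u x - u y)\<^sup>2)) \<partial>lborel \<partial>lborel) = ennreal (2 * (\<mu> * S - A\<^sup>2))"
    and "A\<^sup>2 \<le> \<mu> * S"
proof -
  have iq: "integrable lborel (indicator Q :: 'a \<Rightarrow> real)" using \<mu> by (intro integrable_real_indicator) auto
  have mq: "(LINT x|lborel. indicator Q x :: real) = \<mu>" using \<mu> by (simp add: measure_def)
  have i2: "integrable lborel (\<lambda>x. indicator Q x * (u x)\<^sup>2)"
    by (rule Bochner_Integration.integrable_bound[OF l2_finite_integrable(1)[OF assms(4) fin]]) (auto simp: indicator_def)
  have i1: "integrable lborel (\<lambda>x. indicator Q x * u x)"
  proof (rule Bochner_Integration.integrable_bound)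
    show "integrable lborel (\<lambda>x. indicator Q x + indicator Q x * (u x)\<^sup>2)" using iq i2 by simp
    have "\<bar>u x\<bar> \<le> 1 + (u x)\<^sup>2" for x using sum_squares_bound[of 1 "\<bar>u x\<bar>"] by simp
    then show "AE x in lborel. norm (indicator Q x * u x) \<le> norm (indicator Q x + indicator Q x * (u x)\<^sup>2)"
      by (auto simp: indicator_def)
  qed measurable
  have inner: "(\<integral>\<^sup>+y. ennreal (indicator Q y * (a - u y)\<^sup>2) \<partial>lborel) = ennreal (a\<^sup>2 * \<mu> - 2 * a * A + S)" for a
  proof -
    have eq: "indicator Q y * (a - u y)\<^sup>2 = a\<^sup>2 * indicator Q y - 2 * a * (indicator Q y * u y) + indicator Q y * (u y)\<^sup>2" for y
      by (simp add: power2_eq_square algebra_simps)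
    have "integrable lborel (\<lambda>y. indicator Q y * (a - u y)\<^sup>2)" unfolding eq using iq i1 i2 by simp
    then have "(\<integral>\<^sup>+y. ennreal (indicator Q y * (a - u y)\<^sup>2) \<partial>lborel) = ennreal (LINT y|lborel. indicator Q y * (a - u y)\<^sup>2)"
      by (intro nn_integral_eq_integral) auto
    also have "(LINT y|lborel. indicator Q y * (a - u y)\<^sup>2) = a\<^sup>2 * \<mu> - 2 * a * A + S"
      unfolding eq using iq i1 i2 mq by (simp add: S_def A_def)
    finally show ?thesis .
  qed
  have pos: "0 \<le> indicator Q x * ((u x)\<^sup>2 * \<mu> - 2 * u x * A + S)" for x :: 'a
  proof -
    have "(LINT y|lborel. indicator Q y * (u x - u y)\<^sup>2) = (u x)\<^sup>2 * \<mu> - 2 * u x * A + S"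
    proof -
      have eq: "indicator Q y * (u x - u y)\<^sup>2 = (u x)\<^sup>2 * indicator Q y - 2 * u x * (indicator Q y * u y) + indicator Q y * (u y)\<^sup>2" for y
        by (simp add: power2_eq_square algebra_simps)
      show ?thesis unfolding eq using iq i1 i2 mq by (simp add: S_def A_def)
    qed
    moreover have "0 \<le> (LINT y|lborel. indicator Q y * (u x - u y)\<^sup>2)" by (intro integral_nonneg_AE) auto
    ultimately show ?thesis by simp
  qed
  have eq: "indicator Q x * ((u x)\<^sup>2 * \<mu> - 2 * u x * A + S) = \<mu> * (indicator Q x * (u x)\<^sup>2) - 2 * A * (indicator Q x * u x) + S * indicator Q x" for x
    by (simp add: algebra_simps)
  have io: "integrable lborel (\<lambda>x. indicator Q x * ((u x)\<^sup>2 * \<mu> - 2 * u x * A + S))" unfolding eq using iq i1 i2 by simp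
  have val: "(LINT x|lborel. indicator Q x * ((u x)\<^sup>2 * \<mu> - 2 * u x * A + S)) = 2 * (\<mu> * S - A\<^sup>2)"
  proof -
    have "(LINT x|lborel. indicator Q x * ((u x)\<^sup>2 * \<mu> - 2 * u x * A + S)) = \<mu> * S - 2 * A * A + S * \<mu>"
      unfolding eq using iq i1 i2 mq by (simp add: S_def[symmetric] A_def[symmetric])
    also have "\<dots> = 2 * (\<mu> * S - A\<^sup>2)" by (simp add: power2_eq_square algebra_simps)
    finally show ?thesis .
  qed
  have "(\<integral>\<^sup>+x. \<integral>\<^sup>+y. ennreal (indicator Q x * (indicator Q y * (u x - u y)\<^sup>2)) \<partial>lborel \<partial>lborel)
      = (\<integral>\<^sup>+x. ennreal (indicator Q x) * (\<integral>\<^sup>+y. ennreal (indicator Q y * (u x - u y)\<^sup>2) \<partial>lborel) \<partial>lborel)"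
    by (simp add: ennreal_mult nn_integral_cmult)
  also have "\<dots> = (\<integral>\<^sup>+x. ennreal (indicator Q x * ((u x)\<^sup>2 * \<mu> - 2 * u x * A + S)) \<partial>lborel)"
    unfolding inner by (intro nn_integral_cong) (auto simp: indicator_def)
  also have "\<dots> = ennreal (2 * (\<mu> * S - A\<^sup>2))"
    using nn_integral_eq_integral[OF io] pos val by simp
  finally show "(\<integral>\<^sup>+x. \<integral>\<^sup>+y. ennreal (indicator Q x * (indicator Q y * (u x - u y)\<^sup>2)) \<partial>lborel \<partial>lborel) = ennreal (2 * (\<mu> * S - A\<^sup>2))" .
  have "0 \<le> (LINT x|lborel. indicator Q x * ((u x)\<^sup>2 * \<mu> - 2 * u x * A + S))" by (intro integral_nonneg_AE AE_I2 pos)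
  then show "A\<^sup>2 \<le> \<mu> * S" unfolding val by simp
qed

definition cube_integral :: "real \<Rightarrow> ('a::euclidean_space \<Rightarrow> real) \<Rightarrow> 'a \<Rightarrow> real" where
  "cube_integral \<delta> u p = (LINT x|lborel. indicator (cube \<delta> p) x * u x)"

text \<open>A Poincare inequality on each cube. In dimension \<open>n\<close>, two points of one
  cube are at most \<open>n \<delta>\<close> apart, so distinct ones satisfy
  \<open>1 \<le> (n \<delta>) powr (n + 2 s) * kern s (x - y)\<close>. Division by the volume
  \<open>\<delta> ^ n\<close> leaves \<open>\<delta> powr (2 s)\<close>. Pairs from different cubes
  only enlarge the right side.\<close>

lemma l2_le_cubes:
  fixes u :: "'a::euclidean_space \<Rightarrow> real"
  assumes s: "0 < s" "s < 1" and \<delta>: "0 < \<delta>" and \<Omega>: "bounded \<Omega>" and u: "hs0 s \<Omega> u"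
  shows "enn2real (l2 u) \<le> (\<Sum>p\<in>cube_index \<delta> ` \<Omega>. (cube_integral \<delta> u p)\<^sup>2) / \<delta> ^ DIM('a)
     + real DIM('a) powr (real DIM('a) + 2 * s) * \<delta> powr (2 * s) * enn2real (gagliardo s u)"
proof -
  define n where "n = real DIM('a)"
  define F where "F = cube_index \<delta> ` \<Omega>"
  define \<mu> where "\<mu> = \<delta> ^ DIM('a)"
  define D where "D = (n * \<delta>) powr (n + 2 * s)"
  have npos: "0 < n" by (simp add: n_def)
  have \<mu>: "0 < \<mu>" using \<delta> by (simp add: \<mu>_def)
  have F: "finite F" unfolding F_def by (rule finite_cube_index_image[OF \<Omega> \<delta>])
  have [measurable]: "u \<in> borel_measurable borel" using u by (rule hs0_measurable)
  have fin: "l2 u < \<infinity>" "gagliardo s u < \<infinity>" using u by (auto simp: hs0_def)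
  have em: "emeasure lborel (cube \<delta> p) = ennreal \<mu>" if "p \<in> F" for p
    using that emeasure_cube[OF \<delta>] by (auto simp: F_def \<mu>_def)
  define S where "S p = (LINT x|lborel. indicator (cube \<delta> p) x * (u x)\<^sup>2)" for p
  let ?I = "\<lambda>p x y. indicator (cube \<delta> p) x * (indicator (cube \<delta> p) y * (u x - u y)\<^sup>2) :: real"
  note var = variance_identity[OF cube_measurable em less_imp_le[OF \<mu>] \<open>u \<in> borel_measurable borel\<close> fin(1), folded S_def cube_integral_def]
  \<comment> \<open>At most one summand survives, that of the cube holding both points. The diagonal
    belongs to the trivial case, because the kernel is 0 there.\<close>
  have pt: "(\<Sum>p\<in>F. ennreal (?I p x y)) \<le> ennreal D * ennreal ((u x - u y)\<^sup>2 * kern s (x - y))" for x y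
  proof (cases "cube_index \<delta> x = cube_index \<delta> y \<and> x \<noteq> y")
    case True
    have "(\<Sum>p\<in>F. ennreal (?I p x y)) = (\<Sum>p\<in>F. if p = cube_index \<delta> x then ennreal ((u x - u y)\<^sup>2) else 0)"
      using True by (intro sum.cong) (auto simp: cube_def indicator_def)
    also have "\<dots> \<le> ennreal ((u x - u y)\<^sup>2)" using F by simp
    also have "\<dots> \<le> ennreal (D * ((u x - u y)\<^sup>2 * kern s (x - y)))"
    proof (rule ennreal_leI)
      have "norm (x - y) powr (n + 2 * s) \<le> D"
        unfolding D_def using cube_diameter[OF \<delta>, of x y] True s npos by (intro powr_mono2) (auto simp: n_def)
      then have "1 \<le> D * kern s (x - y)" using True by (simp add: kern_def n_def field_simps)
      then have "(u x - u y)\<^sup>2 * 1 \<le> (u x - u y)\<^sup>2 * (D * kern s (x - y))" by (intro mult_left_mono) auto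
      then show "(u x - u y)\<^sup>2 \<le> D * ((u x - u y)\<^sup>2 * kern s (x - y))" by (simp add: mult_ac)
    qed
    finally show ?thesis by (simp add: ennreal_mult D_def)
  next
    case False
    then have "?I p x y = 0" for p by (auto simp: cube_def indicator_def)
    then have "(\<Sum>p\<in>F. ennreal (?I p x y)) = 0" by (intro sum.neutral) simp
    then show ?thesis by (simp only: zero_le)
  qed
  have "ennreal (\<Sum>p\<in>F. 2 * (\<mu> * S p - (cube_integral \<delta> u p)\<^sup>2)) = (\<Sum>p\<in>F. ennreal (2 * (\<mu> * S p - (cube_integral \<delta> u p)\<^sup>2)))"
    using var(2) by (intro sum_ennreal[symmetric]) auto
  also have "\<dots> = (\<Sum>p\<in>F. \<integral>\<^sup>+x. \<integral>\<^sup>+y. ennreal (?I p x y) \<partial>lborel \<partial>lborel)"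
    using var(1) by (intro sum.cong) auto
  also have "\<dots> = (\<integral>\<^sup>+x. (\<Sum>p\<in>F. \<integral>\<^sup>+y. ennreal (?I p x y) \<partial>lborel) \<partial>lborel)"
    by (rule nn_integral_sum[symmetric]) measurable
  also have "\<dots> = (\<integral>\<^sup>+x. \<integral>\<^sup>+y. (\<Sum>p\<in>F. ennreal (?I p x y)) \<partial>lborel \<partial>lborel)"
    by (intro nn_integral_cong nn_integral_sum[symmetric]) measurable
  also have "\<dots> \<le> (\<integral>\<^sup>+x. \<integral>\<^sup>+y. ennreal D * ennreal ((u x - u y)\<^sup>2 * kern s (x - y)) \<partial>lborel \<partial>lborel)"
    by (intro nn_integral_mono pt)
  also have "\<dots> = ennreal D * gagliardo s u"
    by (simp add: nn_integral_cmult gagliardo_eq)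
  also have "\<dots> = ennreal (D * enn2real (gagliardo s u))"
    using fin(2) by (simp add: ennreal_mult D_def less_top)
  finally have main: "(\<Sum>p\<in>F. 2 * (\<mu> * S p - (cube_integral \<delta> u p)\<^sup>2)) \<le> D * enn2real (gagliardo s u)"
    by (subst (asm) ennreal_le_iff) (auto simp: D_def)
  have "enn2real (l2 u) = (LINT x|lborel. (u x)\<^sup>2)" using fin by (simp add: l2_finite_integrable)
  also have "\<dots> = (LINT x|lborel. (\<Sum>p\<in>F. indicator (cube \<delta> p) x * (u x)\<^sup>2))"
  proof (intro Bochner_Integration.integral_cong)
    fix x show "(u x)\<^sup>2 = (\<Sum>p\<in>F. indicator (cube \<delta> p) x * (u x)\<^sup>2)"
    proof (cases "x \<in> \<Omega>")
      case True
      have "(\<Sum>p\<in>F. indicator (cube \<delta> p) x * (u x)\<^sup>2) = (\<Sum>p\<in>F. if p = cube_index \<delta> x then (u x)\<^sup>2 else 0)"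
        by (intro sum.cong) (auto simp: cube_def indicator_def)
      then show ?thesis using F True by (simp add: F_def)
    next
      case False
      then show ?thesis using u by (simp add: hs0_def)
    qed
  qed simp
  also have "\<dots> = (\<Sum>p\<in>F. S p)" unfolding S_def
  proof (rule Bochner_Integration.integral_sum)
    show "integrable lborel (\<lambda>x. indicator (cube \<delta> p) x * (u x)\<^sup>2)" for p
      by (rule Bochner_Integration.integrable_bound[OF l2_finite_integrable(1)[OF _ fin(1)]]) (auto simp: indicator_def)
  qed
  finally have N: "enn2real (l2 u) = (\<Sum>p\<in>F. S p)" .
  have "(\<Sum>p\<in>F. 2 * (\<mu> * S p - (cube_integral \<delta> u p)\<^sup>2)) = 2 * (\<mu> * enn2real (l2 u)) - 2 * (\<Sum>p\<in>F. (cube_integral \<delta> u p)\<^sup>2)"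
    unfolding N by (simp add: right_diff_distrib sum_subtractf sum_distrib_left)
  \<comment> \<open>Allows a factor 1/2 to be dropped: \<open>2 X \<le> Y\<close> and
    \<open>0 \<le> Y\<close> imply \<open>X \<le> Y\<close>.\<close>
  moreover have "0 \<le> D * enn2real (gagliardo s u)" by (simp add: D_def)
  ultimately have "\<mu> * enn2real (l2 u) \<le> D * enn2real (gagliardo s u) + (\<Sum>p\<in>F. (cube_integral \<delta> u p)\<^sup>2)"
    using main by linarith
  then have "enn2real (l2 u) \<le> (D * enn2real (gagliardo s u) + (\<Sum>p\<in>F. (cube_integral \<delta> u p)\<^sup>2)) / \<mu>"
    using \<mu> by (simp add: pos_le_divide_eq mult.commute)
  also have "\<dots> = (\<Sum>p\<in>F. (cube_integral \<delta> u p)\<^sup>2) / \<mu> + (D / \<mu>) * enn2real (gagliardo s u)"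
    by (simp add: add_divide_distrib)
  also have "D / \<mu> = n powr (n + 2 * s) * \<delta> powr (2 * s)"
  proof -
    have "\<mu> = \<delta> powr n" using \<delta> by (simp add: \<mu>_def n_def powr_realpow)
    moreover have "D = n powr (n + 2 * s) * (\<delta> powr n * \<delta> powr (2 * s))"
      using \<delta> npos by (simp add: D_def powr_mult powr_add)
    ultimately show ?thesis using \<delta> by simp
  qed
  finally show ?thesis by (simp add: F_def \<mu>_def n_def)
qed

lemma cube_integral_bound:
  fixes u :: "'a::euclidean_space \<Rightarrow> real"
  assumes \<delta>: "0 < \<delta>" "\<delta> \<le> 1" and u: "hs0 s \<Omega> u" and "l2 u \<le> 1" and p: "p \<in> cube_index \<delta> ` \<Omega>"
  shows "\<bar>cube_integral \<delta> u p\<bar> \<le> 1"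
proof -
  have [measurable]: "u \<in> borel_measurable borel" using u by (rule hs0_measurable)
  have fin: "l2 u < \<infinity>" using u by (simp add: hs0_def)
  have em: "emeasure lborel (cube \<delta> p) = ennreal (\<delta> ^ DIM('a))" using p emeasure_cube[OF \<delta>(1)] by auto
  have "(cube_integral \<delta> u p)\<^sup>2 \<le> \<delta> ^ DIM('a) * (LINT x|lborel. indicator (cube \<delta> p) x * (u x)\<^sup>2)"
    unfolding cube_integral_def using \<delta>(1) by (intro variance_identity(2)[OF _ em] fin) auto
  also have "\<dots> \<le> 1 * 1"
  proof (intro mult_mono)
    show "\<delta> ^ DIM('a) \<le> 1" using \<delta> by (simp add: power_le_one)
    note i = l2_finite_integrable[OF _ fin]
    have "(LINT x|lborel. indicator (cube \<delta> p) x * (u x)\<^sup>2) \<le> (LINT x|lborel. (u x)\<^sup>2)"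
    proof (rule integral_mono[OF _ i(1)])
      show "integrable lborel (\<lambda>x. indicator (cube \<delta> p) x * (u x)\<^sup>2)"
        by (rule Bochner_Integration.integrable_bound[OF i(1)]) (auto simp: indicator_def)
    qed (auto simp: indicator_def)
    also have "\<dots> = enn2real (l2 u)" by (simp add: i(2))
    also have "\<dots> \<le> 1" using enn2real_mono[OF \<open>l2 u \<le> 1\<close>] by simp
    finally show "(LINT x|lborel. indicator (cube \<delta> p) x * (u x)\<^sup>2) \<le> 1" .
  qed (auto intro!: integral_nonneg_AE)
  finally show ?thesis by (simp add: abs_square_le_1)
qed

section \<open>Extraction of a subsequence convergent in square mean\<close>

lemma pointwise_convergent_subsequence:
  fixes a :: "nat \<Rightarrow> nat \<Rightarrow> real"
  assumes bd: "\<And>k i. \<bar>a k i\<bar> \<le> B"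
  obtains r :: "nat \<Rightarrow> nat" where "strict_mono r" "\<And>i. convergent (\<lambda>k. a (r k) i)"
proof -
  interpret subseqs "\<lambda>i r. convergent (\<lambda>k. a (r k) i)"
  proof
    fix i and r :: "nat \<Rightarrow> nat" assume "strict_mono r"
    have "bounded (range (\<lambda>k. a (r k) i))" using bd by (auto simp: bounded_iff)
    then obtain l r' where "strict_mono (r'::nat\<Rightarrow>nat)" "((\<lambda>k. a (r k) i) \<circ> r') \<longlonglongrightarrow> l"
      using bounded_imp_convergent_subsequence by blast
    then show "\<exists>r'. strict_mono r' \<and> convergent (\<lambda>k. a ((r \<circ> r') k) i)"
      by (auto simp: convergent_def o_def)
  qed
  have "convergent (\<lambda>k. a (diagseq k) i)" for i
  proof -
    \<comment> \<open>The diagonal sequence refines the \<open>i\<close>-th extraction only from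
      index \<open>Suc i\<close> on; the initial segment is discarded afterwards.\<close>
    have "convergent (\<lambda>k. a ((diagseq \<circ> (+) (Suc i)) k) i)"
    proof (rule diagseq_holds)
      fix r s :: "nat \<Rightarrow> nat" and n assume "strict_mono r" "convergent (\<lambda>k. a (s k) n)"
      then show "convergent (\<lambda>k. a ((s \<circ> r) k) n)"
        using convergent_subseq_convergent[of "\<lambda>k. a (s k) n" r] by (simp add: o_def)
    qed
    then have "convergent (\<lambda>k. a (diagseq (k + Suc i)) i)" by (simp add: o_def add.commute)
    then show ?thesis by (subst (asm) convergent_ignore_initial_segment)
  qed
  then show ?thesis using that[OF subseq_diagseq] by blast
qed

lemma L1_le_l2:
  fixes u :: "'a::euclidean_space \<Rightarrow> real"
  assumes \<Omega>[measurable]: "\<Omega> \<in> sets borel" and "emeasure lborel \<Omega> = ennreal m" "0 \<le> m" and u: "hs0 s \<Omega> u"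
  shows "(LINT x|lborel. \<bar>u x\<bar>)\<^sup>2 \<le> m * enn2real (l2 u)"
proof -
  have [measurable]: "u \<in> borel_measurable borel" using u by (rule hs0_measurable)
  have eq: "(LINT x|lborel. \<bar>u x\<bar>) = ip (indicator \<Omega>) (\<lambda>x. \<bar>u x\<bar>)"
    unfolding ip_def using u by (intro Bochner_Integration.integral_cong) (auto simp: hs0_def indicator_def)
  have "l2 (indicator \<Omega> :: 'a \<Rightarrow> real) = (\<integral>\<^sup>+x. indicator \<Omega> x \<partial>lborel)"
    unfolding l2_def by (intro nn_integral_cong) (auto simp: indicator_def)
  then have "l2 (indicator \<Omega> :: 'a \<Rightarrow> real) = ennreal m" using assms by simp
  moreover have "l2 (\<lambda>x. \<bar>u x\<bar>) = ennreal (enn2real (l2 u))" using u by (simp add: l2_def hs0_def less_top)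
  ultimately have "ennreal ((LINT x|lborel. \<bar>u x\<bar>)\<^sup>2) \<le> ennreal (m * enn2real (l2 u))"
    unfolding eq using ip_Cauchy_Schwarz[of "indicator \<Omega>" "\<lambda>x. \<bar>u x\<bar>"] assms(3) by (simp add: ennreal_mult)
  then show ?thesis using assms(3) by (subst (asm) ennreal_le_iff) auto
qed

lemma hs0_diff:
  assumes "hs0 s \<Omega> v" "hs0 s \<Omega> w" shows "hs0 s \<Omega> (\<lambda>x. v x - w x)"
  using assms hs0_diff_finite[OF assms] by (auto simp: hs0_def)

text \<open>The order of choices matters. One diagonal subsequence makes the integrals over all
  cubes of all grids converge. For a given tolerance, a grid is then fixed on which the seminorm
  part is small uniformly in the sequence, and only finitely many cube integrals are left. That the
  limit has finite seminorm is not claimed; lower semicontinuity supplies it later.\<close>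

proposition compact_embedding:
  fixes v :: "nat \<Rightarrow> 'a::euclidean_space \<Rightarrow> real"
  assumes s: "0 < s" "s < 1" and \<Omega>: "open \<Omega>" "bounded \<Omega>" "\<Omega> \<noteq> {}"
    and v: "\<And>k. hs0 s \<Omega> (v k)" and l1: "\<And>k. l2 (v k) \<le> 1" and B: "\<And>k. gagliardo s (v k) \<le> ennreal B"
  obtains r w where "strict_mono (r::nat\<Rightarrow>nat)" "w \<in> borel_measurable borel" "\<And>x. x \<notin> \<Omega> \<Longrightarrow> w x = 0"
    "AE x in lborel. (\<lambda>k. v (r k) x) \<longlonglongrightarrow> w x" "(\<lambda>k. l2 (\<lambda>x. v (r k) x - w x)) \<longlonglongrightarrow> 0"
proof -
  define n where "n = real DIM('a)"
  define \<delta> where "\<delta> m = inverse (real (Suc m))" for m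
  have \<delta>: "0 < \<delta> m" "\<delta> m \<le> 1" for m by (auto simp: \<delta>_def field_simps)
  define F where "F m = cube_index (\<delta> m) ` \<Omega>" for m
  have F: "finite (F m)" "F m \<noteq> {}" for m
    using finite_cube_index_image[OF \<Omega>(2) \<delta>(1)] \<Omega>(3) by (auto simp: F_def)
  have [measurable]: "v k \<in> borel_measurable borel" for k using v by (rule hs0_measurable)
  \<comment> \<open>One index for all cubes of all grids: \<open>prod_decode\<close> splits it into
    a grid and a position. The finite list of cubes is enumerated with repetitions, which does no
    harm.\<close>
  define a where "a k i = (case prod_decode i of (m, j) \<Rightarrow> cube_integral (\<delta> m) (v k) (from_nat_into (F m) j))" for k i
  have "\<bar>a k i\<bar> \<le> 1" for k i
  proof -
    obtain m j where i: "prod_decode i = (m, j)" by (cases "prod_decode i")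
    have "from_nat_into (F m) j \<in> F m" by (rule from_nat_into[OF F(2)])
    then show ?thesis
      unfolding a_def i F_def using cube_integral_bound[OF \<delta> v l1] by simp
  qed
  then obtain r :: "nat \<Rightarrow> nat" where r: "strict_mono r" "\<And>i. convergent (\<lambda>k. a (r k) i)"
    using pointwise_convergent_subsequence[of a 1] by blast
  have conv: "convergent (\<lambda>k. cube_integral (\<delta> m) (v (r k)) p)" if p: "p \<in> F m" for m p
  proof -
    obtain j where "p = from_nat_into (F m) j"
      using from_nat_into_surj[OF countable_finite[OF F(1)] p] by metis
    then show ?thesis using r(2)[of "prod_encode (m, j)"] by (simp add: a_def)
  qed
  define u where "u k = v (r k)" for k
  have u: "hs0 s \<Omega> (u k)" for k using v by (simp add: u_def)
  have [measurable]: "u k \<in> borel_measurable borel" for k by (simp add: u_def)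
  have B': "0 \<le> max B 0" by simp
  \<comment> \<open>\<open>max B 0\<close> because \<open>ennreal\<close> sends a negative
    \<open>B\<close> to 0; the 4 is \<open>2 + 2\<close> from the triangle inequality with factor
    2.\<close>
  have gu: "enn2real (gagliardo s (\<lambda>x. u k x - u l x)) \<le> 4 * max B 0" for k l
  proof -
    have "gagliardo s (\<lambda>x. u k x - u l x) \<le> 2 * gagliardo s (u k) + 2 * gagliardo s (u l)"
      using gagliardo_add_le[of "u k" "\<lambda>x. - u l x" s] by (simp add: gagliardo_uminus)
    also have "\<dots> \<le> 2 * ennreal (max B 0) + 2 * ennreal (max B 0)"
    proof -
      have "gagliardo s (u k) \<le> ennreal (max B 0)" for k
        unfolding u_def by (rule order_trans[OF B]) (simp add: ennreal_leI)
      then show ?thesis by (intro add_mono mult_left_mono) auto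
    qed
    also have "\<dots> = ennreal (4 * max B 0)"
      by (simp add: ennreal_mult ennreal_plus[symmetric] flip: ennreal_numeral)
        (simp flip: distrib_right)
    finally have "enn2real (gagliardo s (\<lambda>x. u k x - u l x)) \<le> enn2real (ennreal (4 * max B 0))"
      by (rule enn2real_mono) simp
    then show ?thesis by simp
  qed
  have cauchy: "\<exists>N. \<forall>k\<ge>N. \<forall>l\<ge>N. enn2real (l2 (\<lambda>x. u k x - u l x)) \<le> e" if e: "0 < e" for e
  proof -
    define C where "C = n powr (n + 2 * s) * (4 * max B 0)"
    have C: "0 \<le> C" by (simp add: C_def)
    have "(\<lambda>m. \<delta> m powr (2 * s)) \<longlonglongrightarrow> 0"
      unfolding \<delta>_def using s by (intro tendsto_zero_powrI[OF LIMSEQ_inverse_real_of_nat tendsto_const]) auto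
    then have "(\<lambda>m. C * \<delta> m powr (2 * s)) \<longlonglongrightarrow> C * 0" by (rule tendsto_mult_left)
    then have "\<forall>\<^sub>F m in sequentially. C * \<delta> m powr (2 * s) < e / 2" using e by (intro order_tendstoD(2)) auto
    then obtain m where m: "C * \<delta> m powr (2 * s) < e / 2" using eventually_happens'[OF sequentially_bot] by blast
    let ?A = "\<lambda>k p. cube_integral (\<delta> m) (u k) p"
    have diff: "cube_integral (\<delta> m) (\<lambda>x. u k x - u l x) p = ?A k p - ?A l p" for k l p
    proof -
      have "emeasure lborel \<Omega> < \<infinity>"
        using emeasure_bounded_finite[OF \<Omega>(2)] by simp
      then have i: "integrable lborel (u k)" for k using \<Omega>(1) by (intro hs0_integrable[OF u]) auto
      have "integrable lborel (\<lambda>x. indicator (cube (\<delta> m) p) x * u k x)" for k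
        by (rule Bochner_Integration.integrable_bound[OF i]) (auto simp: indicator_def)
      then show ?thesis by (simp add: cube_integral_def right_diff_distrib)
    qed
    \<comment> \<open>Chosen so that
      \<open>card (F m) * d\<^sup>2 / \<delta> m ^ DIM('a) = e / 2\<close>.\<close>
    define d where "d = sqrt (e / 2 * \<delta> m ^ DIM('a) / real (card (F m)))"
    have card: "0 < real (card (F m))" using F by (simp add: card_gt_0_iff)
    have d: "0 < d" unfolding d_def using e \<delta>(1) card by simp
    have "\<exists>N. \<forall>k\<ge>N. \<forall>l\<ge>N. \<bar>?A k p - ?A l p\<bar> < d" if "p \<in> F m" for p
      using convergent_Cauchy[OF conv[OF that]] d unfolding Cauchy_def u_def dist_real_def by blast
    then obtain N where N: "\<And>p k l. p \<in> F m \<Longrightarrow> k \<ge> N p \<Longrightarrow> l \<ge> N p \<Longrightarrow> \<bar>?A k p - ?A l p\<bar> < d" by metis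
    show ?thesis
    proof (intro exI[of _ "Max (N ` F m)"] allI impI)
      fix k l assume kl: "k \<ge> Max (N ` F m)" "l \<ge> Max (N ` F m)"
      have "(\<Sum>p\<in>F m. (cube_integral (\<delta> m) (\<lambda>x. u k x - u l x) p)\<^sup>2) \<le> (\<Sum>p\<in>F m. d\<^sup>2)"
      proof (rule sum_mono)
        fix p assume p: "p \<in> F m"
        then have "N p \<le> Max (N ` F m)" using F by simp
        then have "\<bar>?A k p - ?A l p\<bar> \<le> \<bar>d\<bar>" using N[OF p, of k l] kl d by simp
        then show "(cube_integral (\<delta> m) (\<lambda>x. u k x - u l x) p)\<^sup>2 \<le> d\<^sup>2"
          unfolding diff by (simp only: abs_le_square_iff)
      qed
      also have "\<dots> = e / 2 * \<delta> m ^ DIM('a)" unfolding d_def using e \<delta>(1)[of m] card by simp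
      finally have 1: "(\<Sum>p\<in>F m. (cube_integral (\<delta> m) (\<lambda>x. u k x - u l x) p)\<^sup>2) / \<delta> m ^ DIM('a) \<le> e / 2"
        using \<delta>(1)[of m] by (simp add: divide_le_eq)
      have "n powr (n + 2 * s) * \<delta> m powr (2 * s) * enn2real (gagliardo s (\<lambda>x. u k x - u l x))
          \<le> n powr (n + 2 * s) * \<delta> m powr (2 * s) * (4 * max B 0)"
        by (intro mult_left_mono gu) auto
      also have "\<dots> = C * \<delta> m powr (2 * s)" by (simp add: C_def mult_ac)
      finally have 2: "n powr (n + 2 * s) * \<delta> m powr (2 * s) * enn2real (gagliardo s (\<lambda>x. u k x - u l x)) \<le> e / 2"
        using m by linarith
      show "enn2real (l2 (\<lambda>x. u k x - u l x)) \<le> e"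
        using l2_le_cubes[OF s \<delta>(1)[of m] \<Omega>(2) hs0_diff[OF u u], of k l] 1 2
        unfolding F_def n_def by linarith
    qed
  qed
  define \<mu> where "\<mu> = measure lborel \<Omega>"
  have \<mu>: "emeasure lborel \<Omega> = ennreal \<mu>" "0 \<le> \<mu>"
    using emeasure_bounded_finite[OF \<Omega>(2)] by (auto simp: \<mu>_def emeasure_eq_ennreal_measure less_top)
  \<comment> \<open>On a set of finite measure the Cauchy property in square mean gives it in the
    mean, from which a further subsequence converges almost everywhere.\<close>
  obtain r' :: "nat \<Rightarrow> nat" where r': "strict_mono r'" "AE x in lborel. Cauchy (\<lambda>i. u (r' i) x)"
  proof (rule cauchy_L1_AE_cauchy_subseq[of lborel u])
    show "integrable lborel (u k)" for k using \<Omega>(1) \<mu>(1) by (intro hs0_integrable[OF u]) auto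
    fix e :: real assume "0 < e"
    \<comment> \<open>The \<open>\<mu> + 1\<close> in the denominator excludes division by 0 and
      still leaves \<open>\<mu> * e' < e\<^sup>2\<close>.\<close>
    define e' where "e' = e\<^sup>2 / (2 * (\<mu> + 1))"
    have e': "0 < e'" using \<open>0 < e\<close> \<mu>(2) by (simp add: e'_def)
    obtain N where N: "\<And>k l. k \<ge> N \<Longrightarrow> l \<ge> N \<Longrightarrow> enn2real (l2 (\<lambda>x. u k x - u l x)) \<le> e'"
      using cauchy[OF e'] by blast
    have "(LINT x|lborel. norm (u k x - u l x)) < e" if "k \<ge> N" "l \<ge> N" for k l
    proof -
      have "(LINT x|lborel. \<bar>u k x - u l x\<bar>)\<^sup>2 \<le> \<mu> * enn2real (l2 (\<lambda>x. u k x - u l x))"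
        using \<Omega>(1) \<mu> by (intro L1_le_l2[OF _ _ _ hs0_diff[OF u u]]) auto
      also have "\<dots> \<le> \<mu> * e'" using N[OF that] \<mu>(2) by (rule mult_left_mono)
      also have "\<dots> < e\<^sup>2"
      proof -
        have "\<mu> * e\<^sup>2 < 2 * (\<mu> + 1) * e\<^sup>2" using \<mu>(2) \<open>0 < e\<close> by (intro mult_strict_right_mono) auto
        then show ?thesis using \<mu>(2) by (simp add: e'_def divide_less_eq mult.commute)
      qed
      finally show ?thesis using \<open>0 < e\<close> by (simp add: power_less_imp_less_base)
    qed
    then show "\<exists>N. \<forall>i\<ge>N. \<forall>j\<ge>N. (LINT x|lborel. norm (u i x - u j x)) < e" by blast
  qed (rule that)
  \<comment> \<open>Off \<Omega> the sequence is constantly 0 and so is its limit; points of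
    divergence, where \<open>lim\<close> is unspecified, form a null set.\<close>
  define w where "w x = lim (\<lambda>i. u (r' i) x)" for x
  have [measurable]: "w \<in> borel_measurable borel" unfolding w_def[abs_def] by measurable
  have wz: "w x = 0" if "x \<notin> \<Omega>" for x using u that by (simp add: w_def hs0_def)
  have AEw: "AE x in lborel. (\<lambda>i. u (r' i) x) \<longlonglongrightarrow> w x"
    using r'(2) by eventually_elim (simp add: w_def real_Cauchy_convergent convergent_LIMSEQ_iff[symmetric])
  have "(\<lambda>k. l2 (\<lambda>x. u (r' k) x - w x)) \<longlonglongrightarrow> 0"
    unfolding order_tendsto_iff
  proof safe
    fix E :: ennreal assume "0 < E"
    then obtain y where y: "0 < y" "y < E" using dense by blast
    then obtain e where e: "y = ennreal e" "0 < e" by (cases y) auto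
    obtain N where N: "\<And>k l. k \<ge> N \<Longrightarrow> l \<ge> N \<Longrightarrow> enn2real (l2 (\<lambda>x. u k x - u l x)) \<le> e"
      using cauchy[OF e(2)] by blast
    have ge: "k \<le> r' k" for k using r'(1) by (rule seq_suble)
    \<comment> \<open>The Cauchy estimate between \<open>k\<close> and \<open>l\<close>, passed to
      the limit in \<open>l\<close> by Fatou.\<close>
    have "l2 (\<lambda>x. u (r' k) x - w x) \<le> ennreal e" if k: "k \<ge> N" for k
    proof -
      have "l2 (\<lambda>x. u (r' k) x - w x) = (\<integral>\<^sup>+x. liminf (\<lambda>l. ennreal ((u (r' k) x - u (r' l) x)\<^sup>2)) \<partial>lborel)"
        unfolding l2_def
      proof (rule nn_integral_cong_AE)
        show "AE x in lborel. ennreal ((u (r' k) x - w x)\<^sup>2) = liminf (\<lambda>l. ennreal ((u (r' k) x - u (r' l) x)\<^sup>2))"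
          using AEw
        proof eventually_elim
          case (elim x)
          then have "(\<lambda>l. ennreal ((u (r' k) x - u (r' l) x)\<^sup>2)) \<longlonglongrightarrow> ennreal ((u (r' k) x - w x)\<^sup>2)"
            by (intro tendsto_intros)
          then show ?case by (rule lim_imp_Liminf[OF sequentially_bot, symmetric])
        qed
      qed
      also have "\<dots> \<le> liminf (\<lambda>l. l2 (\<lambda>x. u (r' k) x - u (r' l) x))"
        unfolding l2_def by (rule nn_integral_liminf) measurable
      also have "\<dots> \<le> liminf (\<lambda>l. ennreal e)"
      proof (rule Liminf_mono)
        show "\<forall>\<^sub>F l in sequentially. l2 (\<lambda>x. u (r' k) x - u (r' l) x) \<le> ennreal e"
        proof (rule eventually_sequentiallyI[of N])
          fix l assume "N \<le> l"
          then have "enn2real (l2 (\<lambda>x. u (r' k) x - u (r' l) x)) \<le> e"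
            using k ge[of k] ge[of l] by (intro N) auto
          then have "ennreal (enn2real (l2 (\<lambda>x. u (r' k) x - u (r' l) x))) \<le> ennreal e" by (rule ennreal_leI)
          then show "l2 (\<lambda>x. u (r' k) x - u (r' l) x) \<le> ennreal e"
            using hs0_diff_finite(1)[OF u u] by (simp add: less_top)
        qed
      qed
      finally show ?thesis by (simp add: Liminf_const)
    qed
    then show "\<forall>\<^sub>F k in sequentially. l2 (\<lambda>x. u (r' k) x - w x) < E"
      using y e(1) by (intro eventually_sequentiallyI[of N]) (auto intro: order.strict_trans1)
  qed simp
  then show ?thesis
    using AEw wz by (intro that[of "r \<circ> r'" w]) (auto simp: u_def strict_mono_o r(1) r'(1))
qed

subsection \<open>The first eigenvalue\<close>

text \<open>Almost everywhere convergence on the space gives it on pairs, where Fatou yields lower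
  semicontinuity.\<close>

lemma gagliardo_liminf:
  fixes v :: "nat \<Rightarrow> 'a::euclidean_space \<Rightarrow> real"
  assumes [measurable]: "\<And>k. v k \<in> borel_measurable borel"
    and lim: "AE x in lborel. (\<lambda>k. v k x) \<longlonglongrightarrow> w x"
  shows "gagliardo s w \<le> liminf (\<lambda>k. gagliardo s (v k))"
proof -
  have "gagliardo s w = (\<integral>\<^sup>+z. liminf (\<lambda>k. ennreal ((quot s (v k) z)\<^sup>2)) \<partial>lborel)"
    unfolding gagliardo_def l2_def
  proof (rule nn_integral_cong_AE)
    show "AE z in lborel. ennreal ((quot s w z)\<^sup>2) = liminf (\<lambda>k. ennreal ((quot s (v k) z)\<^sup>2))"
      using AE_lborel_pair[OF lim]
    proof eventually_elim
      case (elim z)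
      then have "(\<lambda>k. ennreal ((quot s (v k) z)\<^sup>2)) \<longlonglongrightarrow> ennreal ((quot s w z)\<^sup>2)"
        unfolding quot_def by (intro tendsto_intros) auto
      then show ?case by (rule lim_imp_Liminf[OF sequentially_bot, symmetric])
    qed
  qed
  also have "\<dots> \<le> liminf (\<lambda>k. gagliardo s (v k))"
    unfolding gagliardo_def l2_def by (rule nn_integral_liminf) measurable
  finally show ?thesis .
qed

lemma l2_eq_0_iff:
  assumes [measurable]: "w \<in> borel_measurable borel"
  shows "l2 w = 0 \<longleftrightarrow> (AE x in lborel. w x = 0)"
  unfolding l2_def by (subst nn_integral_0_iff_AE) auto

text \<open>Keeps the infimum of the Rayleigh quotient from ranging over the empty set; a Lipschitz
  bump is enough.\<close>

lemma hs0_nonzero_exists: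
  fixes \<Omega> :: "'a::euclidean_space set"
  assumes s: "0 < s" "s < 1" and \<Omega>: "open \<Omega>" "\<Omega> \<noteq> {}"
  shows "\<exists>w. hs0 s \<Omega> w \<and> l2 w \<noteq> 0"
proof -
  obtain x0 where "x0 \<in> \<Omega>" using \<Omega>(2) by blast
  then obtain r where r: "0 < r" "cball x0 r \<subseteq> \<Omega>" using \<Omega>(1) open_contains_cball by blast
  let ?w = "tent x0 r"
  have z: "?w x = 0" if "x \<notin> cball x0 r" for x using tent_eq_0[OF r(1) that] .
  have "l2 ?w \<le> (\<integral>\<^sup>+x. indicator (cball x0 r) x \<partial>lborel)"
    unfolding l2_def
  proof (rule nn_integral_mono)
    fix x show "ennreal ((?w x)\<^sup>2) \<le> indicator (cball x0 r) x"
      using tent_range[of x0 r x] z[of x] by (cases "x \<in> cball x0 r") (auto simp: power_le_one)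
  qed
  also have "\<dots> < \<infinity>" using emeasure_compact_finite[of "cball x0 r"] by simp
  finally have "l2 ?w < \<infinity>" .
  moreover have "gagliardo s ?w < \<infinity>"
    using emeasure_compact_finite[of "cball x0 r"] z tent_lipschitz[OF r(1), of x0]
    by (intro gagliardo_finite_of_lipschitz[OF s, of "max 1 (4 / r\<^sup>2)" _ "cball x0 r"]) auto
  moreover have "l2 ?w \<noteq> 0"
  proof
    assume "l2 ?w = 0"
    then have "AE x in lborel. ?w x = 0" by (simp add: l2_eq_0_iff)
    then have "AE x in lborel. x \<notin> ball x0 (r / 2)"
      by eventually_elim (use tent_eq_1[OF r(1)] in fastforce)
    then have "emeasure lborel (ball x0 (r / 2)) = 0"
      by (subst (asm) AE_iff_measurable[of "ball x0 (r / 2)"]) auto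
    then show False using r(1) unit_ball_vol_pos[of "real DIM('a)"] by (simp add: emeasure_ball)
  qed
  moreover have "?w x = 0" if "x \<notin> \<Omega>" for x using z[of x] r(2) that by blast
  ultimately show ?thesis unfolding hs0_def by (intro exI[of _ ?w] conjI allI impI tent_measurable)
qed

definition rayleigh :: "real \<Rightarrow> ('a::euclidean_space \<Rightarrow> real) \<Rightarrow> real" where
  "rayleigh s w = enn2real (gagliardo s w) / enn2real (l2 w)"

text \<open>Direct method. Normalising the minimising sequence to \<open>l2 = 1\<close> gives the
  bounds for compactness; convergence in square mean preserves the norm, so the limit is not 0, and
  lower semicontinuity bounds its seminorm by the infimum.\<close>

proposition rayleigh_minimiser:
  fixes \<Omega> :: "'a::euclidean_space set"
  assumes s: "0 < s" "s < 1" and \<Omega>: "open \<Omega>" "bounded \<Omega>" "\<Omega> \<noteq> {}"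
  obtains w where "hs0 s \<Omega> w" "l2 w \<noteq> 0" "\<And>v. hs0 s \<Omega> v \<Longrightarrow> l2 v \<noteq> 0 \<Longrightarrow> rayleigh s w \<le> rayleigh s v"
proof -
  define R where "R = rayleigh s ` {v. hs0 s \<Omega> v \<and> l2 v \<noteq> 0}"
  have R: "R \<noteq> {}" using hs0_nonzero_exists[OF s \<Omega>(1,3)] by (auto simp: R_def)
  have Rb: "bdd_below R" unfolding R_def rayleigh_def by (intro bdd_belowI2[of _ 0]) auto
  define m where "m = Inf R"
  have m: "m \<le> rayleigh s v" if "hs0 s \<Omega> v" "l2 v \<noteq> 0" for v
    unfolding m_def using that Rb by (intro cInf_lower) (auto simp: R_def)
  have "\<exists>v. hs0 s \<Omega> v \<and> l2 v = 1 \<and> gagliardo s v \<le> ennreal (m + inverse (real (Suc k)))" for k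
  proof -
    have "m < m + inverse (real (Suc k))" by simp
    then obtain q where "q \<in> R" "q < m + inverse (real (Suc k))"
      unfolding m_def using cInf_lessD[OF R] by blast
    then obtain v where v: "hs0 s \<Omega> v" "l2 v \<noteq> 0" "rayleigh s v < m + inverse (real (Suc k))" by (auto simp: R_def)
    define N where "N = enn2real (l2 v)"
    define G where "G = enn2real (gagliardo s v)"
    have N: "l2 v = ennreal N" "0 < N" and G: "gagliardo s v = ennreal G" "0 \<le> G"
      using v(1,2) by (auto simp: N_def G_def hs0_def less_top enn2real_positive_iff zero_less_iff_neq_zero)
    let ?v = "\<lambda>x. 1 / sqrt N * v x"
    have [measurable]: "v \<in> borel_measurable borel" using v(1) by (rule hs0_measurable)
    have sq: "(1 / sqrt N)\<^sup>2 = 1 / N" using N by (simp add: power_divide)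
    have 1: "l2 ?v = 1"
      using N(2) by (subst l2_cmult) (simp_all only: sq N(1), auto simp flip: ennreal_mult)
    have 2: "gagliardo s ?v = ennreal (G / N)"
      using N(2) G(2) by (subst gagliardo_cmult) (simp_all only: sq G(1), auto simp flip: ennreal_mult)
    have "G / N \<le> m + inverse (real (Suc k))" using v(3) by (simp add: rayleigh_def G_def N_def)
    then have "gagliardo s ?v \<le> ennreal (m + inverse (real (Suc k)))" unfolding 2 by (rule ennreal_leI)
    moreover have "hs0 s \<Omega> ?v" using v(1) 1 2 by (simp add: hs0_def)
    ultimately show ?thesis using 1 by blast
  qed
  then obtain v where v: "\<And>k. hs0 s \<Omega> (v k)" "\<And>k. l2 (v k) = 1" "\<And>k. gagliardo s (v k) \<le> ennreal (m + inverse (real (Suc k)))"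
    by metis
  have bd: "gagliardo s (v k) \<le> ennreal (m + 1)" for k
    by (rule order_trans[OF v(3)]) (auto intro!: ennreal_leI simp: field_simps)
  have l1: "l2 (v k) \<le> 1" for k using v(2) by simp
  obtain r w where r: "strict_mono (r::nat\<Rightarrow>nat)" and w: "w \<in> borel_measurable borel" "\<And>x. x \<notin> \<Omega> \<Longrightarrow> w x = 0"
    and AE: "AE x in lborel. (\<lambda>k. v (r k) x) \<longlonglongrightarrow> w x" and lim: "(\<lambda>k. l2 (\<lambda>x. v (r k) x - w x)) \<longlonglongrightarrow> 0"
    by (rule compact_embedding[OF s \<Omega> v(1) l1 bd]) (rule that)
  note [measurable] = w(1) hs0_measurable[OF v(1)]
  have "gagliardo s w \<le> liminf (\<lambda>k. gagliardo s (v (r k)))" by (rule gagliardo_liminf[OF _ AE]) measurable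
  also have "\<dots> \<le> liminf (\<lambda>k. ennreal (m + inverse (real (Suc (r k)))))"
    by (intro Liminf_mono always_eventually allI v(3))
  also have "\<dots> = ennreal m"
  proof -
    have "(\<lambda>k. m + inverse (real (Suc k))) \<longlonglongrightarrow> m + 0"
      by (intro tendsto_add tendsto_const LIMSEQ_inverse_real_of_nat)
    then have "(\<lambda>k. ennreal (m + inverse (real (Suc (r k))))) \<longlonglongrightarrow> ennreal m"
      using LIMSEQ_subseq_LIMSEQ[OF _ r] by (intro tendsto_ennrealI) (auto simp: o_def)
    then show ?thesis by (simp add: lim_imp_Liminf)
  qed
  finally have gw: "gagliardo s w \<le> ennreal m" .
  have lw: "l2 w < \<infinity>"
  proof -
    obtain k where "l2 (\<lambda>x. v (r k) x - w x) < 1"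
      using order_tendstoD(2)[OF lim, of 1] eventually_happens'[OF sequentially_bot] by fastforce
    moreover have "l2 w \<le> 2 * l2 (v (r k)) + 2 * l2 (\<lambda>x. v (r k) x - w x)"
      using l2_diff_le[of "v (r k)" "\<lambda>x. v (r k) x - w x"] by simp
    ultimately show ?thesis using v(2) by (auto intro!: order.strict_trans1[of "l2 w"] simp: ennreal_mult_less_top order.strict_trans)
  qed
  have "(\<lambda>k. enn2real (l2 (v (r k)))) \<longlonglongrightarrow> enn2real (l2 w)"
    using lw v(2) lim by (intro l2_tendsto) auto
  then have N: "enn2real (l2 w) = 1" using v(2) LIMSEQ_unique[OF tendsto_const] by fastforce
  have hw: "hs0 s \<Omega> w" using w lw gw by (auto simp: hs0_def intro: order.strict_trans1)
  have m0: "0 \<le> m" unfolding m_def using R by (intro cInf_greatest) (auto simp: R_def rayleigh_def)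
  have "rayleigh s w \<le> m"
    using enn2real_mono[OF gw] m0 N by (simp add: rayleigh_def)
  moreover have "l2 w \<noteq> 0" using N by auto
  ultimately show ?thesis using m by (intro that[OF hw]) (auto intro: order_trans)
qed

text \<open>At almost every \<open>x\<close> the inner integral is 0. If
  \<open>w x \<noteq> 0\<close>, its integrand is positive at every \<open>y\<close> outside
  \<Omega>, a set of infinite measure because \<Omega> is bounded. This yields the positivity of the
  eigenvalue.\<close>

lemma gagliardo_eq_0:
  fixes w :: "'a::euclidean_space \<Rightarrow> real"
  assumes w: "hs0 s \<Omega> w" and \<Omega>: "bounded \<Omega>" "open \<Omega>" and 0: "gagliardo s w = 0"
  shows "AE x in lborel. w x = 0"
proof -
  have [measurable]: "w \<in> borel_measurable borel" using w by (rule hs0_measurable)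
  have "AE x in lborel. (\<integral>\<^sup>+y. ennreal ((w x - w y)\<^sup>2 * kern s (x - y)) \<partial>lborel) = 0"
    using 0 unfolding gagliardo_eq[OF \<open>w \<in> borel_measurable borel\<close>] by (subst (asm) nn_integral_0_iff_AE) auto
  then show ?thesis
  proof eventually_elim
    case (elim x)
    show ?case
    proof (rule ccontr)
      assume nz: "w x \<noteq> 0"
      have "AE y in lborel. ennreal ((w x - w y)\<^sup>2 * kern s (x - y)) = 0"
        using elim by (subst (asm) nn_integral_0_iff_AE) auto
      then have "AE y in lborel. y \<in> \<Omega>"
      proof eventually_elim
        case (elim y)
        show ?case
        proof (rule ccontr)
          assume "y \<notin> \<Omega>"
          then have "w y = 0" "x \<noteq> y" using w nz by (auto simp: hs0_def)
          then have "0 < (w x - w y)\<^sup>2 * kern s (x - y)" using nz by (simp add: kern_def)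
          then show False using elim by (simp add: ennreal_eq_0_iff)
        qed
      qed
      then have "emeasure lborel (- \<Omega>) = 0"
        using \<Omega>(2) by (subst (asm) AE_iff_measurable[of "- \<Omega>"]) auto
      moreover have "emeasure lborel (UNIV :: 'a set) = emeasure lborel \<Omega> + emeasure lborel (- \<Omega>)"
        using \<Omega>(2) by (subst plus_emeasure) auto
      ultimately show False using emeasure_bounded_finite[OF \<Omega>(1)] by (simp add: emeasure_lborel_UNIV)
    qed
  qed
qed

section \<open>Borel representatives and the value of the first eigenvalue\<close>

lemma energy_space0_representative:
  fixes \<Omega> :: "'a::euclidean_space set"
  assumes c: "0 < c" and \<Omega>: "open \<Omega>" and w: "w \<in> borel_measurable lebesgue"
    "set_integrable lebesgue \<Omega> (\<lambda>x. (w x)\<^sup>2)" "energy c s \<Omega> w < \<infinity>" "AE x in lebesgue. x \<notin> \<Omega> \<longrightarrow> w x = 0"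
  obtains v where "hs0 s \<Omega> v" "AE x in lborel. w x = v x" "energy c s \<Omega> w = ennreal (c / 2) * gagliardo s v"
    "(LINT x:\<Omega>|lebesgue. (w x)\<^sup>2) = enn2real (l2 v)"
proof -
  obtain v0 where v0[measurable]: "v0 \<in> borel_measurable borel" and AE0: "AE x in lborel. w x = v0 x"
    using borel_representative[OF w(1)] by blast
  define v where "v x = indicator \<Omega> x * v0 x" for x
  have [measurable]: "\<Omega> \<in> sets borel" using \<Omega> by simp
  have [measurable]: "v \<in> borel_measurable borel" unfolding v_def[abs_def] by measurable
  have z: "v x = 0" if "x \<notin> \<Omega>" for x using that by (simp add: v_def)
  have AE4: "AE x in lborel. x \<notin> \<Omega> \<longrightarrow> w x = 0" using w(4) by (simp add: AE_completion_iff)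
  from AE0 AE4 have AE: "AE x in lborel. w x = v x"
    by eventually_elim (auto simp: v_def indicator_def)
  have en: "energy c s \<Omega> w = ennreal (c / 2) * gagliardo s v" by (rule energy_eq_gagliardo[OF AE z])
  have [measurable]: "w \<in> borel_measurable lebesgue" by (rule w(1))
  have sq: "AE x in lebesgue. indicator \<Omega> x *\<^sub>R (w x)\<^sup>2 = (v x)\<^sup>2"
    using AE_completion[OF AE] by eventually_elim (auto simp: z indicator_def)
  have vm: "(\<lambda>x. (v x)\<^sup>2) \<in> borel_measurable lborel" by measurable
  have wm: "(\<lambda>x. indicator \<Omega> x *\<^sub>R (w x)\<^sup>2) \<in> borel_measurable lebesgue"
    by (intro borel_measurable_scaleR borel_measurable_indicator borel_measurable_power w(1)) simp
  have "integrable lebesgue (\<lambda>x. (v x)\<^sup>2)"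
    using w(2) integrable_cong_AE[OF wm measurable_completion[OF vm] sq] unfolding set_integrable_def by simp
  then have i: "integrable lborel (\<lambda>x. (v x)\<^sup>2)" using integrable_completion[OF vm] by simp
  have "(LINT x:\<Omega>|lebesgue. (w x)\<^sup>2) = (LINT x|lebesgue. (v x)\<^sup>2)"
    unfolding set_lebesgue_integral_def using wm sq vm by (intro integral_cong_AE) (auto simp: measurable_completion)
  also have "\<dots> = (LINT x|lborel. (v x)\<^sup>2)" by (rule integral_completion[OF vm])
  also have "\<dots> = enn2real (l2 v)" using integrable_l2[OF i] by (simp add: integral_nonneg_AE)
  finally have L: "(LINT x:\<Omega>|lebesgue. (w x)\<^sup>2) = enn2real (l2 v)" .
  have "gagliardo s v < \<infinity>"
    using w(3) c unfolding en by (auto simp: ennreal_mult_less_top)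
  then have "hs0 s \<Omega> v" using z integrable_l2[OF i] by (simp add: hs0_def)
  then show ?thesis using AE en L by (rule that)
qed

lemma hs0_energy_space0:
  fixes \<Omega> :: "'a::euclidean_space set"
  assumes c: "0 < c" and \<Omega>: "open \<Omega>" and v: "hs0 s \<Omega> v"
  shows "v \<in> energy_space0 c s \<Omega>" "energy c s \<Omega> v = ennreal (c / 2) * gagliardo s v"
    "(LINT x:\<Omega>|lebesgue. (v x)\<^sup>2) = enn2real (l2 v)"
proof -
  have [measurable]: "v \<in> borel_measurable borel" using v by (rule hs0_measurable)
  have [measurable]: "\<Omega> \<in> sets borel" using \<Omega> by simp
  have z: "v x = 0" if "x \<notin> \<Omega>" for x using v that by (simp add: hs0_def)
  show en: "energy c s \<Omega> v = ennreal (c / 2) * gagliardo s v" by (rule energy_eq_gagliardo[OF _ z]) auto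
  have eq: "indicator \<Omega> x *\<^sub>R (v x)\<^sup>2 = (v x)\<^sup>2" for x by (auto simp: indicator_def z)
  have vm: "(\<lambda>x. (v x)\<^sup>2) \<in> borel_measurable lborel" by measurable
  have i: "integrable lborel (\<lambda>x. (v x)\<^sup>2)" using v by (intro l2_finite_integrable) (auto simp: hs0_def)
  then have "set_integrable lebesgue \<Omega> (\<lambda>x. (v x)\<^sup>2)"
    unfolding set_integrable_def eq using integrable_completion[OF vm] by simp
  moreover have "energy c s \<Omega> v < \<infinity>" unfolding en using v by (simp add: hs0_def ennreal_mult_less_top)
  ultimately show "v \<in> energy_space0 c s \<Omega>"
    using z unfolding energy_space0_def energy_space_def by (auto simp: measurable_completion)
  show "(LINT x:\<Omega>|lebesgue. (v x)\<^sup>2) = enn2real (l2 v)"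
    unfolding set_lebesgue_integral_def eq integral_completion[OF vm] using v
    by (intro l2_finite_integrable) (auto simp: hs0_def)
qed

text \<open>On the reals \<open>LEAST\<close> is meaningful only when a least element exists, so the
  minimiser is what gives the definition its value.\<close>

lemma first_eigenvalue_attained:
  fixes \<Omega> :: "'a::euclidean_space set"
  assumes s: "0 < s" "s < 1" and c: "0 < c" and \<Omega>: "open \<Omega>" "bounded \<Omega>" "\<Omega> \<noteq> {}"
  obtains w where "hs0 s \<Omega> w" "l2 w \<noteq> 0" "first_eigenvalue c s \<Omega> = c / 2 * rayleigh s w"
proof -
  obtain w where w: "hs0 s \<Omega> w" "l2 w \<noteq> 0" and min: "\<And>v. hs0 s \<Omega> v \<Longrightarrow> l2 v \<noteq> 0 \<Longrightarrow> rayleigh s w \<le> rayleigh s v"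
    using rayleigh_minimiser[OF s \<Omega>] by metis
  have quotient: "enn2real (ennreal (c / 2) * gagliardo s v) / enn2real (l2 v) = c / 2 * rayleigh s v" for v :: "'a \<Rightarrow> real"
    using c by (simp add: enn2real_mult rayleigh_def)
  have "first_eigenvalue c s \<Omega> = c / 2 * rayleigh s w"
    unfolding first_eigenvalue_def
  proof (rule Least_equality)
    have "\<not> (AE x in lebesgue. w x = 0)"
      using w l2_eq_0_iff[OF hs0_measurable[OF w(1)]] by (simp add: AE_completion_iff)
    then show "\<exists>v\<in>energy_space0 c s \<Omega>. \<not> (AE x in lebesgue. v x = 0) \<and>
       c / 2 * rayleigh s w = enn2real (energy c s \<Omega> v) / (LINT x:\<Omega>|lebesgue. (v x)\<^sup>2)"
      using hs0_energy_space0[OF c \<Omega>(1) w(1)] quotient[of w] by (intro bexI[of _ w]) auto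
  next
    fix q assume "\<exists>v\<in>energy_space0 c s \<Omega>. \<not> (AE x in lebesgue. v x = 0) \<and>
       q = enn2real (energy c s \<Omega> v) / (LINT x:\<Omega>|lebesgue. (v x)\<^sup>2)"
    then obtain u where u: "u \<in> energy_space0 c s \<Omega>" "\<not> (AE x in lebesgue. u x = 0)"
      "q = enn2real (energy c s \<Omega> u) / (LINT x:\<Omega>|lebesgue. (u x)\<^sup>2)" by blast
    obtain v where v: "hs0 s \<Omega> v" "AE x in lborel. u x = v x" "energy c s \<Omega> u = ennreal (c / 2) * gagliardo s v"
      "(LINT x:\<Omega>|lebesgue. (u x)\<^sup>2) = enn2real (l2 v)"
      using u(1) unfolding energy_space0_def energy_space_def
      by (auto elim: energy_space0_representative[OF c \<Omega>(1)])
    have "l2 v \<noteq> 0"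
    proof
      assume "l2 v = 0"
      then have "AE x in lborel. v x = 0" using l2_eq_0_iff[OF hs0_measurable[OF v(1)]] by simp
      with v(2) have "AE x in lborel. u x = 0" by eventually_elim simp
      then show False using u(2) by (simp add: AE_completion_iff)
    qed
    then show "c / 2 * rayleigh s w \<le> q"
      using min[OF v(1)] c unfolding u(3) v(3,4) quotient by simp
  qed
  then show ?thesis using w by (intro that)
qed

text \<open>The hypothesis is stability of the zero solution with \<open>f' 0 = b\<close>, known for
  test functions; by density it reaches the minimiser of the Rayleigh quotient.\<close>

lemma stability_bounds_first_eigenvalue:
  fixes \<Omega> :: "'a::euclidean_space set"
  assumes s: "0 < s" "s < 1" and c: "0 < c" and dom: "bounded_smooth_domain \<Omega>"
    and stab: "\<And>\<xi>. \<xi> \<in> test_functions \<Omega> \<Longrightarrow> b * enn2real (l2 \<xi>) \<le> c / 2 * enn2real (gagliardo s \<xi>)"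
  shows "0 < first_eigenvalue c s \<Omega>" "b \<le> first_eigenvalue c s \<Omega>"
proof -
  have \<Omega>: "open \<Omega>" "bounded \<Omega>" "\<Omega> \<noteq> {}" using dom by (auto simp: bounded_smooth_domain_def)
  obtain w where w: "hs0 s \<Omega> w" "l2 w \<noteq> 0" and ev: "first_eigenvalue c s \<Omega> = c / 2 * rayleigh s w"
    using first_eigenvalue_attained[OF s c \<Omega>] by metis
  have [measurable]: "w \<in> borel_measurable borel" using w(1) by (rule hs0_measurable)
  have N: "0 < enn2real (l2 w)" using w by (simp add: hs0_def enn2real_positive_iff zero_less_iff_neq_zero)
  have "gagliardo s w \<noteq> 0"
    using gagliardo_eq_0[OF w(1) \<Omega>(2,1)] w(2) l2_eq_0_iff[of w] by auto
  then have "0 < enn2real (gagliardo s w)"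
    using w(1) by (simp add: hs0_def enn2real_positive_iff zero_less_iff_neq_zero)
  then show "0 < first_eigenvalue c s \<Omega>" using N c by (simp add: ev rayleigh_def)
  \<comment> \<open>Density is available for nonnegative functions only; the modulus keeps the
    \<open>l2\<close> norm and does not increase the seminorm.\<close>
  let ?w = "\<lambda>x. \<bar>w x\<bar>"
  have aw: "gagliardo s ?w \<le> gagliardo s w" by (rule gagliardo_lipschitz) simp
  have lw: "l2 ?w = l2 w" by (simp add: l2_def)
  have hw: "hs0 s \<Omega> ?w" using w(1) aw lw by (auto simp: hs0_def intro: order.strict_trans1)
  obtain \<xi> where \<xi>: "\<And>k. \<xi> k \<in> test_functions \<Omega>" "\<And>k x. 0 \<le> \<xi> k x"
    "(\<lambda>k. l2 (\<lambda>x. \<xi> k x - ?w x)) \<longlonglongrightarrow> 0" "(\<lambda>k. gagliardo s (\<lambda>x. \<xi> k x - ?w x)) \<longlonglongrightarrow> 0"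
    "AE x in lborel. (\<lambda>k. \<xi> k x) \<longlonglongrightarrow> ?w x"
    by (rule density_sequence[OF s dom hw abs_ge_zero]) (rule that)
  note h\<xi> = test_functions_hs0[OF s \<xi>(1)]
  have "(\<lambda>k. enn2real (l2 (\<xi> k))) \<longlonglongrightarrow> enn2real (l2 ?w)"
    using h\<xi> hw \<xi>(3) by (intro l2_tendsto hs0_finite hs0_measurable)
  moreover have "(\<lambda>k. enn2real (gagliardo s (\<xi> k))) \<longlonglongrightarrow> enn2real (gagliardo s ?w)"
    unfolding gagliardo_def using hs0_finite(2)[OF h\<xi>] hs0_finite(2)[OF hw] \<xi>(4) hs0_measurable[OF h\<xi>] hs0_measurable[OF hw]
    by (intro l2_tendsto quot_measurable) (auto simp: gagliardo_def quot_diff)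
  ultimately have "b * enn2real (l2 ?w) \<le> c / 2 * enn2real (gagliardo s ?w)"
    using stab[OF \<xi>(1)] by (intro LIMSEQ_le[OF tendsto_mult_left tendsto_mult_left]) auto
  also have "\<dots> \<le> c / 2 * enn2real (gagliardo s w)"
    using c enn2real_mono[OF aw] w(1) by (intro mult_left_mono) (auto simp: hs0_def)
  finally show "b \<le> first_eigenvalue c s \<Omega>"
    using N unfolding lw by (simp add: ev rayleigh_def pos_le_divide_eq)
qed

section \<open>The weak equation for a Borel representative\<close>

lemma infdist_frontier_bounded_below:
  fixes \<Omega> :: "'a::euclidean_space set"
  assumes \<Omega>: "open \<Omega>" "bounded \<Omega>" "\<Omega> \<noteq> {}" and K: "compact K" "K \<subseteq> \<Omega>"
  obtains d where "0 < d" "\<And>x. x \<in> K \<Longrightarrow> d \<le> infdist x (frontier \<Omega>)"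
proof (cases "K = {}")
  case True then show ?thesis by (intro that[of 1]) auto
next
  case False
  \<comment> \<open>The distance to an empty set would be 0 by convention; a nonempty bounded set
    has a boundary.\<close>
  have fr: "frontier \<Omega> \<noteq> {}"
    using frontier_not_empty[of \<Omega>] \<Omega>(2,3) not_bounded_UNIV by blast
  obtain x0 where x0: "x0 \<in> K" "\<And>x. x \<in> K \<Longrightarrow> infdist x0 (frontier \<Omega>) \<le> infdist x (frontier \<Omega>)"
    using continuous_attains_inf[OF K(1) False continuous_on_infdist[OF continuous_on_id]] by blast
  have "x0 \<notin> frontier \<Omega>" using x0(1) K(2) \<Omega>(1) by (auto simp: frontier_def interior_open)
  then have "infdist x0 (frontier \<Omega>) \<noteq> 0" using in_closed_iff_infdist_zero[OF frontier_closed fr] by blast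
  then have "0 < infdist x0 (frontier \<Omega>)" using infdist_nonneg[of x0 "frontier \<Omega>"] by linarith
  then show ?thesis using x0(2) by (intro that)
qed

text \<open>On a compact subset the distance to the boundary has a positive minimum, so the weight
  can be divided out.\<close>

lemma locally_integrable_of_weighted:
  fixes \<Omega> :: "'a::euclidean_space set" and g :: "'a \<Rightarrow> real"
  assumes \<Omega>: "open \<Omega>" "bounded \<Omega>" "\<Omega> \<noteq> {}" and s: "0 < s" and K: "compact K" "K \<subseteq> \<Omega>"
    and g[measurable]: "g \<in> borel_measurable borel" and AE: "AE x in lborel. x \<in> \<Omega> \<longrightarrow> u x = g x"
    and int: "set_integrable lebesgue \<Omega> (\<lambda>x. u x * infdist x (frontier \<Omega>) powr s)"
  shows "integrable lborel (\<lambda>x. indicator K x * g x)"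
proof -
  obtain d where d: "0 < d" "\<And>x. x \<in> K \<Longrightarrow> d \<le> infdist x (frontier \<Omega>)"
    using infdist_frontier_bounded_below[OF \<Omega> K] by blast
  have [measurable]: "K \<in> sets borel" using K(1) by (simp add: compact_imp_closed)
  let ?f = "\<lambda>x. indicator \<Omega> x *\<^sub>R (u x * infdist x (frontier \<Omega>) powr s)"
  have m: "(\<lambda>x. indicator K x * g x) \<in> borel_measurable lborel" by measurable
  have "integrable lebesgue (\<lambda>x. indicator K x * g x)"
  proof (rule Bochner_Integration.integrable_bound)
    show "integrable lebesgue (\<lambda>x. inverse (d powr s) * ?f x)" using int unfolding set_integrable_def by (rule integrable_mult_right)
    show "(\<lambda>x. indicator K x * g x) \<in> borel_measurable lebesgue" by (rule measurable_completion[OF m])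
    show "AE x in lebesgue. norm (indicator K x * g x) \<le> norm (inverse (d powr s) * ?f x)"
      using AE_completion[OF AE]
    proof eventually_elim
      case (elim x)
      show ?case
      proof (cases "x \<in> K")
        case True
        have "d powr s \<le> infdist x (frontier \<Omega>) powr s" using d True s by (intro powr_mono2) auto
        then have "1 \<le> inverse (d powr s) * infdist x (frontier \<Omega>) powr s" using d(1) by (simp add: field_simps)
        then have "\<bar>g x\<bar> * 1 \<le> \<bar>g x\<bar> * (inverse (d powr s) * infdist x (frontier \<Omega>) powr s)" by (intro mult_left_mono) auto
        then show ?thesis using True K(2) elim by (auto simp: abs_mult mult_ac)
      qed simp
    qed
  qed
  then show ?thesis using integrable_completion[OF m] by simp
qed

text \<open>The outer function \<open>g\<close> allows \<open>f\<close>, its derivative and the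
  identity. Vanishing off \<Omega> is asked of the product, since it may come from the test function
  or, when \<phi> is a fractional Laplacian, from \<open>v\<close>.\<close>

lemma integral_test_function_representative:
  fixes \<Omega> :: "'a::euclidean_space set" and g :: "real \<Rightarrow> real" and \<phi> :: "'a \<Rightarrow> real"
  assumes \<Omega>: "open \<Omega>" and [measurable]: "v \<in> borel_measurable borel" "g \<in> borel_measurable borel" "\<phi> \<in> borel_measurable borel"
    and u: "u \<in> borel_measurable lebesgue" "AE x in lborel. u x = v x" and \<phi>: "\<And>x. x \<notin> \<Omega> \<Longrightarrow> g (v x) * \<phi> x = 0"
  shows "(LINT x:\<Omega>|lebesgue. g (u x) * \<phi> x) = (LINT x|lborel. g (v x) * \<phi> x)"
proof -
  have m: "(\<lambda>x. g (v x) * \<phi> x) \<in> borel_measurable lborel" by measurable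
  have "(LINT x:\<Omega>|lebesgue. g (u x) * \<phi> x) = (LINT x|lebesgue. g (v x) * \<phi> x)"
    unfolding set_lebesgue_integral_def
  proof (rule integral_cong_AE)
    have "\<phi> \<in> borel_measurable lebesgue" by (rule measurable_completion) measurable
    moreover have "(\<lambda>x. g (u x)) \<in> borel_measurable lebesgue" by (rule measurable_compose[OF u(1)]) measurable
    ultimately show "(\<lambda>x. indicator \<Omega> x *\<^sub>R (g (u x) * \<phi> x)) \<in> borel_measurable lebesgue"
      using \<Omega> by (intro borel_measurable_scaleR borel_measurable_indicator borel_measurable_times) auto
    show "(\<lambda>x. g (v x) * \<phi> x) \<in> borel_measurable lebesgue" by (rule measurable_completion[OF m])
    show "AE x in lebesgue. indicator \<Omega> x *\<^sub>R (g (u x) * \<phi> x) = g (v x) * \<phi> x"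
      using AE_completion[OF u(2)] by eventually_elim (use \<phi> in \<open>auto simp: indicator_def\<close>)
  qed
  also have "\<dots> = (LINT x|lborel. g (v x) * \<phi> x)" by (rule integral_completion[OF m])
  finally show ?thesis .
qed

text \<open>Test functions are admissible because their principal value exists everywhere and is
  bounded. The factor \<open>c / 2\<close> combines the constant of the operator with the 1/2 from
  symmetrisation.\<close>

lemma weak_solution_bilinear:
  fixes \<Omega> :: "'a::euclidean_space set"
  assumes s: "0 < s" "s < 1" and \<Omega>: "open \<Omega>" "bounded \<Omega>"
    and sol: "L1_weak_solution c s \<Omega> f u" and [measurable]: "f \<in> borel_measurable borel"
    and u: "u \<in> borel_measurable lebesgue" "AE x in lborel. u x = v x" and v: "hs0 s \<Omega> v"
    and \<phi>: "\<phi> \<in> test_functions \<Omega>"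
  shows "c / 2 * bil s v \<phi> = (LINT x|lborel. f (v x) * \<phi> x)"
proof -
  have [measurable]: "v \<in> borel_measurable borel" "\<phi> \<in> borel_measurable borel"
    using hs0_measurable[OF v] test_functions_measurable[OF \<phi>] by auto
  have z: "\<phi> x = 0" if "x \<notin> \<Omega>" for x using test_functions_supportE[OF \<phi>] that by (metis subsetD)
  have vz: "v x = 0" if "x \<notin> \<Omega>" for x using v that by (simp add: hs0_def)
  have [measurable]: "lap s \<phi> \<in> borel_measurable borel" unfolding lap_def[abs_def] by measurable
  obtain M where M: "\<And>x. \<bar>\<phi> x\<bar> \<le> M" using test_functions_bounded[OF \<phi>] by metis
  obtain C where C: "\<And>x. \<bar>lap s \<phi> x\<bar> \<le> C" using lap_truncated_bound[OF s \<phi>] by metis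
  note frac = frac_laplacian_test_function[OF s \<phi>, of c]
  have "\<phi> \<in> borel_measurable lebesgue" by (rule measurable_completion) measurable
  moreover have "bounded (\<phi> ` \<Omega>)" using M by (auto simp: bounded_iff)
  moreover have "bounded (frac_laplacian c s \<phi> ` \<Omega>)"
    unfolding bounded_iff frac using C by (intro exI[of _ "\<bar>c\<bar> * C"]) (auto simp: frac abs_mult intro!: mult_left_mono)
  moreover have "\<forall>x\<in>\<Omega>. \<exists>L. has_frac_laplacian c s \<phi> x L"
    using has_frac_laplacian_test_function[OF s \<phi>] by blast
  ultimately have "(LINT x:\<Omega>|lebesgue. u x * frac_laplacian c s \<phi> x) = (LINT x:\<Omega>|lebesgue. f (u x) * \<phi> x)"
    using sol z unfolding L1_weak_solution_def by blast
  also have "\<dots> = (LINT x|lborel. f (v x) * \<phi> x)"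
    by (rule integral_test_function_representative[OF \<Omega>(1) _ _ _ u]) (simp_all add: z)
  finally have rhs: "(LINT x:\<Omega>|lebesgue. u x * frac_laplacian c s \<phi> x) = (LINT x|lborel. f (v x) * \<phi> x)" .
  have "(LINT x:\<Omega>|lebesgue. u x * frac_laplacian c s \<phi> x) = (LINT x|lborel. v x * (c * lap s \<phi> x))"
    unfolding frac
    by (rule integral_test_function_representative[OF \<Omega>(1) _ _ _ u, where g="\<lambda>x. x"]) (simp_all add: vz)
  also have "\<dots> = c * (LINT x|lborel. v x * lap s \<phi> x)"
    by (subst integral_mult_right_zero[symmetric]) (simp add: mult_ac)
  also have "(LINT x|lborel. v x * lap s \<phi> x) = 1 / 2 * bil s v \<phi>"
  proof (rule integral_mult_lap[OF s \<phi>])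
    show "integrable lborel v" using \<Omega> emeasure_bounded_finite[OF \<Omega>(2)] by (intro hs0_integrable[OF v]) auto
    show "gagliardo s v < \<infinity>" using v by (simp add: hs0_def)
  qed
  finally show ?thesis using rhs by simp
qed

theorem theorem1p8:
  fixes \<Omega> :: "'a::euclidean_space set" and s c :: real
    and f :: "real \<Rightarrow> real" and u :: "'a \<Rightarrow> real"
  assumes "0 < s" and "s < 1" and "0 < c"
    and "bounded_smooth_domain \<Omega>"
    and "f C1_differentiable_on UNIV" and "strictly_convex f" and "f 0 = 0"
    and "u \<in> energy_space c s \<Omega>"
    and "AE x in lebesgue. 0 \<le> u x"
    and "L1_weak_solution c s \<Omega> f u"
    and "stable c s \<Omega> f u"
  shows "(AE x in lebesgue. u x = 0) \<and>
         0 < first_eigenvalue c s \<Omega> \<and> deriv f 0 \<le> first_eigenvalue c s \<Omega>"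
proof -
  note s = assms(1,2) and c = assms(3) and dom = assms(4)
  have \<Omega>: "open \<Omega>" "bounded \<Omega>" "\<Omega> \<noteq> {}" using dom by (auto simp: bounded_smooth_domain_def)
  have um: "u \<in> borel_measurable lebesgue" "set_integrable lebesgue \<Omega> (\<lambda>x. (u x)\<^sup>2)" "energy c s \<Omega> u < \<infinity>"
    using assms(8) by (auto simp: energy_space_def)
  have [measurable]: "f \<in> borel_measurable borel" "deriv f \<in> borel_measurable borel"
    using C1_has_continuous_deriv(2,3)[OF assms(5)] by (auto intro: borel_measurable_continuous_onI)
  have sol: "set_integrable lebesgue \<Omega> (\<lambda>x. f (u x) * infdist x (frontier \<Omega>) powr s)"
    "AE x in lebesgue. x \<notin> \<Omega> \<longrightarrow> u x = 0"
    using assms(10) by (auto simp: L1_weak_solution_def)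
  obtain v0 where v0: "hs0 s \<Omega> v0" "AE x in lborel. u x = v0 x"
    using energy_space0_representative[OF c \<Omega>(1) um sol(2)] by metis
  \<comment> \<open>The modulus makes the representative nonnegative everywhere; it still agrees
    with \<open>u\<close> almost everywhere and stays in \<open>hs0\<close>.\<close>
  define v where "v x = \<bar>v0 x\<bar>" for x
  have AEv: "AE x in lborel. u x = v x"
    using v0(2) assms(9)[unfolded AE_completion_iff] by eventually_elim (simp add: v_def)
  have "gagliardo s v \<le> gagliardo s v0" unfolding v_def by (rule gagliardo_lipschitz) simp
  moreover have "v \<in> borel_measurable borel" unfolding v_def[abs_def] using hs0_measurable[OF v0(1)] by measurable
  ultimately have v: "hs0 s \<Omega> v" "\<And>x. 0 \<le> v x"
    using v0(1) by (auto simp: hs0_def v_def l2_def intro: order.strict_trans1)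
  have [measurable]: "v \<in> borel_measurable borel" using v(1) by (rule hs0_measurable)
  have stab: "(LINT x|lborel. deriv f (v x) * (\<xi> x)\<^sup>2) \<le> c / 2 * enn2real (gagliardo s \<xi>)" if \<xi>: "\<xi> \<in> test_functions \<Omega>" for \<xi>
  proof -
    have [measurable]: "\<xi> \<in> borel_measurable borel" using \<xi> by (rule test_functions_measurable)
    have z: "\<xi> x = 0" if "x \<notin> \<Omega>" for x using test_functions_supportE[OF \<xi>] that by (metis subsetD)
    have "(LINT x:\<Omega>|lebesgue. deriv f (u x) * (\<xi> x)\<^sup>2) = (LINT x|lborel. deriv f (v x) * (\<xi> x)\<^sup>2)"
      by (rule integral_test_function_representative[OF \<Omega>(1) _ _ _ um(1) AEv]) (simp_all add: z)
    moreover have "enn2real (energy c s \<Omega> \<xi>) = c / 2 * enn2real (gagliardo s \<xi>)"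
      using c hs0_energy_space0(2)[OF c \<Omega>(1) test_functions_hs0[OF s \<xi>]] by (simp add: enn2real_mult)
    ultimately show ?thesis using assms(11) \<xi> unfolding stable_def by fastforce
  qed
  have vanish: "AE x in lborel. v x = 0"
  proof (rule stable_solution_vanishes[OF s _ dom assms(5,6,7) v, of "c / 2"])
    fix K assume K: "compact K" "K \<subseteq> \<Omega>"
    show "integrable lborel (\<lambda>x. indicator K x * f (v x))"
      using AEv by (intro locally_integrable_of_weighted[OF \<Omega> s(1) K _ _ sol(1)]) auto
    have m: "(\<lambda>x. indicator K x * deriv f (v x)) \<in> borel_measurable lborel"
      using K(1) by (intro borel_measurable_times borel_measurable_indicator) (auto simp: compact_imp_closed)
    have "set_integrable lebesgue K (\<lambda>x. deriv f (u x))" using assms(11) K by (simp add: stable_def)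
    moreover have "AE x in lebesgue. indicator K x *\<^sub>R deriv f (u x) = indicator K x * deriv f (v x)"
      using AE_completion[OF AEv] by eventually_elim simp
    ultimately have "integrable lebesgue (\<lambda>x. indicator K x * deriv f (v x))"
      unfolding set_integrable_def
      using integrable_cong_AE[OF borel_measurable_integrable measurable_completion[OF m]] by blast
    then show "integrable lborel (\<lambda>x. indicator K x * deriv f (v x))"
      using integrable_completion[OF m] by simp
  next
    fix \<phi> :: "'a \<Rightarrow> real" assume "\<phi> \<in> test_functions \<Omega>"
    then show "c / 2 * bil s v \<phi> = (LINT x|lborel. f (v x) * \<phi> x)"
      by (intro weak_solution_bilinear[OF s \<Omega>(1,2) assms(10) _ um(1) AEv v(1)]) auto
  qed (use c stab in auto)
  \<comment> \<open>Since \<open>v\<close> vanishes almost everywhere, the stability inequality now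
    has the constant potential \<open>deriv f 0\<close>.\<close>
  have "deriv f 0 * enn2real (l2 \<xi>) \<le> c / 2 * enn2real (gagliardo s \<xi>)" if \<xi>: "\<xi> \<in> test_functions \<Omega>" for \<xi>
  proof -
    have [measurable]: "\<xi> \<in> borel_measurable borel" using \<xi> by (rule test_functions_measurable)
    have "(LINT x|lborel. deriv f (v x) * (\<xi> x)\<^sup>2) = (LINT x|lborel. deriv f 0 * (\<xi> x)\<^sup>2)"
      using vanish by (intro integral_cong_AE) auto
    also have "\<dots> = deriv f 0 * enn2real (l2 \<xi>)"
      using hs0_finite(1)[OF test_functions_hs0[OF s \<xi>]] by (simp add: l2_finite_integrable(2))
    finally show ?thesis using stab[OF \<xi>] by simp
  qed
  from stability_bounds_first_eigenvalue[OF s c dom this]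
  have "0 < first_eigenvalue c s \<Omega>" "deriv f 0 \<le> first_eigenvalue c s \<Omega>" by auto
  moreover have "AE x in lebesgue. u x = 0"
    unfolding AE_completion_iff using AEv vanish by eventually_elim simp
  ultimately show ?thesis by blast
qed

end
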